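(* Let $p\geq 5$ be a prime, $k\geq 1$ an integer and $t\in\{1,\dots,p-1\}$. Let \[S=\{(A,B)\in(\mathbb{F}_{p^k})^2 : 4A^3+27B^2\neq 0\},\] and let $S_t\subset S$ be the set of pairs $(A,B)$ for which the trace $T$ of the $p^k$-th power Frobenius of the elliptic curve $y^2=x^3+Ax+B$ over $\mathbb{F}_{p^k}$ (i.e. $T=p^k+1-\#E(\mathbb{F}_{p^k})$) satisfies $T\equiv t\bmod p$. Then $\#S=p^{2k}-p^k$ and \[\Big|\#S_t-\frac{\#S}{p-1}\Big|\leq 3p^{\frac{3k}{2}+1}.\] *)

theory Defs
  imports Complex_Main
    "HOL-Library.Cardinality"
    "HOL-Computational_Algebra.Primes"
    "HOL-Number_Theory.Cong"
begin

text \<open>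
  The finite field with \<open>p ^ k\<close> elements is a type of sort \<open>{field, finite}\<close> whose cardinality
  is \<open>p ^ k\<close>.
\<close>

text \<open>
  Points, over the field of coefficients, of the projective closure of
  \<open>y\<^sup>2 = x\<^sup>3 + A x + B\<close>: the affine points and the unique point \<open>(0 : 1 : 0)\<close> at infinity.
\<close>

datatype 'a ec_point = Infinity | Affine 'a 'a

definition ec_points :: "'a::field \<Rightarrow> 'a \<Rightarrow> 'a ec_point set" where
  "ec_points A B = insert Infinity {Affine x y | x y. y ^ 2 = x ^ 3 + A * x + B}"

definition frob_trace :: "'a::{field, finite} \<Rightarrow> 'a \<Rightarrow> int" where
  "frob_trace A B = int CARD('a) + 1 - int (card (ec_points A B))"

end

theory Submission
  imports Defs
    "HOL-Computational_Algebra.Computational_Algebra"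
    "HOL-Number_Theory.Residue_Primitive_Roots"
    "HOL-Algebra.Algebraic_Closure_Type"
begin

hide_const (open) Divisibility.prime

text \<open>
  By Euler's criterion and the power sums over \<open>F\<^sub>q\<close>, \<open>q = p ^ k\<close>, the trace is modulo \<open>p\<close> the norm
  from \<open>F\<^sub>q\<close> to \<open>F\<^sub>p\<close> of the Hasse invariant \<open>H(A, B)\<close>, the coefficient of \<open>x ^ (p - 1)\<close> in
  \<open>(x\<^sup>3 + A x + B) ^ ((p - 1) / 2)\<close>. For fixed \<open>A \<noteq> 0\<close> and \<open>p \<ge> 7\<close>, \<open>g = H(A, \<cdot>)\<close> is a nonconstant
  polynomial of degree \<open>m < p / 2\<close>, whose roots are simple because it satisfies the Picard--Fuchs
  differential equation. It therefore suffices to show that each fibre of the map \<open>x \<mapsto> norm (g x)\<close>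
  over \<open>F\<^sub>p\<^sup>*\<close> has \<open>q / (p - 1)\<close> elements up to an error of \<open>m \<surd>q\<close>. (For \<open>p = 5\<close> one has
  \<open>H(A, B) = 2 A\<close>, and the roles of \<open>A\<close> and \<open>B\<close> are exchanged.)

  This is a case of Weil's theorem. Stepanov's method gives \<open>Q / (p - 1) + O(\<surd>Q)\<close> as an upper bound
  for the fibres over the extensions \<open>F\<^sub>Q\<close> of \<open>F\<^sub>q\<close> of suitable degrees, hence also as a lower
  bound, because the fibres together have about \<open>Q\<close> elements. The constants are useless, but
  for a nontrivial character \<open>\<chi>\<close> of \<open>F\<^sub>p\<^sup>*\<close> the sums \<open>S j\<close> of \<open>\<chi> (norm (g x))\<close> over the extension of degree \<open>j\<close> are,
  up to sign, the power sums of the inverse roots of an \<open>L\<close>-function that is a polynomial of degree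
  less than \<open>m\<close>. The crude bounds for \<open>S j\<close>, \<open>j \<rightarrow> \<infinity>\<close>, show that these inverse roots are
  at most \<open>\<surd>q\<close> in absolute value, which yields \<open>(m - 1) \<surd>q\<close> as a bound for \<open>S 1\<close>.
\<close>

section \<open>Stepanov's method\<close>

text \<open>Gaussian elimination, one coefficient position at a time: a polynomial whose coefficient
  at \<open>N\<close> is nonzero serves as pivot, clears that coefficient in the others and leaves
  the family.\<close>

lemma poly_linear_relation:
  fixes G :: "'i \<Rightarrow> 'a::field poly"
  assumes "finite I" and "N < card I"
    and "\<And>i k. i \<in> I \<Longrightarrow> k \<ge> N \<Longrightarrow> poly.coeff (G i) k = 0"
  shows "\<exists>a. (\<exists>i\<in>I. a i \<noteq> 0) \<and> (\<Sum>i\<in>I. Polynomial.smult (a i) (G i)) = 0"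
  using assms
proof (induction N arbitrary: I G)
  case 0
  then have "G i = 0" if "i \<in> I" for i
    using that by (intro poly_eqI) auto
  moreover have "I \<noteq> {}"
    using 0 by auto
  ultimately show ?case
    by (intro exI[of _ "\<lambda>_. 1"]) auto
next
  case (Suc N)
  show ?case
  proof (cases "\<exists>i\<in>I. poly.coeff (G i) N \<noteq> 0")
    case False
    have "poly.coeff (G i) k = 0" if "i \<in> I" "k \<ge> N" for i k
      using that False Suc.prems(3)[of i k] by (cases "k = N") auto
    then show ?thesis
      using Suc.prems by (intro Suc.IH) auto
  next
    case True
    then obtain i0 where i0: "i0 \<in> I" "poly.coeff (G i0) N \<noteq> 0"
      by auto
    define c where "c i = poly.coeff (G i) N / poly.coeff (G i0) N" for i
    define G' where "G' i = G i - Polynomial.smult (c i) (G i0)" for i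
    have "poly.coeff (G' i) k = 0" if "i \<in> I - {i0}" "k \<ge> N" for i k
      using that i0 Suc.prems(3)[of i k] Suc.prems(3)[of i0 k]
      by (cases "k = N") (auto simp: G'_def c_def)
    moreover have "N < card (I - {i0})"
      using Suc.prems i0 by simp
    ultimately obtain a where a: "\<exists>i\<in>I - {i0}. a i \<noteq> 0"
      "(\<Sum>i\<in>I - {i0}. Polynomial.smult (a i) (G' i)) = 0"
      using Suc.IH[of "I - {i0}" G'] Suc.prems by blast
    \<comment> \<open>The pivot's coefficient collects the multiples of \<open>G i0\<close> that
      were subtracted in \<open>G'\<close>.\<close>
    define b where "b = a(i0 := - (\<Sum>i\<in>I - {i0}. a i * c i))"
    have "(\<Sum>i\<in>I. Polynomial.smult (b i) (G i)) =
        Polynomial.smult (b i0) (G i0) + (\<Sum>i\<in>I - {i0}. Polynomial.smult (a i) (G i))"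
      using i0 Suc.prems by (subst sum.remove[of _ i0]) (auto simp: b_def)
    also have "\<dots> = (\<Sum>i\<in>I - {i0}. Polynomial.smult (a i) (G' i))"
      by (simp add: b_def G'_def smult_diff_right sum_subtractf smult_sum)
    also have "\<dots> = 0"
      by (rule a)
    finally show ?thesis
      using a(1) by (intro exI[of _ b]) (auto simp: b_def)
  qed
qed

lemma order_linear_power_mult:
  fixes U :: "'a::idom poly"
  assumes "poly U b \<noteq> 0"
  shows "Polynomial.order b ([:- b, 1:] ^ n * U) = n"
proof -
  have "U \<noteq> 0" using assms by auto
  then show ?thesis
    using assms by (subst order_mult) (auto simp: order_power_n_n order_0I)
qed

text \<open>The term of least order at \<open>b\<close> among those with nonzero coefficient cannot
  cancel, since all others are divisible by a higher power of the linear factor.\<close>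

lemma sum_distinct_orders_nonzero:
  fixes M :: "'i \<Rightarrow> 'a::field poly"
  assumes "finite I" and M: "\<And>i. i \<in> I \<Longrightarrow> M i \<noteq> 0"
    and inj: "inj_on (\<lambda>i. Polynomial.order b (M i)) I" and a: "\<exists>i\<in>I. a i \<noteq> 0"
  shows "(\<Sum>i\<in>I. Polynomial.smult (a i) (M i)) \<noteq> 0"
proof
  let ?o = "\<lambda>i. Polynomial.order b (M i)"
  assume 0: "(\<Sum>i\<in>I. Polynomial.smult (a i) (M i)) = 0"
  define i0 where "i0 = arg_min ?o (\<lambda>i. i \<in> I \<and> a i \<noteq> 0)"
  have i0: "i0 \<in> I" "a i0 \<noteq> 0"
    using a arg_min_natI[of "\<lambda>i. i \<in> I \<and> a i \<noteq> 0"] unfolding i0_def by blast+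
  have le: "?o i0 \<le> ?o i" if "i \<in> I" "a i \<noteq> 0" for i
    using that arg_min_nat_le[of "\<lambda>i. i \<in> I \<and> a i \<noteq> 0" i ?o] unfolding i0_def by blast
  have dvd: "[:- b, 1:] ^ Suc (?o i0) dvd Polynomial.smult (a i) (M i)" if i: "i \<in> I - {i0}" for i
  proof (cases "a i = 0")
    case False
    then have "?o i0 < ?o i"
      using le[of i] i i0 inj by (metis DiffD1 DiffD2 inj_on_def insertI1 le_neq_implies_less)
    then have "[:- b, 1:] ^ Suc (?o i0) dvd M i"
      by (metis Suc_leI dvd_trans le_imp_power_dvd order_1)
    then show ?thesis by (rule dvd_smult)
  qed auto
  have "Polynomial.smult (a i0) (M i0) + (\<Sum>i\<in>I - {i0}. Polynomial.smult (a i) (M i)) = 0"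
    using 0 i0 \<open>finite I\<close> by (simp add: sum.remove)
  moreover have "[:- b, 1:] ^ Suc (?o i0) dvd (\<Sum>i\<in>I - {i0}. Polynomial.smult (a i) (M i))"
    by (intro dvd_sum dvd)
  ultimately have "[:- b, 1:] ^ Suc (?o i0) dvd Polynomial.smult (a i0) (M i0)"
    by (metis add_eq_0_iff dvd_minus_iff minus_minus)
  then have "[:- b, 1:] ^ Suc (?o i0) dvd M i0"
    using i0 by (simp add: dvd_smult_iff)
  then show False
    using order_2[OF M[OF i0(1)]] by blast
qed

lemma stepanov_exponents:
  fixes d s :: nat
  assumes "d \<ge> 1"
  shows "((d * s + 1) ^ 2 - 1) div d = s * (d * s + 2)" and "d dvd (d * s + 1) ^ 2 - 1"
proof -
  have "(d * s + 1) ^ 2 - 1 = d * (s * (d * s + 2))"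
    by (simp add: power2_eq_square algebra_simps)
  then show "((d * s + 1) ^ 2 - 1) div d = s * (d * s + 2)" "d dvd (d * s + 1) ^ 2 - 1"
    using assms by simp_all
qed

text \<open>Stepanov's method, with Bombieri's device of using \<open>r\<close>-th powers instead of derivatives.
  The auxiliary polynomial \<open>R\<close> is nonzero since its terms have distinct orders at the simple
  root \<open>b\<close>; on the points that are counted, \<open>R ^ r\<close> agrees with a polynomial \<open>P\<close>
  of degree so small that it can be made to vanish identically.\<close>
lemma stepanov:
  fixes F :: "'a::alg_closed_field poly"
  assumes p: "prime p" "CHAR('a) = p" and r: "r = p ^ \<mu>" "r = d * s + 1"
    and d: "d \<ge> 4" and m: "Polynomial.degree F \<le> m" "s \<ge> m" "s \<ge> 1"
    and b: "Polynomial.order b F = 1" "F \<noteq> 0" "b ^ (r ^ 2) = b"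
  shows "d * card {x. x ^ (r ^ 2) = x \<and> poly F x ^ ((r ^ 2 - 1) div d) = 1} \<le> r ^ 2 + 2 * m * d * r"
proof -
  define Y where "Y = [:- b, 1:]"
  define J where "J = s + m"
  \<comment> \<open>The range of \<open>j\<close> is long enough for \<open>card I\<close> to exceed
    the number \<open>N\<close> of coefficients, yet short enough to keep the degree of
    \<open>R\<close> within about \<open>2 * m * r\<close> of \<open>r ^ 2 / d\<close>.\<close>
  define I where "I = {..<s} \<times> {1..d} \<times> {..<J}"
  define M where "M = (\<lambda>(u,i,j). Y ^ (u + r * j) * F ^ (1 + s * i))"
  define G where "G = (\<lambda>(u,i,j). Y ^ (r * u + j) * F ^ (r - s * i))"
  define N where "N = r * (s - 1) + J + m * (r - s)"
  have r_ge: "r \<ge> 4 * s + 1"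
    using r(2) d mult_le_mono1[of 4 d s] by linarith
  have fI: "finite I" by (simp add: I_def)
  have cardI: "card I = s * d * J"
    by (simp add: I_def card_cartesian_product)
  have "N < card I"
  proof -
    have "int (card I) = int ((r - 1) * J)"
      using r(2) by (simp add: cardI mult_ac)
    also have "\<dots> = (int r - 1) * int J"
      using r(2) by (simp add: of_nat_diff)
    finally have 1: "int (card I) = (int r - 1) * (int s + int m)" by (simp add: J_def)
    have 2: "int N = int r * (int s - 1) + int s + int m + int m * (int r - int s)"
      using m r_ge by (simp add: N_def J_def of_nat_diff)
    \<comment> \<open>The difference \<open>card I - N\<close> equals
      \<open>r + m * s - 2 * (s + m)\<close>.\<close>
    have "2 * (int s + int m) \<le> int r + int m * int s - 1"
    proof -
      have "2 * (s + m) \<le> r - 1" using m r_ge by simp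
      then have "2 * (int s + int m) \<le> int r - 1" using r_ge by simp
      moreover have "int m * int s \<ge> 0" by simp
      ultimately show ?thesis by (smt (verit))
    qed
    then have "int N < int (card I)"
      unfolding 1 2 by (simp add: algebra_simps)
    then show ?thesis by simp
  qed
  have degY: "Polynomial.degree (Y ^ n) = n" for n
    by (simp add: Y_def degree_linear_power)
  have degF: "Polynomial.degree (F ^ n) \<le> m * n" for n
    using degree_power_le[of F n] m(1) by (meson le_trans mult_le_mono1)
  have si: "s * i \<le> r - 1" "s \<le> s * i" if "1 \<le> i" "i \<le> d" for i
    using that r(2) mult_le_mono2[of i d s] by (auto simp: mult.commute)
  have "poly.coeff (G t) k = 0" if t: "t \<in> I" and k: "k \<ge> N" for t k
  proof -
    obtain u i j where t': "t = (u,i,j)" "u < s" "1 \<le> i" "i \<le> d" "j < J"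
      using t by (auto simp: I_def)
    have "Polynomial.degree (G t) \<le> (r * u + j) + m * (r - s * i)"
      unfolding G_def t'(1) using degree_mult_le[of "Y ^ (r * u + j)" "F ^ (r - s * i)"]
        degF[of "r - s * i"] degY[of "r * u + j"] by simp
    also have "r * u \<le> r * (s - 1)" using t' by auto
    also have "r * (s - 1) + j + m * (r - s * i) < N"
    proof -
      have "m * (r - s * i) \<le> m * (r - s)"
        using si(2)[of i] t' by (intro mult_le_mono2 diff_le_mono2) auto
      from add_less_le_mono[OF t'(5) this] show ?thesis by (simp add: N_def)
    qed
    finally show ?thesis using k by (intro coeff_eq_0) auto
  qed
  then obtain a' where a': "\<exists>t\<in>I. a' t \<noteq> 0" "(\<Sum>t\<in>I. Polynomial.smult (a' t) (G t)) = 0"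
    using poly_linear_relation[OF fI \<open>N < card I\<close>, of G] by blast
  have "r > 0" using r(2) by simp
  \<comment> \<open>With \<open>r\<close>-th roots as coefficients of \<open>R\<close>, the additive
    power \<open>R ^ r\<close> carries the coefficients \<open>a'\<close> of the relation.\<close>
  have "\<exists>y. y ^ r = a' t" for t
    using nth_root_exists[OF \<open>r > 0\<close>, of "a' t"] .
  then obtain a where a: "\<And>t. a t ^ r = a' t" by metis
  define R where "R = (\<Sum>t\<in>I. Polynomial.smult (a t) (M t))"
  obtain F1 where F1: "F = Y * F1" "poly F1 b \<noteq> 0"
  proof -
    obtain F1 where "F = [:- b, 1:] ^ 1 * F1" "\<not> [:- b, 1:] dvd F1"
      using order_decomp[OF b(2), of b] b(1) by auto
    then show ?thesis
      using that[of F1] by (auto simp: Y_def poly_eq_0_iff_dvd)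
  qed
  have ordM: "Polynomial.order b (M (u,i,j)) = u + s * i + r * j + 1" "M (u,i,j) \<noteq> 0" for u i j
  proof -
    have "M (u,i,j) = Y ^ (u + s * i + r * j + 1) * F1 ^ (1 + s * i)"
      by (simp add: M_def F1(1) power_mult_distrib power_add mult_ac)
    moreover have "poly (F1 ^ (1 + s * i)) b \<noteq> 0" using F1 by simp
    ultimately show "Polynomial.order b (M (u,i,j)) = u + s * i + r * j + 1"
      using order_linear_power_mult unfolding Y_def by metis
    show "M (u,i,j) \<noteq> 0"
      using b(2) by (simp add: M_def Y_def)
  qed
  have "inj_on (\<lambda>t. Polynomial.order b (M t)) I"
  proof (rule inj_onI)
    fix t t'
    assume tt': "t \<in> I" "t' \<in> I" and ord_eq: "Polynomial.order b (M t) = Polynomial.order b (M t')"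
    obtain u i j u' i' j' where t_eq: "t = (u,i,j)" "t' = (u',i',j')"
      by (metis prod.exhaust)
    note t = tt'[unfolded t_eq]
    note eq = ord_eq[unfolded t_eq]
    \<comment> \<open>The orders are read as digits: since \<open>u < s\<close> and
      \<open>u + s * (i - 1) < r\<close>, division by \<open>r\<close> and then by \<open>s\<close>
      recovers \<open>j\<close>, \<open>i\<close> and \<open>u\<close>.\<close>
    have eq: "(u + s * (i - 1)) + r * j = (u' + s * (i' - 1)) + r * j'"
    proof -
      have "s * i = s * (i - 1) + s" "s * i' = s * (i' - 1) + s"
        using t by (auto simp: I_def algebra_simps simp flip: mult_Suc_right)
      then show ?thesis using eq by (simp add: ordM)
    qed
    have lt: "u + s * (i - 1) < r" if "(u,i,j) \<in> I" for u i j
    proof -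
      have "s * (i - 1) \<le> s * (d - 1)" using that by (auto simp: I_def)
      also have "s * (d - 1) = s * d - s" by (simp add: diff_mult_distrib2)
      finally have "s * (i - 1) \<le> s * d - s" .
      moreover have "s * 1 \<le> s * d" using d by (intro mult_le_mono2) simp
      moreover have "u < s" using that by (simp add: I_def)
      ultimately show ?thesis unfolding r(2) mult.commute[of d s] by linarith
    qed
    have j: "j = j'"
      using arg_cong[OF eq, of "\<lambda>x. x div r"] lt[OF t(1)] lt[OF t(2)] \<open>r > 0\<close> by simp
    with eq have eq2: "u + s * (i - 1) = u' + s * (i' - 1)" by simp
    have "s > 0" using m by simp
    have "i - 1 = i' - 1"
      using arg_cong[OF eq2, of "\<lambda>x. x div s"] t \<open>s > 0\<close> by (simp add: I_def)
    moreover have "u = u'"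
      using arg_cong[OF eq2, of "\<lambda>x. x mod s"] t \<open>s > 0\<close> by (simp add: I_def)
    ultimately show "t = t'"
      using j t by (auto simp: I_def t_eq)
  qed
  moreover have "\<exists>t\<in>I. a t \<noteq> 0"
    using a' a \<open>r > 0\<close> by (metis power_0_left less_numeral_extra(3))
  ultimately have R0: "R \<noteq> 0"
    unfolding R_def using ordM(2) fI by (intro sum_distinct_orders_nonzero) auto
  define Z where "Z = {x. x ^ (r ^ 2) = x \<and> poly F x ^ ((r ^ 2 - 1) div d) = 1}"
  have "poly R x = 0" if x: "x \<in> Z" for x
  proof -
    \<comment> \<open>A counted point satisfies \<open>poly F x ^ (s * (r + 1)) = 1\<close>, and
      \<open>r * (1 + s * i)\<close> exceeds \<open>r - s * i\<close> by the multiple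
      \<open>s * (r + 1) * i\<close>.\<close>
    have 1: "poly F x ^ (r * (1 + s * i)) = poly F x ^ (r - s * i)" if i: "1 \<le> i" "i \<le> d" for i
    proof -
      define c where "c = r - s * i"
      have c: "r = s * i + c"
        using si(1)[OF i] by (simp add: c_def)
      have "d * s + 2 = r + 1" using r(2) by simp
      moreover have "r * (1 + s * i) = c + s * (r + 1) * i"
        by (simp add: algebra_simps c)
      ultimately have "r * (1 + s * i) = (r - s * i) + s * (d * s + 2) * i"
        by (simp add: c_def)
      then show ?thesis
        using x stepanov_exponents(1)[of d s] d r(2) unfolding Z_def
        by (simp add: power_add power_mult)
    qed
    \<comment> \<open>Both \<open>x\<close> and \<open>b\<close> are fixed by the additive
      \<open>r ^ 2\<close>-power map, so the exponent \<open>r * r * j\<close> of \<open>Y\<close>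
      in the \<open>r\<close>-th power of \<open>M (u,i,j)\<close> collapses to
      \<open>j\<close>.\<close>
    have "(x - b) ^ (r ^ 2) = x ^ (r ^ 2) - b ^ (r ^ 2)"
    proof -
      have "r ^ 2 = CHAR('a) ^ (\<mu> * 2)" by (simp add: p r power_mult)
      then have "((x - b) + b) ^ (r ^ 2) = (x - b) ^ (r ^ 2) + b ^ (r ^ 2)"
        using p by (intro freshmans_dream') auto
      then show ?thesis by simp
    qed
    then have 2: "(x - b) ^ (r * r) = x - b"
      using x b by (simp add: Z_def power2_eq_square)
    have Yx: "poly Y x = x - b" by (simp add: Y_def)
    have term_eq: "(a t * poly (M t) x) ^ r = a' t * poly (G t) x" if t: "t \<in> I" for t
    proof -
      obtain u i j where t': "t = (u,i,j)" "1 \<le> i" "i \<le> d"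
        using t by (auto simp: I_def)
      have "(a t * poly (M t) x) ^ r =
          a' t * ((x - b) ^ (r * u) * ((x - b) ^ (r * r)) ^ j * poly F x ^ (r * (1 + s * i)))"
        unfolding M_def t'(1) a[symmetric]
        by (simp add: Yx power_mult_distrib power_add mult_ac flip: power_mult)
      also have "\<dots> = a' t * poly (G t) x"
        unfolding 1[OF t'(2,3)] 2 by (simp add: G_def t'(1) Yx power_add)
      finally show ?thesis .
    qed
    have "poly R x ^ r = (\<Sum>t\<in>I. (a t * poly (M t) x) ^ r)"
      unfolding R_def poly_sum poly_smult using p r by (intro freshmans_dream_sum') auto
    also have "\<dots> = (\<Sum>t\<in>I. a' t * poly (G t) x)"
      by (intro sum.cong term_eq) auto
    also have "\<dots> = poly (\<Sum>t\<in>I. Polynomial.smult (a' t) (G t)) x"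
      by (simp add: poly_sum)
    also have "\<dots> = 0" using a' by simp
    finally show ?thesis using \<open>r > 0\<close> by simp
  qed
  then have "card Z \<le> card {x. poly R x = 0}"
    using R0 by (intro card_mono poly_roots_finite) auto
  also have "\<dots> \<le> Polynomial.degree R"
    by (rule card_poly_roots_bound[OF R0])
  also have "\<dots> \<le> (s - 1) + r * (J - 1) + m * r"
    unfolding R_def
  proof (rule degree_sum_le[OF fI])
    fix t assume t: "t \<in> I"
    then obtain u i j where t': "t = (u,i,j)" "u < s" "1 \<le> i" "i \<le> d" "j < J"
      by (auto simp: I_def)
    have "Polynomial.degree (Polynomial.smult (a t) (M t)) \<le> u + r * j + m * (1 + s * i)"
      using degree_mult_le[of "Y ^ (u + r * j)" "F ^ (1 + s * i)"] degF[of "1 + s * i"]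
        degY[of "u + r * j"] degree_smult_le[of "a t" "M t"] by (simp add: M_def t'(1))
    also have "m * (1 + s * i) \<le> m * r"
      using si[OF t'(3,4)] \<open>r > 0\<close> by (intro mult_le_mono) auto
    also have "r * j \<le> r * (J - 1)" using t' by auto
    also have "u \<le> s - 1" using t' by auto
    finally show "Polynomial.degree (Polynomial.smult (a t) (M t)) \<le> s - 1 + r * (J - 1) + m * r"
      by simp
  qed
  finally have "d * card Z \<le> d * ((s - 1) + r * (J - 1) + m * r)" by simp
  also have "int \<dots> \<le> int (r ^ 2 + 2 * m * d * r)"
  proof -
    have "int (d * ((s - 1) + r * (J - 1) + m * r)) =
        int d * (int s - 1 + int r * (int s + int m - 1) + int m * int r)"
      using m by (simp add: J_def of_nat_diff)
    also have "\<dots> = (int d * int s) * (1 + int r) - int d - int d * int r + 2 * int m * int d *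
      int r"
      by (simp add: algebra_simps)
    also have "int d * int s = int r - 1" using r(2) by simp
    also have "(int r - 1) * (1 + int r) = int r ^ 2 - 1" by (simp add: power2_eq_square
      algebra_simps)
    finally have "int (d * ((s - 1) + r * (J - 1) + m * r)) =
      int r ^ 2 - 1 - int d - int d * int r + 2 * int m * int d * int r" .
    moreover have "int d * int r \<ge> 0" by simp
    moreover have "int (r ^ 2 + 2 * m * d * r) = int r ^ 2 + 2 * int m * int d * int r" by simp
    ultimately show ?thesis by linarith
  qed
  finally show ?thesis unfolding Z_def by (simp only: of_nat_le_iff)
qed

section \<open>Power sums and polynomial L-functions\<close>

text \<open>The polynomial \<open>P\<close> below filters out one of the values \<open>w ^ n0\<close>, whose powers are
  then bounded by \<open>O(R ^ (n0 * j))\<close>.\<close>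
lemma norm_le_if_power_sums_le:
  fixes W :: "complex multiset"
  assumes n0: "n0 \<ge> 1" and R: "R > 0"
    and bound: "\<And>j. j \<ge> 1 \<Longrightarrow> norm (\<Sum>w\<in>#W. w ^ (n0 * j)) \<le> C * R ^ (n0 * j)"
    and w0: "w0 \<in># W"
  shows "norm w0 \<le> R"
proof -
  define f where "f w = w ^ n0" for w :: complex
  define A where "A = f ` set_mset W - {f w0}"
  define P where "P = (\<Prod>a\<in>A. [:- a, 1:])"
  have A: "finite A" by (simp add: A_def)
  have P0: "poly P (f w) = 0 \<longleftrightarrow> f w \<in> A" for w
    using A by (simp add: P_def poly_prod)
  define K where "K = norm (of_nat (size {#w \<in># W. f w = f w0#}) * poly P (f w0))"
  have "size {#w \<in># W. f w = f w0#} \<noteq> 0"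
    using w0 by (auto simp: filter_mset_eq_conv)
  then have K: "K > 0"
    using P0[of w0] by (auto simp: K_def A_def)
  define D where "D = (\<Sum>l\<le>Polynomial.degree P. norm (poly.coeff P l) * (C * R ^ (n0 * l)))"
  have main: "K * norm (f w0) ^ j \<le> D * (R ^ n0) ^ j" if j: "j \<ge> 1" for j
  proof -
    \<comment> \<open>Every other value \<open>f w\<close> is a root of \<open>P\<close>, so only
      entries with \<open>f w = f w0\<close> survive; expanding \<open>P\<close> turns the same sum
      into power sums at the shifted exponents \<open>j + l\<close>.\<close>
    have "(\<Sum>w\<in>#W. f w ^ j * poly P (f w)) =
        (\<Sum>w\<in>#W. if f w = f w0 then f w0 ^ j * poly P (f w0) else 0)"
    proof (intro arg_cong[of _ _ sum_mset] image_mset_cong)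
      fix w assume "w \<in># W"
      then show "f w ^ j * poly P (f w) = (if f w = f w0 then f w0 ^ j * poly P (f w0) else 0)"
        using P0[of w] by (auto simp: A_def)
    qed
    also have "\<dots> = of_nat (size {#w \<in># W. f w = f w0#}) * (f w0 ^ j * poly P (f w0))"
      by (induction W) (auto simp: algebra_simps)
    finally have "K * norm (f w0) ^ j = norm (\<Sum>w\<in>#W. f w ^ j * poly P (f w))"
      by (simp add: K_def norm_mult norm_power)
    also have "(\<Sum>w\<in>#W. f w ^ j * poly P (f w)) =
        (\<Sum>w\<in>#W. \<Sum>l\<le>Polynomial.degree P. poly.coeff P l * w ^ (n0 * (j + l)))"
      by (simp add: poly_altdef sum_distrib_left power_add power_mult f_def mult_ac)
    also have "\<dots> = (\<Sum>l\<le>Polynomial.degree P. poly.coeff P l * (\<Sum>w\<in>#W. w ^ (n0 * (j + l))))"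
      by (induction W) (simp_all add: sum.distrib algebra_simps)
    also have "norm \<dots> \<le> (\<Sum>l\<le>Polynomial.degree P. norm (poly.coeff P l) * (C * R ^ (n0 * (j + l))))"
      by (rule sum_norm_le) (use j bound in \<open>auto simp: norm_mult intro!: mult_left_mono\<close>)
    also have "\<dots> = D * (R ^ n0) ^ j"
      unfolding D_def sum_distrib_right
      by (intro sum.cong) (simp_all add: distrib_left power_add flip: power_mult)
    finally show ?thesis .
  qed
  have "norm (f w0) \<le> R ^ n0"
  proof (rule ccontr)
    assume "\<not> ?thesis"
    then have "1 < norm (f w0) / R ^ n0" using R by (simp add: field_simps)
    then obtain j where "D / K < (norm (f w0) / R ^ n0) ^ j"
      using real_arch_pow by blast
    also have "\<dots> \<le> (norm (f w0) / R ^ n0) ^ Suc j"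
      using \<open>1 < norm (f w0) / R ^ n0\<close> by (intro power_increasing) auto
    finally have "D * (R ^ n0) ^ Suc j < K * norm (f w0) ^ Suc j"
      using K R by (simp add: field_simps power_divide)
    then show False using main[of "Suc j"] by simp
  qed
  then show ?thesis
    using n0 R power_mono_iff[of "norm w0" R n0] by (simp add: f_def norm_power)
qed

text \<open>Logarithmic derivatives turn products into sums, and each factor contributes minus the
  geometric series without its constant term.\<close>

lemma fps_X_deriv_prod_linear:
  fixes W :: "'a::field_char_0 multiset"
  defines "L \<equiv> (\<lambda>W. \<Prod>w\<in>#W. 1 - fps_const w * fps_X)"
  shows "fps_X * fps_deriv (L W) = - (L W * Abs_fps (\<lambda>j. if j = 0 then 0 else \<Sum>w\<in>#W. w ^ j))"
proof (induction W)
  case empty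
  show ?case by (simp add: L_def fps_eq_iff)
next
  case (add w W)
  let ?S = "\<lambda>W. Abs_fps (\<lambda>j. if j = 0 then 0 else \<Sum>w\<in>#W. w ^ j)"
  let ?l = "1 - fps_const w * fps_X"
  have geo: "?l * ?S {#w#} = fps_const w * fps_X"
  proof -
    have "?l * ?S {#w#} = ?S {#w#} - fps_const w * (fps_X * ?S {#w#})"
      by (simp only: left_diff_distrib mult_1_left mult.assoc)
    also have "\<dots> = fps_const w * fps_X"
    proof (rule fps_ext)
      fix n show "fps_nth (?S {#w#} - fps_const w * (fps_X * ?S {#w#})) n = fps_nth (fps_const w
        * fps_X) n"
        by (cases n) (simp_all add: fps_X_nth)
    qed
    finally show ?thesis .
  qed
  have S: "?S (add_mset w W) = ?S {#w#} + ?S W"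
    by (rule fps_ext) auto
  have L_add: "L (add_mset w W) = ?l * L W"
    by (simp add: L_def)
  have deriv_l: "fps_deriv ?l = - fps_const w"
    by simp
  have ring1: "x * (l * D + - c * M) = l * (x * D) - c * x * M" for x l D c M :: "'a fps"
    by (simp only: distrib_left mult_minus_left mult_minus_right diff_conv_add_uminus mult_ac)
  have ring2: "l * (- (M * S)) - l * T * M = - (l * M * (T + S))" for l M S T :: "'a fps"
    by (simp only: distrib_left mult_minus_left mult_minus_right diff_conv_add_uminus
      minus_add_distrib mult_ac add_ac)
  have "fps_X * fps_deriv (L (add_mset w W)) = fps_X * (?l * fps_deriv (L W) + - fps_const w * L W)"
    by (simp only: L_add fps_deriv_mult deriv_l)
  also have "\<dots> = ?l * (fps_X * fps_deriv (L W)) - fps_const w * fps_X * L W"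
    by (rule ring1)
  also have "\<dots> = ?l * (- (L W * ?S W)) - ?l * ?S {#w#} * L W"
    by (simp only: add.IH geo)
  also have "\<dots> = - (L (add_mset w W) * (?S {#w#} + ?S W))"
    unfolding L_add by (rule ring2)
  finally show ?case unfolding S .
qed

text \<open>Here \<open>c\<close> are the coefficients of a polynomial \<open>L\<close>-function and \<open>S\<close> those of its logarithmic
  derivative.\<close>
lemma L_function_bound:
  fixes c S :: "nat \<Rightarrow> complex"
  assumes c0: "c 0 = 1" and cm: "\<And>n. n \<ge> m \<Longrightarrow> c n = 0"
    and newton: "\<And>n. of_nat n * c n = (\<Sum>j=1..n. S j * c (n - j))"
    and n0: "n0 \<ge> 1" and R: "R > 0"
    and bound: "\<And>j. j \<ge> 1 \<Longrightarrow> norm (S (n0 * j)) \<le> C * R ^ (n0 * j)"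
  shows "norm (S 1) \<le> real (m - 1) * R"
proof -
  \<comment> \<open>By \<open>cm\<close> the sequence \<open>c\<close> has finite support, so it
    defines a polynomial, of degree at most \<open>m - 1\<close>.\<close>
  define P where "P = Abs_poly c"
  have coeffP: "poly.coeff P n = c n" for n
  proof -
    have "\<forall>\<^sub>\<infinity>n. c n = 0"
      unfolding MOST_nat using cm by (meson less_imp_le_nat)
    then show ?thesis by (simp add: P_def Abs_poly_inverse)
  qed
  have P0: "poly P 0 = 1"
    by (simp add: poly_0_coeff_0 coeffP c0)
  then have "P \<noteq> 0" by auto
  then obtain Z where Z: "size Z = Polynomial.degree P"
    "P = Polynomial.smult (Polynomial.lead_coeff P) (\<Prod>z\<in>#Z. [:- z, 1:])"
    using alg_closed_imp_factorization by blast
  define W where "W = image_mset inverse Z"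
  have degP: "Polynomial.degree P \<le> m - 1"
    by (rule degree_le) (auto simp: coeffP cm)
  have Z0: "0 \<notin># Z"
  proof
    assume "0 \<in># Z"
    then have "poly P 0 = 0"
      by (subst Z(2)) (auto simp: poly_prod_mset image_iff)
    then show False using P0 by simp
  qed
  have "(\<Prod>z\<in>#Z. [:- z, 1:]) = Polynomial.smult (\<Prod>z\<in>#Z. - z) (\<Prod>z\<in>#Z. [:1, - inverse z:])"
    using Z0
  proof (induction Z)
    case (add x Z)
    then have x: "[:- x, 1:] = Polynomial.smult (- x) [:1, - inverse x:]" by simp
    have IH: "(\<Prod>z\<in>#Z. [:- z, 1:]) = Polynomial.smult (\<Prod>z\<in>#Z. - z) (\<Prod>z\<in>#Z. [:1, - inverse z:])"
      using add by simp
    show ?case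
      unfolding image_mset_add_mset prod_mset.add_mset IH x
      by (simp only: mult_smult_left mult_smult_right smult_smult mult_ac)
  qed simp
  moreover have "Polynomial.lead_coeff P * (\<Prod>z\<in>#Z. - z) = 1"
  proof -
    have "poly (\<Prod>z\<in>#Z. [:- z, 1:]) 0 = (\<Prod>z\<in>#Z. - z)"
      by (induction Z) auto
    then show ?thesis using P0 Z(2) by (metis poly_smult)
  qed
  ultimately have P_eq: "P = (\<Prod>z\<in>#Z. [:1, - inverse z:])"
    using Z(2) by (metis smult_1_left smult_smult)
  have "fps_of_poly (\<Prod>z\<in>#Z. [:1, - inverse z:]) = (\<Prod>w\<in>#W. 1 - fps_const w * fps_X)"
  proof -
    have "fps_of_poly [:1, - w:] = 1 - fps_const w * fps_X" for w :: complex
      by (simp add: fps_of_poly_pCons flip: fps_const_neg)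
    then show ?thesis
      unfolding W_def
      by (induction Z) (simp_all only: image_mset_empty image_mset_add_mset prod_mset.add_mset
            prod_mset_empty fps_of_poly_mult fps_of_poly_1)
  qed
  then have L: "fps_of_poly P = (\<Prod>w\<in>#W. 1 - fps_const w * fps_X)"
    unfolding P_eq[symmetric] .
  define G where "G = Abs_fps (\<lambda>j. if j = 0 then 0 else S j)"
  define PS where "PS = Abs_fps (\<lambda>j. if j = 0 then 0 else \<Sum>w\<in>#W. w ^ j)"
  \<comment> \<open>The hypothesis \<open>newton\<close> identifies this series with
    \<open>P * G\<close>, the factorization with \<open>- (P * PS)\<close>; cancelling
    \<open>P\<close> exhibits \<open>S j\<close> as minus a power sum of the inverse roots.\<close>
  have "fps_X * fps_deriv (fps_of_poly P) = fps_of_poly P * G"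
  proof (rule fps_ext)
    fix n
    have "fps_nth (fps_of_poly P * G) n = (\<Sum>j=0..n. fps_nth G j * c (n - j))"
      by (subst mult.commute) (simp add: fps_mult_nth coeffP)
    also have "\<dots> = (\<Sum>j=1..n. S j * c (n - j))"
      by (simp add: sum.atLeast_Suc_atMost G_def)
    also have "\<dots> = of_nat n * c n" by (rule newton[symmetric])
    also have "\<dots> = fps_nth (fps_X * fps_deriv (fps_of_poly P)) n"
      by (cases n) (simp_all add: coeffP)
    finally show "fps_nth (fps_X * fps_deriv (fps_of_poly P)) n = fps_nth (fps_of_poly P * G) n"
      by simp
  qed
  also have "fps_X * fps_deriv (fps_of_poly P) = - (fps_of_poly P * PS)"
    unfolding L PS_def by (rule fps_X_deriv_prod_linear)
  finally have "fps_of_poly P * (G + PS) = 0"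
    by (metis add.right_inverse add.commute distrib_left)
  then have GPS: "G = - PS"
    using \<open>P \<noteq> 0\<close> by (simp add: eq_neg_iff_add_eq_0)
  have S: "S j = - (\<Sum>w\<in>#W. w ^ j)" if "j \<ge> 1" for j
    using arg_cong[OF GPS, of "\<lambda>f. fps_nth f j"] that by (simp add: G_def PS_def)
  have W_le: "norm w \<le> R" if "w \<in># W" for w
  proof (rule norm_le_if_power_sums_le[OF n0 R _ that])
    fix j :: nat assume "j \<ge> 1"
    moreover from this have "n0 * j \<ge> 1" using n0 by simp
    ultimately show "norm (\<Sum>w\<in>#W. w ^ (n0 * j)) \<le> C * R ^ (n0 * j)"
      using bound[of j] S[of "n0 * j"] by simp
  qed
  have "norm (S 1) = norm (\<Sum>w\<in>#W. w)" using S[of 1] by simp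
  also have "\<dots> \<le> real (size W) * R"
    using W_le
  proof (induction W)
    case (add w W)
    have "norm (\<Sum>w\<in>#add_mset w W. w) \<le> norm w + norm (\<Sum>w\<in>#W. w)"
      by (simp add: norm_triangle_ineq)
    then show ?case using add.IH add.prems by (force simp: algebra_simps)
  qed simp
  also have "\<dots> \<le> real (m - 1) * R"
    using degP Z(1) R by (intro mult_right_mono) (auto simp: W_def)
  finally show ?thesis .
qed

section \<open>Newton identities of a permutation\<close>

text \<open>A multiset rather than a set: a walk longer than the period of \<open>x\<close> meets
  its points repeatedly, and the repetitions count.\<close>

definition orbit_mset :: "('a \<Rightarrow> 'a) \<Rightarrow> 'a \<Rightarrow> nat \<Rightarrow> 'a multiset" where
  "orbit_mset \<phi> x j = image_mset (\<lambda>i. (\<phi> ^^ i) x) (mset_set {..<j})"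

lemma size_orbit_mset [simp]: "size (orbit_mset \<phi> x j) = j"
  by (simp add: orbit_mset_def)

lemma orbit_mset_0 [simp]: "orbit_mset \<phi> x 0 = {#}"
  by (simp add: orbit_mset_def)

lemma orbit_mset_Suc: "orbit_mset \<phi> x (Suc j) = add_mset ((\<phi> ^^ j) x) (orbit_mset \<phi> x j)"
  by (simp add: orbit_mset_def lessThan_Suc)

lemma orbit_mset_add: "orbit_mset \<phi> x (i + j) = orbit_mset \<phi> x i + orbit_mset \<phi> ((\<phi> ^^ i) x) j"
proof (induction j)
  case (Suc j)
  have "(\<phi> ^^ (i + j)) x = (\<phi> ^^ j) ((\<phi> ^^ i) x)"
    by (subst add.commute) (simp add: funpow_add)
  with Suc show ?case by (simp add: orbit_mset_Suc)
qed simp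

text \<open>Applying \<open>\<phi>\<close> shifts the walk by one place; a closed walk gains at its
  end the point that it loses at its start.\<close>

lemma orbit_mset_stable:
  assumes "(\<phi> ^^ j) x = x"
  shows "image_mset \<phi> (orbit_mset \<phi> x j) = orbit_mset \<phi> x j"
proof -
  have "add_mset x (image_mset \<phi> (orbit_mset \<phi> x j)) = orbit_mset \<phi> x (Suc j)"
    by (induction j) (simp_all add: orbit_mset_Suc)
  then show ?thesis
    using assms by (simp add: orbit_mset_Suc)
qed

lemma funpow_multiple_fixed:
  assumes "(\<phi> ^^ e) x = x"
  shows "(\<phi> ^^ (e * b)) x = x"
  using assms by (induction b) (simp_all add: funpow_add)

text \<open>Closed walks at \<open>x\<close> have length \<open>e * b\<close> with \<open>e\<close>
  the period, and run \<open>b\<close> times through the cycle. As multiplicities in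
  \<open>D\<close> are constant along the cycle, such a walk fits into \<open>D\<close> exactly for
  \<open>b \<le> count D x\<close>.\<close>

lemma card_orbits_below:
  assumes inj: "inj \<phi>" and D: "image_mset \<phi> D = D" and x: "x \<in># D"
  shows "card {j\<in>{1..size D}. (\<phi> ^^ j) x = x \<and> orbit_mset \<phi> x j \<subseteq># D} = count D x"
proof -
  have inj_pow: "inj (\<phi> ^^ i)" for i
    using inj by (induction i) (auto intro: inj_compose)
  have cnt: "count D ((\<phi> ^^ i) y) = count D y" for i y
  proof (induction i)
    case (Suc i)
    have "count D (\<phi> ((\<phi> ^^ i) y)) = count (image_mset \<phi> D) (\<phi> ((\<phi> ^^ i) y))"
      by (simp add: D)
    also have "\<dots> = count D ((\<phi> ^^ i) y)"
    proof -
      have "\<phi> -` {\<phi> z} \<inter> set_mset D = (if z \<in># D then {z} else {})" for z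
        using inj by (auto simp: inj_def)
      then show ?thesis
        by (simp add: count_image_mset not_in_iff)
    qed
    finally show ?case using Suc by simp
  qed simp
  have range: "(\<phi> ^^ i) x \<in># D" for i
    using cnt[of i x] x by (simp add: count_greater_zero_iff[symmetric] del: count_greater_zero_iff)
  \<comment> \<open>The forward orbit stays in the finite support of \<open>D\<close>, so it
    repeats, and injectivity turns the repetition into a return to \<open>x\<close>.\<close>
  have "\<not> inj_on (\<lambda>i. (\<phi> ^^ i) x) UNIV"
  proof
    assume "inj_on (\<lambda>i. (\<phi> ^^ i) x) UNIV"
    moreover have "range (\<lambda>i. (\<phi> ^^ i) x) \<subseteq> set_mset D" using range by auto
    ultimately show False
      using finite_set_mset finite_imageD finite_subset infinite_UNIV_nat by metis
  qed
  then obtain i j where ij: "i < j" "(\<phi> ^^ i) x = (\<phi> ^^ j) x"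
    unfolding inj_on_def by (metis linorder_neqE_nat)
  then have "(\<phi> ^^ i) x = (\<phi> ^^ i) ((\<phi> ^^ (j - i)) x)"
    by (metis add_diff_inverse_nat comp_apply funpow_add less_imp_not_less)
  then have "(\<phi> ^^ (j - i)) x = x"
    using inj_pow[of i] by (simp add: inj_def)
  then have ex: "\<exists>e. e > 0 \<and> (\<phi> ^^ e) x = x"
    using ij by (intro exI[of _ "j - i"]) auto
  define e where "e = (LEAST e. e > 0 \<and> (\<phi> ^^ e) x = x)"
  have e: "e > 0" "(\<phi> ^^ e) x = x"
    using LeastI_ex[OF ex] by (simp_all add: e_def)
  have e_least: "(\<phi> ^^ i) x \<noteq> x" if "0 < i" "i < e" for i
    using not_less_Least[of i "\<lambda>e. e > 0 \<and> (\<phi> ^^ e) x = x"] that by (auto simp: e_def)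
  have per: "(\<phi> ^^ j) x = x \<longleftrightarrow> e dvd j" for j
  proof
    assume "e dvd j"
    then show "(\<phi> ^^ j) x = x"
      using funpow_multiple_fixed[OF e(2)] by (auto elim: dvdE)
  next
    assume j: "(\<phi> ^^ j) x = x"
    have "(\<phi> ^^ (j mod e)) x = (\<phi> ^^ (j mod e)) ((\<phi> ^^ (e * (j div e))) x)"
      using funpow_multiple_fixed[OF e(2)] by simp
    also have "\<dots> = (\<phi> ^^ (j mod e + e * (j div e))) x"
      by (simp only: funpow_add comp_apply)
    finally have "(\<phi> ^^ (j mod e)) x = x" using j by simp
    then have "j mod e = 0" using e_least[of "j mod e"] e(1) by auto
    then show "e dvd j" by auto
  qed
  have orbit_inj: "inj_on (\<lambda>i. (\<phi> ^^ i) x) {..<e}"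
  proof (rule linorder_inj_onI)
    fix i j assume ij: "i < j" "i \<in> {..<e}" "j \<in> {..<e}"
    show "(\<phi> ^^ i) x \<noteq> (\<phi> ^^ j) x"
    proof
      assume "(\<phi> ^^ i) x = (\<phi> ^^ j) x"
      also have "\<dots> = (\<phi> ^^ i) ((\<phi> ^^ (j - i)) x)"
        using ij by (simp flip: funpow_add comp_apply[of "\<phi> ^^ i"])
      finally have "(\<phi> ^^ (j - i)) x = x"
        using inj_pow[of i] by (simp add: inj_def)
      moreover have "j - i < e" using ij by (simp add: less_imp_diff_less)
      ultimately show False using e_least[of "j - i"] ij by simp
    qed
  qed auto
  have orbit_e: "orbit_mset \<phi> x e = mset_set ((\<lambda>i. (\<phi> ^^ i) x) ` {..<e})"
    unfolding orbit_mset_def by (rule image_mset_mset_set[OF orbit_inj])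
  have orbit_eb: "orbit_mset \<phi> x (e * b) = repeat_mset b (orbit_mset \<phi> x e)" for b
    by (induction b) (simp_all add: orbit_mset_add e)
  have sub: "orbit_mset \<phi> x (e * b) \<subseteq># D \<longleftrightarrow> b \<le> count D x" for b
  proof
    assume "orbit_mset \<phi> x (e * b) \<subseteq># D"
    then have "count (orbit_mset \<phi> x (e * b)) x \<le> count D x"
      by (rule mset_subset_eq_count)
    moreover have "x \<in> (\<lambda>i. (\<phi> ^^ i) x) ` {..<e}" using e(1) by (auto intro: image_eqI[of _ _ 0])
    ultimately show "b \<le> count D x" by (simp add: orbit_eb orbit_e)
  next
    assume b: "b \<le> count D x"
    show "orbit_mset \<phi> x (e * b) \<subseteq># D"
    proof (rule mset_subset_eqI)
      fix y show "count (orbit_mset \<phi> x (e * b)) y \<le> count D y"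
      proof (cases "y \<in> (\<lambda>i. (\<phi> ^^ i) x) ` {..<e}")
        case True
        then show ?thesis using b cnt by (auto simp: orbit_eb orbit_e)
      qed (simp add: orbit_eb orbit_e)
    qed
  qed
  have "{j\<in>{1..size D}. (\<phi> ^^ j) x = x \<and> orbit_mset \<phi> x j \<subseteq># D} = (\<lambda>b. e * b) ` {1..count D x}"
  proof (intro equalityI subsetI)
    fix j assume "j \<in> {j\<in>{1..size D}. (\<phi> ^^ j) x = x \<and> orbit_mset \<phi> x j \<subseteq># D}"
    then obtain b where "j = e * b" "j \<ge> 1" "orbit_mset \<phi> x (e * b) \<subseteq># D"
      by (auto simp: per elim: dvdE)
    then show "j \<in> (\<lambda>b. e * b) ` {1..count D x}"
      using sub[of b] by (intro image_eqI[of _ _ b]) (cases b; simp)+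
  next
    fix j assume "j \<in> (\<lambda>b. e * b) ` {1..count D x}"
    then obtain b where b: "j = e * b" "1 \<le> b" "b \<le> count D x"
      by (metis atLeastAtMost_iff imageE)
    then have "orbit_mset \<phi> x j \<subseteq># D" using sub by simp
    then show "j \<in> {j\<in>{1..size D}. (\<phi> ^^ j) x = x \<and> orbit_mset \<phi> x j \<subseteq># D}"
      using b e(1) size_mset_mono[of "orbit_mset \<phi> x j" D] by (auto simp: per)
  qed
  also have "card \<dots> = count D x"
    using e(1) by (subst card_image) (auto simp: inj_on_def)
  finally show ?thesis .
qed

lemma sum_mset_count: "size D = (\<Sum>x\<in>set_mset D. count D x)"
  by (simp add: size_multiset_overloaded_eq)

text \<open>The Newton identities of the zeta function of a permutation, twisted by a multiplicative
  weight \<open>w\<close>: a stable multiset of size \<open>n\<close> contains exactly \<open>n\<close> pairs of a point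
  \<open>x\<close> and a closed walk \<open>x, \<phi> x, \<dots>, (\<phi> ^^ j) x = x\<close>.\<close>
lemma newton_stable_msets:
  fixes w :: "'a multiset \<Rightarrow> 'b::comm_ring_1"
  assumes inj: "inj \<phi>"
    and w: "\<And>D E. image_mset \<phi> D = D \<Longrightarrow> image_mset \<phi> E = E \<Longrightarrow> w (D + E) = w D * w E"
    and fin: "\<And>n. finite {D. image_mset \<phi> D = D \<and> size D = n}"
    and fin_fix: "\<And>j. j \<ge> 1 \<Longrightarrow> finite {x. (\<phi> ^^ j) x = x}"
  defines "c \<equiv> \<lambda>n. \<Sum>D | image_mset \<phi> D = D \<and> size D = n. w D"
    and "S \<equiv> \<lambda>j. \<Sum>x | (\<phi> ^^ j) x = x. w (orbit_mset \<phi> x j)"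
  shows "of_nat n * c n = (\<Sum>j=1..n. S j * c (n - j))"
proof -
  define \<D> where "\<D> n = {D. image_mset \<phi> D = D \<and> size D = n}" for n
  have fin: "finite (\<D> n)" for n using fin by (simp add: \<D>_def)
  define A where "A D j = {x. (\<phi> ^^ j) x = x \<and> orbit_mset \<phi> x j \<subseteq># D}" for D j
  \<comment> \<open>Counted by points first, each \<open>x\<close> contributes
    \<open>count D x\<close> lengths, and these add up to \<open>size D\<close>.\<close>
  have cardA: "(\<Sum>j=1..n. card (A D j)) = n" if D: "D \<in> \<D> n" for D
  proof -
    have sz: "size D = n" and st: "image_mset \<phi> D = D" using D by (auto simp: \<D>_def)
    have A_sub: "A D j = {x\<in>set_mset D. (\<phi> ^^ j) x = x \<and> orbit_mset \<phi> x j \<subseteq># D}" if "j \<ge> 1" for j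
    proof -
      have "x \<in># D" if "orbit_mset \<phi> x j \<subseteq># D" for x
      proof -
        have "x \<in># orbit_mset \<phi> x j"
          using \<open>j \<ge> 1\<close> by (auto simp: orbit_mset_def intro!: image_eqI[of _ _ 0])
        then show ?thesis using that by (rule mset_subset_eqD[rotated])
      qed
      then show ?thesis by (auto simp: A_def)
    qed
    have "(\<Sum>j=1..n. card (A D j)) = (\<Sum>j=1..n. \<Sum>x\<in>set_mset D. if (\<phi> ^^ j) x = x \<and> orbit_mset \<phi> x
      j \<subseteq># D then 1 else 0)"
      by (intro sum.cong refl) (simp add: A_sub sum.If_cases Int_def)
    also have "\<dots> = (\<Sum>x\<in>set_mset D. \<Sum>j=1..n. if (\<phi> ^^ j) x = x \<and> orbit_mset \<phi> x j \<subseteq># D then 1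
      else 0)"
      by (rule sum.swap)
    also have "\<dots> = (\<Sum>x\<in>set_mset D. count D x)"
    proof (intro sum.cong refl)
      fix x assume x: "x \<in># D"
      show "(\<Sum>j=1..n. if (\<phi> ^^ j) x = x \<and> orbit_mset \<phi> x j \<subseteq># D then 1 else 0) = count D x"
        using card_orbits_below[OF inj st x] sz by (simp add: sum.If_cases Int_def)
    qed
    also have "\<dots> = n" using sz by (simp add: sum_mset_count)
    finally show ?thesis .
  qed
  have finA: "finite (A D j)" if "j \<ge> 1" for D j
    using fin_fix[OF that] by (rule finite_subset[rotated]) (auto simp: A_def)
  have "of_nat n * c n = (\<Sum>D\<in>\<D> n. of_nat (\<Sum>j=1..n. card (A D j)) * w D)"
    unfolding c_def \<D>_def[symmetric] sum_distrib_left by (intro sum.cong refl) (simp only: cardA)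
  also have "\<dots> = (\<Sum>D\<in>\<D> n. \<Sum>j=1..n. \<Sum>x\<in>A D j. w D)"
    by (simp add: sum_distrib_right)
  also have "\<dots> = (\<Sum>j=1..n. \<Sum>D\<in>\<D> n. \<Sum>x\<in>A D j. w D)"
    by (rule sum.swap)
  also have "\<dots> = (\<Sum>j=1..n. S j * c (n - j))"
  proof (intro sum.cong refl)
    fix j assume j: "j \<in> {1..n}"
    have "(\<Sum>D\<in>\<D> n. \<Sum>x\<in>A D j. w D) = (\<Sum>(D,x)\<in>Sigma (\<D> n) (\<lambda>D. A D j). w D)"
      using fin finA j by (subst sum.Sigma) auto
    also have "\<dots> = (\<Sum>(x,E)\<in>{x. (\<phi> ^^ j) x = x} \<times> \<D> (n - j). w (orbit_mset \<phi> x j) * w E)"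
    \<comment> \<open>Splitting off the walk: \<open>(D, x)\<close> corresponds to \<open>x\<close>
      together with the remainder of \<open>D\<close>, which is again stable, and \<open>w\<close>
      factors accordingly.\<close>
    proof (rule sum.reindex_bij_witness[of _ "\<lambda>(x,E). (orbit_mset \<phi> x j + E, x)"
          "\<lambda>(D,x). (x, D - orbit_mset \<phi> x j)"], goal_cases)
      case (1 a) then show ?case by (auto simp: A_def)
    next
      case (2 a)
      then obtain D x where a: "a = (D,x)" "D \<in> \<D> n" "x \<in> A D j" by auto
      obtain E where E: "D = orbit_mset \<phi> x j + E"
        using a(3) by (auto simp: A_def mset_subset_eq_exists_conv)
      have "image_mset \<phi> E = E"
        using a(2,3) orbit_mset_stable[of j \<phi> x] by (simp add: \<D>_def E A_def)
      then show ?case using a E j by (auto simp: A_def \<D>_def)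
    next
      case (3 b) then show ?case by auto
    next
      case (4 b) then show ?case using j by (auto simp: A_def \<D>_def orbit_mset_stable)
    next
      case (5 a)
      then obtain D x where a: "a = (D,x)" "D \<in> \<D> n" "x \<in> A D j" by auto
      obtain E where E: "D = orbit_mset \<phi> x j + E"
        using a(3) by (auto simp: A_def mset_subset_eq_exists_conv)
      have "image_mset \<phi> E = E"
        using a(2,3) orbit_mset_stable[of j \<phi> x] by (simp add: \<D>_def E A_def)
      then show ?case using a(3) orbit_mset_stable[of j \<phi> x] by (simp add: a(1) E A_def w)
    qed
    also have "\<dots> = S j * c (n - j)"
      unfolding S_def c_def \<D>_def[symmetric] by (simp add: sum_product sum.cartesian_product)
    finally show "(\<Sum>D\<in>\<D> n. \<Sum>x\<in>A D j. w D) = S j * c (n - j)" .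
  qed
  finally show ?thesis .
qed

section \<open>Finite fields and their algebraic closure\<close>

text \<open>Multiplication by a nonzero \<open>x\<close> permutes the nonzero elements; comparing
  their products gives the claim.\<close>

lemma finite_field_power_card:
  fixes x :: "'a::{field,finite}"
  shows "x ^ CARD('a) = x"
proof (cases "x = 0")
  case False
  have "x ^ (CARD('a) - 1) * \<Prod>(UNIV - {0}) = (\<Prod>y\<in>UNIV - {0}. x * y)"
    by (simp add: prod.distrib)
  also have "\<dots> = \<Prod>(UNIV - {0})"
    by (rule prod.reindex_bij_witness[of _ "\<lambda>y. y / x" "\<lambda>y. x * y"]) (use False in auto)
  finally have "x ^ (CARD('a) - 1) = 1"
    by (simp add: prod_zero_iff)
  then show ?thesis
    using power_minus_mult[of "CARD('a)" x] by simp
qed (simp add: zero_less_card_finite)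

lemma CHAR_finite_field:
  assumes "prime p" "CARD('a::{field,finite}) = p ^ k"
  shows "CHAR('a) = p"
proof -
  have "prime CHAR('a)"
    by (intro prime_CHAR_semidom finite_imp_CHAR_pos) simp
  moreover have "CHAR('a) dvd p ^ k"
    using CHAR_dvd_CARD[where ?'a = 'a] assms by simp
  ultimately show ?thesis
    using assms(1) prime_dvd_power primes_dvd_imp_eq by blast
qed

lemma frobenius_add:
  fixes x y :: "'a::comm_ring_1"
  assumes "prime p" "CHAR('a) = p"
  shows "(x + y) ^ (p ^ n) = x ^ (p ^ n) + y ^ (p ^ n)"
  using assms by (intro freshmans_dream') auto

lemma frobenius_inj:
  fixes x y :: "'a::idom"
  assumes "prime p" "CHAR('a) = p" "x ^ (p ^ n) = y ^ (p ^ n)"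
  shows "x = y"
proof -
  have "(x - y) ^ (p ^ n) + y ^ (p ^ n) = x ^ (p ^ n)"
    using frobenius_add[OF assms(1,2), of "x - y" y n] by simp
  then have "(x - y) ^ (p ^ n) = 0" using assms(3) by simp
  then show ?thesis by simp
qed

section \<open>Linear factors and roots of polynomials\<close>

lemma proots_prod_mset_linear: "proots (\<Prod>x\<in>#A. [:- x, 1:] :: 'a::idom poly) = A"
proof (induction A)
  case (add x A)
  have "(\<Prod>x\<in>#A. [:- x, 1:] :: 'a poly) \<noteq> 0"
    by (auto simp: prod_mset_zero_iff)
  then show ?case using add by (simp add: proots_mult del: mult_pCons_left)
qed simp

lemma degree_lead_coeff_prod_linear:
  "Polynomial.degree (\<Prod>x\<in>#A. [:- x, 1:] :: 'b::idom poly) = size A"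
  "Polynomial.lead_coeff (\<Prod>x\<in>#A. [:- x, 1:] :: 'b::idom poly) = 1"
proof (induction A)
  case (add x A)
  have nz: "(\<Prod>x\<in>#A. [:- x, 1:] :: 'b poly) \<noteq> 0" by (auto simp: prod_mset_zero_iff)
  show "Polynomial.degree (\<Prod>x\<in>#add_mset x A. [:- x, 1:] :: 'b poly) = size (add_mset x A)"
    using nz add.IH(1) by (simp add: degree_mult_eq del: mult_pCons_left)
  show "Polynomial.lead_coeff (\<Prod>x\<in>#add_mset x A. [:- x, 1:] :: 'b poly) = 1"
    using add.IH(2) by (simp only: image_mset_add_mset prod_mset.add_mset lead_coeff_mult) simp
qed simp_all

lemma poly_eq_prod_proots:
  fixes P :: "'a::alg_closed_field poly"
  assumes "P \<noteq> 0"
  shows "P = Polynomial.smult (Polynomial.lead_coeff P) (\<Prod>x\<in>#proots P. [:- x, 1:])"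
    and "size (proots P) = Polynomial.degree P"
proof -
  obtain A where A: "size A = Polynomial.degree P"
    "P = Polynomial.smult (Polynomial.lead_coeff P) (\<Prod>x\<in>#A. [:- x, 1:])"
    using alg_closed_imp_factorization[OF assms] by blast
  have "proots P = A"
    by (subst A(2)) (use assms in \<open>simp add: proots_prod_mset_linear\<close>)
  with A show "P = Polynomial.smult (Polynomial.lead_coeff P) (\<Prod>x\<in>#proots P. [:- x, 1:])"
    "size (proots P) = Polynomial.degree P" by auto
qed

text \<open>The polynomial \<open>X ^ (p ^ n) - X\<close> has derivative -1, hence no multiple
  roots, and so as many roots as its degree.\<close>

lemma card_frobenius_fixed:
  assumes p: "prime p" "CHAR('a::alg_closed_field) = p" and n: "n \<ge> 1"
  shows "card {x::'a. x ^ (p ^ n) = x} = p ^ n"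
proof -
  define Q where "Q = p ^ n"
  define P where "P = Polynomial.monom 1 Q - Polynomial.monom (1::'a) 1"
  have Q: "Q > 1" using prime_gt_1_nat[OF p(1)] n unfolding Q_def by (intro one_less_power) auto
  have deg: "Polynomial.degree P = Q"
    unfolding P_def diff_conv_add_uminus using Q
    by (subst degree_add_eq_left) (auto simp: degree_monom_eq)
  then have P0: "P \<noteq> 0" using Q by auto
  have roots: "poly P x = 0 \<longleftrightarrow> x ^ Q = x" for x
    by (auto simp: P_def poly_monom)
  have "of_nat Q = (0::'a)"
    using p n by (simp add: Q_def of_nat_eq_0_iff_char_dvd dvd_power)
  then have pd: "pderiv P = -1"
    by (simp add: P_def pderiv_diff pderiv_monom monom_0 one_pCons)
  have ord: "Polynomial.order x P \<le> 1" for x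
  proof (rule ccontr)
    assume "\<not> ?thesis"
    then have "[:- x, 1:] ^ 2 dvd P"
      by (subst order_divides) auto
    then obtain R where "P = [:- x, 1:] ^ 2 * R"
      by (rule dvdE)
    then have "P = [:- x, 1:] * ([:- x, 1:] * R)"
      by (simp only: power2_eq_square mult.assoc)
    then have "poly (pderiv P) x = 0"
      by (simp only: pderiv_mult) simp
    then show False by (simp add: pd)
  qed
  have "Q = size (proots P)" using poly_eq_prod_proots(2)[OF P0] deg by simp
  also have "\<dots> = (\<Sum>x\<in>set_mset (proots P). count (proots P) x)"
    by (rule sum_mset_count)
  also have "\<dots> = (\<Sum>x\<in>set_mset (proots P). 1)"
  proof (intro sum.cong refl)
    fix x assume "x \<in># proots P"
    then have "count (proots P) x \<ge> 1" by simp
    then show "count (proots P) x = 1" using ord[of x] P0 by simp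
  qed
  also have "\<dots> = card {x::'a. x ^ Q = x}" using P0 by (simp add: roots)
  finally show ?thesis by (simp add: Q_def)
qed

section \<open>Polynomials under homomorphisms of their coefficients\<close>

lemma map_poly_hom_mult:
  fixes f :: "'a::comm_semiring_1 \<Rightarrow> 'b::comm_semiring_1"
  assumes f: "f 0 = 0" "\<And>x y. f (x + y) = f x + f y" "\<And>x y. f (x * y) = f x * f y"
  shows "map_poly f (P * Q) = map_poly f P * map_poly f Q"
proof (rule poly_eqI)
  fix n
  have f_sum: "f (sum h A) = (\<Sum>i\<in>A. f (h i))" for h :: "nat \<Rightarrow> 'a" and A
    by (induction A rule: infinite_finite_induct) (simp_all add: f)
  show "poly.coeff (map_poly f (P * Q)) n = poly.coeff (map_poly f P * map_poly f Q) n"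
    by (simp add: coeff_map_poly f coeff_mult f_sum)
qed

lemma map_poly_hom_prod_mset_linear:
  fixes f :: "'a::comm_ring_1 \<Rightarrow> 'b::comm_ring_1"
  assumes f: "f 0 = 0" "f 1 = 1" "\<And>x y. f (x + y) = f x + f y" "\<And>x y. f (x * y) = f x * f y"
  shows "map_poly f (\<Prod>x\<in>#A. [:- x, 1:]) = (\<Prod>x\<in>#A. [:- f x, 1:])"
proof (induction A)
  case (add x A)
  have "f (- x) + f x = 0" using f(3)[of "- x" x] f(1) by simp
  then have "f (- x) = - f x" by (simp add: eq_neg_iff_add_eq_0)
  then show ?case
    using add by (simp add: map_poly_hom_mult[OF f(1,3,4)] map_poly_pCons f del: mult_pCons_left)
qed (simp add: f)

lemma map_poly_to_ac_mult: "map_poly to_ac (P * Q) = map_poly to_ac P * map_poly to_ac Q"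
  by (rule map_poly_hom_mult) simp_all

lemma map_poly_to_ac_add: "map_poly to_ac (P + Q) = map_poly to_ac P + map_poly to_ac Q"
  by (rule poly_eqI) (simp add: coeff_map_poly)

lemma poly_map_poly_to_ac: "poly (map_poly to_ac P) (to_ac x) = to_ac (poly P x)"
  by (induction P) (simp_all add: map_poly_pCons)

lemma degree_map_poly_to_ac [simp]: "Polynomial.degree (map_poly to_ac P) = Polynomial.degree P"
  by (rule degree_map_poly) simp

lemma map_poly_to_ac_eq_iff: "map_poly to_ac P = map_poly to_ac Q \<longleftrightarrow> P = Q"
  by (auto simp: poly_eq_iff coeff_map_poly)

lemma finite_poly_degree_less: "finite {P :: 'a::{zero,finite} poly. Polynomial.degree P \<le> n}"
proof (rule finite_imageD)
  have "(\<lambda>P. map (poly.coeff P) [0..<Suc n]) ` {P :: 'a poly. Polynomial.degree P \<le> n}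
      \<subseteq> {xs. set xs \<subseteq> UNIV \<and> length xs = Suc n}" by auto
  then show "finite ((\<lambda>P. map (poly.coeff P) [0..<Suc n]) ` {P :: 'a poly. Polynomial.degree P \<le>
    n})"
    by (rule finite_subset) (rule finite_lists_length_eq, simp)
  show "inj_on (\<lambda>P. map (poly.coeff P) [0..<Suc n]) {P :: 'a poly. Polynomial.degree P \<le> n}"
  proof (rule inj_onI)
    fix P Q :: "'a poly"
    assume deg: "P \<in> {P. Polynomial.degree P \<le> n}" "Q \<in> {P. Polynomial.degree P \<le> n}"
      and eq: "map (poly.coeff P) [0..<Suc n] = map (poly.coeff Q) [0..<Suc n]"
    show "P = Q"
    proof (rule poly_eqI)
      fix i show "poly.coeff P i = poly.coeff Q i"
      proof (cases "i \<le> n")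
        case True
        then show ?thesis using arg_cong[OF eq, of "\<lambda>xs. xs ! i"] by (simp del: upt_Suc)
      next
        case False
        then show ?thesis using deg by (simp add: coeff_eq_0)
      qed
    qed
  qed
qed

lemma eq_0_if_dvd_degree_less:
  fixes h :: "'b::idom poly"
  assumes "f dvd h" "Polynomial.degree h < Polynomial.degree f"
  shows "h = 0"
  using assms dvd_imp_degree_le[of f h] by linarith

text \<open>Factors are cancelled one at a time, which also covers repeated roots; as
  \<open>U\<close> does not vanish at them, each linear factor must divide \<open>V\<close>.\<close>

lemma prod_linear_dvd_mult_cancel:
  fixes U V :: "'a::field poly"
  assumes "(\<Prod>b\<in>#B. [:- b, 1:]) dvd U * V" and "\<And>b. b \<in># B \<Longrightarrow> poly U b \<noteq> 0"
  shows "(\<Prod>b\<in>#B. [:- b, 1:]) dvd V"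
  using assms
proof (induction B arbitrary: V)
  case (add b B)
  from add.prems(1) obtain W where "U * V = (\<Prod>b\<in>#add_mset b B. [:- b, 1:]) * W"
    by (rule dvdE)
  then have W: "U * V = [:- b, 1:] * (\<Prod>b\<in>#B. [:- b, 1:]) * W"
    by (simp only: image_mset_add_mset prod_mset.add_mset)
  then have "poly (U * V) b = 0" by (simp only: poly_mult) simp
  then have "poly V b = 0" using add.prems(2)[of b] by simp
  then have "[:- b, 1:] dvd V" by (simp only: poly_eq_0_iff_dvd)
  then obtain V' where V': "V = [:- b, 1:] * V'" by (rule dvdE)
  have "[:- b, 1:] * (U * V') = U * V"
    unfolding V' by (rule mult.left_commute)
  also have "\<dots> = [:- b, 1:] * ((\<Prod>b\<in>#B. [:- b, 1:]) * W)"
    unfolding W by (rule mult.assoc)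
  finally have "U * V' = (\<Prod>b\<in>#B. [:- b, 1:]) * W"
    by (rule mult_left_cancel[THEN iffD1, rotated]) simp
  then have "(\<Prod>b\<in>#B. [:- b, 1:]) dvd U * V'" by simp
  then have "(\<Prod>b\<in>#B. [:- b, 1:]) dvd V'"
    by (rule add.IH) (use add.prems(2) in auto)
  then show ?case
    unfolding V' by (simp only: image_mset_add_mset prod_mset.add_mset mult_dvd_mono dvd_refl)
qed simp

lemma geometric_sum_nat:
  fixes x :: nat
  assumes "x \<ge> 1"
  shows "(x - 1) * (\<Sum>i<j. x ^ i) = x ^ j - 1"
proof -
  have "Suc ((x - 1) * (\<Sum>i<j. x ^ i)) = x ^ j"
  proof (induction j)
    case (Suc j)
    have "Suc ((x - 1) * (\<Sum>i<Suc j. x ^ i)) = x ^ j + (x - 1) * x ^ j"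
      using Suc by (simp add: distrib_left)
    also have "\<dots> = (1 + (x - 1)) * x ^ j" by (simp add: distrib_right)
    finally show ?case using assms by simp
  qed simp
  then show ?thesis by simp
qed

section \<open>Norm fibres of a polynomial\<close>

text \<open>The simple root over the algebraic closure serves Stepanov's argument, and it excludes
  the degenerate case of a constant times a proper power.\<close>

locale finite_field_poly =
  fixes g :: "'a::{field,finite} poly" and p k :: nat
  assumes prime_p: "prime p" and p_ge: "p \<ge> 5" and k_ge: "k \<ge> 1" and card_field: "CARD('a) = p ^ k"
    and deg_g: "Polynomial.degree g \<ge> 1"
    and simple_root: "\<exists>b. Polynomial.order b (map_poly to_ac g) = 1"
begin

abbreviation m where "m \<equiv> Polynomial.degree g"
abbreviation d where "d \<equiv> p - 1"
abbreviation E :: "'a poly \<Rightarrow> 'a alg_closure poly" where "E \<equiv> map_poly to_ac"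

definition q where "q = p ^ k"

text \<open>\<open>U\<close> is the multiplicative group of the prime field and \<open>N\<close> the norm from the field with \<open>q\<close>
  elements to the prime field. On the field with \<open>Q\<close> elements, \<open>G Q x\<close> is the norm of \<open>g x\<close> to the
  prime field. All fields live in the algebraic closure, as sets of fixed points of powers of
  the Frobenius map \<open>fr\<close>.\<close>

definition fr :: "'a alg_closure \<Rightarrow> 'a alg_closure" where "fr x = x ^ q"

definition U :: "'a alg_closure set" where "U = {x. x ^ d = 1}"

definition N :: "'a alg_closure \<Rightarrow> 'a alg_closure" where "N y = y ^ ((q - 1) div d)"

definition G :: "nat \<Rightarrow> 'a alg_closure \<Rightarrow> 'a alg_closure" where
  "G Q x = poly (E g) x ^ ((Q - 1) div d)"

section \<open>The Frobenius map and its fixed fields\<close>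

lemma CHAR_K [simp]: "CHAR('a) = p"
  using CHAR_finite_field[OF prime_p card_field] .

lemma CHAR_ac: "CHAR('a alg_closure) = p"
  by simp

lemma q_gt_1: "q > 1"
  using p_ge k_ge unfolding q_def by (intro one_less_power) auto

lemma d_dvd: "d dvd p ^ n - 1"
  using geometric_sum_nat[of p n] p_ge by (metis dvd_triv_left le_trans one_le_numeral)

lemma fr_0 [simp]: "fr 0 = 0" and fr_1 [simp]: "fr 1 = 1" and fr_mult: "fr (x * y) = fr x * fr y"
  and fr_add: "fr (x + y) = fr x + fr y"
  using q_gt_1 p_ge frobenius_add[OF prime_p CHAR_ac, of x y k]
  by (auto simp: fr_def power_mult_distrib q_def)

lemma funpow_fr: "(fr ^^ j) x = x ^ (q ^ j)"
  by (induction j) (auto simp: fr_def mult.commute simp flip: power_mult)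

lemma inj_fr: "inj fr"
  using frobenius_inj[OF prime_p CHAR_ac] unfolding inj_def fr_def q_def by blast

lemma fr_eq_0_iff [simp]: "fr x = 0 \<longleftrightarrow> x = 0"
  using q_gt_1 by (auto simp: fr_def)

lemma card_fixed: "n \<ge> 1 \<Longrightarrow> card {x::'a alg_closure. x ^ (p ^ n) = x} = p ^ n"
  by (rule card_frobenius_fixed[OF prime_p]) auto

lemma finite_fixed: "n \<ge> 1 \<Longrightarrow> finite {x::'a alg_closure. x ^ (p ^ n) = x}"
  using card_fixed[of n] p_ge by (intro card_ge_0_finite) auto

lemma fr_to_ac [simp]: "fr (to_ac x) = to_ac x"
  unfolding fr_def q_def by (simp add: finite_field_power_card flip: to_ac_power card_field)

lemma range_to_ac: "range to_ac = {x. fr x = x}"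
proof (rule card_subset_eq)
  show "finite {x. fr x = x}" using finite_fixed[of k] k_ge by (simp add: fr_def q_def)
  show "card (range (to_ac :: 'a \<Rightarrow> _)) = card {x::'a alg_closure. fr x = x}"
    using card_fixed[of k] k_ge card_field by (simp add: card_image inj_to_ac fr_def q_def)
qed auto

section \<open>Galois descent for polynomials over the base field\<close>

lemma map_fr_E: "map_poly fr (E h) = E h"
  by (rule poly_eqI) (simp add: coeff_map_poly)

lemma fr_poly: "fr (poly P x) = poly (map_poly fr P) (fr x)"
  by (induction P) (simp_all add: map_poly_pCons fr_add fr_mult)

lemma fr_poly_E: "fr (poly (E h) x) = poly (E h) (fr x)"
  by (simp add: fr_poly map_fr_E)

lemma E_eq_0_iff [simp]: "E h = 0 \<longleftrightarrow> h = 0"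
  by (simp add: map_poly_eq_0_iff)

lemma coeff_E [simp]: "poly.coeff (E h) i = to_ac (poly.coeff h i)"
  by (simp add: coeff_map_poly)

text \<open>Frobenius fixes the coefficients of \<open>E h\<close>, so it carries the factorization
  into linear factors to another one of the same polynomial.\<close>

lemma stable_proots:
  assumes "h \<noteq> 0"
  shows "image_mset fr (proots (E h)) = proots (E h)"
proof -
  define c where "c = Polynomial.lead_coeff (E h)"
  have c: "c \<noteq> 0" using assms by (simp add: c_def)
  have "E h = [:c:] * (\<Prod>x\<in>#proots (E h). [:- x, 1:])"
    using poly_eq_prod_proots(1)[of "E h"] assms by (simp add: c_def)
  then have "map_poly fr (E h) = map_poly fr ([:c:] * (\<Prod>x\<in>#proots (E h). [:- x, 1:]))"
    by simp
  also have "\<dots> = Polynomial.smult (fr c) (\<Prod>x\<in>#image_mset fr (proots (E h)). [:- x, 1:])"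
    by (simp add: map_poly_smult fr_add fr_mult map_poly_hom_prod_mset_linear map_poly_pCons
        multiset.map_comp o_def)
  finally have "proots (E h) = proots \<dots>" by (simp add: map_fr_E)
  also have "\<dots> = image_mset fr (proots (E h))"
    using c by (simp add: proots_prod_mset_linear del: image_mset.compositionality)
  finally show ?thesis by simp
qed

text \<open>The product of linear factors over a stable multiset has Frobenius-invariant
  coefficients, hence comes from the base field. This turns sums over stable multisets into sums
  over monic polynomials.\<close>

lemma bij_monic_stable:
  "bij_betw (\<lambda>h. proots (E h)) {h. Polynomial.degree h = n \<and> Polynomial.lead_coeff h = 1}
    {D. image_mset fr D = D \<and> size D = n}"
proof (rule bij_betwI')
  fix h h' :: "'a poly"
  assume h: "h \<in> {h. Polynomial.degree h = n \<and> Polynomial.lead_coeff h = 1}"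
    "h' \<in> {h. Polynomial.degree h = n \<and> Polynomial.lead_coeff h = 1}"
  have "E h = (\<Prod>x\<in>#proots (E h). [:- x, 1:])" if "Polynomial.lead_coeff h = 1" for h
  proof -
    have "h \<noteq> 0" using that by auto
    then show ?thesis using poly_eq_prod_proots(1)[of "E h"] that by simp
  qed
  then show "proots (E h) = proots (E h') \<longleftrightarrow> h = h'"
    using h map_poly_to_ac_eq_iff by (metis (mono_tags, lifting) mem_Collect_eq)
next
  fix h :: "'a poly"
  assume h: "h \<in> {h. Polynomial.degree h = n \<and> Polynomial.lead_coeff h = 1}"
  then have "h \<noteq> 0" by auto
  then show "proots (E h) \<in> {D. image_mset fr D = D \<and> size D = n}"
    using h stable_proots poly_eq_prod_proots(2)[of "E h"] by auto
next
  fix D assume D: "D \<in> {D. image_mset fr D = D \<and> size D = n}"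
  define P where "P = (\<Prod>x\<in>#D. [:- x, 1:])"
  define h where "h = map_poly of_ac P"
  have "map_poly fr P = (\<Prod>x\<in>#image_mset fr D. [:- x, 1:])"
    unfolding P_def
    by (simp add: map_poly_hom_prod_mset_linear fr_add fr_mult multiset.map_comp o_def)
  then have "map_poly fr P = P" using D by (simp add: P_def)
  then have "fr (poly.coeff P i) = poly.coeff P i" for i
    by (metis coeff_map_poly fr_0)
  then have "poly.coeff P i \<in> range to_ac" for i by (simp add: range_to_ac)
  then have Eh: "E h = P"
    unfolding h_def by (intro poly_eqI) (simp add: coeff_map_poly to_ac_of_ac)
  have "Polynomial.degree h = n"
    using D Eh degree_lead_coeff_prod_linear(1)[of D] degree_map_poly_to_ac[of h] by (simp add:
      P_def)
  moreover have "Polynomial.lead_coeff h = 1"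
    using degree_lead_coeff_prod_linear(2)[of D] unfolding P_def[symmetric] Eh[symmetric] by simp
  moreover have "D = proots (E h)"
    by (simp add: Eh P_def proots_prod_mset_linear)
  ultimately show "\<exists>h\<in>{h. Polynomial.degree h = n \<and> Polynomial.lead_coeff h = 1}. D = proots (E h)"
    by auto
qed

lemma finite_monic: "finite {h :: 'a poly. Polynomial.degree h = n \<and> Polynomial.lead_coeff h = 1}"
  by (rule finite_subset[OF _ finite_poly_degree_less[of n]]) auto

lemma finite_stable: "finite {D. image_mset fr D = D \<and> size D = n}"
  using bij_betw_finite[OF bij_monic_stable] finite_monic by auto

section \<open>Values of the norm and sizes of its fibres\<close>

lemma N_0 [simp]: "N 0 = 0"
proof -
  have "d > 0" "d \<le> q - 1"
    using p_ge d_dvd[of k] q_gt_1 by (auto simp: q_def intro: dvd_imp_le)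
  then have "(q - 1) div d > 0" by (simp add: div_greater_zero_iff)
  then show ?thesis by (simp add: N_def)
qed

lemma N_1 [simp]: "N 1 = 1" by (simp add: N_def)

lemma N_mult: "N (x * y) = N x * N y" by (simp add: N_def power_mult_distrib)

lemma N_in_U:
  assumes "fr y = y" "y \<noteq> 0"
  shows "N y \<in> U"
proof -
  have "y * y ^ (q - 1) = y * 1"
    using assms(1) q_gt_1 by (simp add: fr_def flip: power_Suc)
  then have "y ^ (q - 1) = 1" by (rule mult_left_cancel[OF assms(2), THEN iffD1])
  moreover have "(q - 1) div d * d = q - 1" using d_dvd[of k] by (simp add: q_def)
  ultimately show ?thesis by (simp add: N_def U_def flip: power_mult)
qed

lemma U_0: "insert 0 U = {x. x ^ p = x}"
proof -
  have "x ^ p = x \<longleftrightarrow> x = 0 \<or> x ^ d = 1" for x :: "'a alg_closure"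
  proof -
    have "x ^ p = x * x ^ d" using p_ge by (simp flip: power_Suc)
    then show ?thesis by auto
  qed
  then show ?thesis by (auto simp: U_def)
qed

lemma U_nonzero: "0 \<notin> U" using p_ge by (auto simp: U_def power_0_left)

lemma finite_U: "finite U" and card_U: "card U = d"
proof -
  have fin: "finite (insert 0 U)" unfolding U_0 using finite_fixed[of 1] by simp
  then show "finite U" by simp
  have "card (insert 0 U) = p" unfolding U_0 using card_fixed[of 1] by simp
  then show "card U = d" using U_nonzero \<open>finite U\<close> by simp
qed

lemma roots_E_bound: "card {x. poly (E g) x = 0} \<le> m" and finite_roots_E: "finite {x. poly (E g)
  x = 0}"
proof -
  have "E g \<noteq> 0" using deg_g by auto
  then show "card {x. poly (E g) x = 0} \<le> m" "finite {x. poly (E g) x = 0}"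
    using card_poly_roots_bound[of "E g"] poly_roots_finite[of "E g"] by auto
qed

text \<open>Stepanov's method needs the root \<open>b\<close> in a finite field. Multiplicity one in
  the stable multiset of roots provides a closed walk at \<open>b\<close>, whose length is
  \<open>e\<close>.\<close>

lemma periodic_simple_root: "\<exists>b e. Polynomial.order b (E g) = 1 \<and> e \<ge> 1 \<and> b ^ (q ^ e) = b"
proof -
  obtain b where b: "Polynomial.order b (E g) = 1" using simple_root by auto
  have g0: "g \<noteq> 0" using deg_g by auto
  then have "b \<in># proots (E g)" using b by (simp add: order_root)
  define A where "A = {j\<in>{1..size (proots (E g))}. (fr ^^ j) b = b \<and> orbit_mset fr b j \<subseteq># proots
    (E g)}"
  have "card A = 1"
    using card_orbits_below[OF inj_fr stable_proots[OF g0] \<open>b \<in># proots (E g)\<close>] b g0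
    by (simp add: A_def)
  then obtain j where "j \<in> A" by (auto simp: card_1_singleton_iff)
  then show ?thesis using b by (auto simp: funpow_fr A_def)
qed

text \<open>Scaling \<open>g\<close> by a suitable constant moves the fibre over \<open>t\<close> to
  the fibre over 1, which \<open>stepanov\<close> bounds, and preserves the order at
  \<open>b\<close>.\<close>

lemma card_norm_fiber_upper:
  assumes r: "r = p ^ \<mu>" "r = d * s + 1" and s: "s \<ge> m"
    and b: "Polynomial.order b (E g) = 1" "b ^ (r ^ 2) = b" and t: "t \<in> U"
  shows "d * card {x. x ^ (r ^ 2) = x \<and> G (r ^ 2) x = t} \<le> r ^ 2 + 2 * m * d * r"
proof -
  have s1: "s \<ge> 1" using s deg_g by simp
  have d: "d \<ge> 4" using p_ge by simp
  have "r > 1" using r(2) s1 d by simp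
  then have "r ^ 2 > 1" by (rule one_less_power) simp
  moreover have dv: "d dvd r ^ 2 - 1"
    using stepanov_exponents(2)[of d s] r(2) d by simp
  ultimately have pos: "(r ^ 2 - 1) div d > 0"
    using p_ge by (simp add: div_greater_zero_iff dvd_imp_le)
  obtain c where c: "c ^ ((r ^ 2 - 1) div d) = inverse t"
    using nth_root_exists[OF pos] by blast
  have t0: "t \<noteq> 0" using t U_nonzero by auto
  then have c0: "c \<noteq> 0" using c pos by (auto simp: power_0_left)
  define F where "F = Polynomial.smult c (E g)"
  have "d * card {x. x ^ (r ^ 2) = x \<and> poly F x ^ ((r ^ 2 - 1) div d) = 1} \<le> r ^ 2 + 2 * m * d * r"
    using c0 deg_g b
    by (intro stepanov[OF prime_p _ r d _ s s1]) (auto simp: F_def order_smult)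
  moreover have "poly F x ^ ((r ^ 2 - 1) div d) = 1 \<longleftrightarrow> G (r ^ 2) x = t" for x
    unfolding F_def G_def poly_smult power_mult_distrib c using t0 by (simp add: field_simps)
  ultimately show ?thesis by simp
qed

text \<open>Since \<open>k dvd n\<close>, the field with \<open>p ^ n\<close> elements contains the
  coefficients of \<open>g\<close>, so \<open>g\<close> maps it into itself.\<close>

lemma G_in_U:
  assumes "x ^ (p ^ n) = x" "poly (E g) x \<noteq> 0" "k dvd n"
  shows "G (p ^ n) x \<in> U"
proof -
  let ?y = "poly (E g) x"
  obtain j where j: "n = k * j" using assms(3) by (rule dvdE)
  have "(fr ^^ j) (poly (E g) x) = poly (E g) ((fr ^^ j) x)"
    by (induction j) (simp_all add: fr_poly_E)
  then have "?y ^ (p ^ n) = ?y"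
    using assms(1) by (simp add: funpow_fr j q_def power_mult)
  then have "?y * ?y ^ (p ^ n - 1) = ?y * 1"
    using p_ge power_minus_mult[of "p ^ n" ?y] by (simp add: mult.commute)
  then have "?y ^ (p ^ n - 1) = 1" by (rule mult_left_cancel[OF assms(2), THEN iffD1])
  moreover have "(p ^ n - 1) div d * d = p ^ n - 1" using d_dvd[of n] by simp
  ultimately show ?thesis by (simp add: G_def U_def flip: power_mult)
qed

lemma sum_over_U:
  fixes f :: "'a alg_closure \<Rightarrow> 'b::real_normed_field"
  assumes n: "n \<ge> 1" "k dvd n" and Q: "Q = p ^ n" "(Q - 1) div d > 0" and f0: "f 0 = 0"
  shows "(\<Sum>x | x ^ Q = x. f (G Q x)) = (\<Sum>t\<in>U. of_nat (card {x. x ^ Q = x \<and> G Q x = t}) * f t)"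
proof -
  have fin: "finite {x::'a alg_closure. x ^ Q = x}" unfolding Q using finite_fixed n by simp
  have "(\<Sum>t\<in>U. of_nat (card {x. x ^ Q = x \<and> G Q x = t}) * f t) =
      (\<Sum>t\<in>U. \<Sum>x | x ^ Q = x \<and> G Q x = t. f (G Q x))"
    by (intro sum.cong refl) simp
  also have "\<dots> = (\<Sum>x\<in>(\<Union>t\<in>U. {x. x ^ Q = x \<and> G Q x = t}). f (G Q x))"
    using fin finite_U by (intro sum.UNION_disjoint[symmetric]) auto
  also have "\<dots> = (\<Sum>x | x ^ Q = x. f (G Q x))"
  proof (rule sum.mono_neutral_left[OF fin])
    show "\<forall>x\<in>{x. x ^ Q = x} - (\<Union>t\<in>U. {x. x ^ Q = x \<and> G Q x = t}). f (G Q x) = 0"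
    proof
      fix x assume x: "x \<in> {x. x ^ Q = x} - (\<Union>t\<in>U. {x. x ^ Q = x \<and> G Q x = t})"
      then have "poly (E g) x = 0" using G_in_U[of x n] n Q by auto
      then show "f (G Q x) = 0" using Q(2) f0 by (simp add: G_def power_0_left)
    qed
  qed auto
  finally show ?thesis by simp
qed

lemma G_exponent_pos:
  assumes "n \<ge> 1" shows "(p ^ n - 1) div d > 0"
proof -
  have "p ^ n > 1" using p_ge assms by (intro one_less_power) auto
  then show ?thesis using d_dvd[of n] p_ge by (simp add: div_greater_zero_iff dvd_imp_le)
qed

lemma sum_card_G:
  assumes n: "n \<ge> 1" "k dvd n" and Q: "Q = p ^ n"
  shows "(\<Sum>t\<in>U. card {x. x ^ Q = x \<and> G Q x = t}) + card {x. x ^ Q = x \<and> poly (E g) x = 0} = Q"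
proof -
  have fin: "finite {x::'a alg_closure. x ^ Q = x}" unfolding Q using finite_fixed n by simp
  have pos: "(Q - 1) div d > 0" using G_exponent_pos n Q by simp
  have G0: "G Q x = 0 \<longleftrightarrow> poly (E g) x = 0" for x using pos by (simp add: G_def power_0_left)
  have "(\<Sum>x | x ^ Q = x. if G Q x = 0 then 0 else 1) = (\<Sum>t\<in>U. real (card {x. x ^ Q = x \<and> G Q x =
    t}) * (if t = 0 then 0 else 1))"
    using sum_over_U[of n Q "\<lambda>t. if t = 0 then 0 else (1::real)"] n Q pos by simp
  also have "\<dots> = (\<Sum>t\<in>U. real (card {x. x ^ Q = x \<and> G Q x = t}))"
    using U_nonzero by (intro sum.cong) auto
  also have "(\<Sum>x | x ^ Q = x. if G Q x = 0 then 0 else 1) = real (card ({x. x ^ Q = x} - {x. x ^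
    Q = x \<and> poly (E g) x = 0}))"
  proof -
    have "(\<Sum>x | x ^ Q = x. if G Q x = 0 then 0 else 1) =
        (\<Sum>x\<in>{x. x ^ Q = x} - {x. x ^ Q = x \<and> poly (E g) x = 0}. 1 :: real)"
      using fin by (intro sum.mono_neutral_cong_right) (auto simp: G0)
    then show ?thesis by simp
  qed
  also have "\<dots> = real (card {x::'a alg_closure. x ^ Q = x}) - real (card {x. x ^ Q = x \<and> poly (E
    g) x = 0})"
    using fin by (subst card_Diff_subset) (auto intro!: of_nat_diff card_mono)
  also have "card {x::'a alg_closure. x ^ Q = x} = Q" using card_fixed n Q by simp
  finally have "real Q = real ((\<Sum>t\<in>U. card {x. x ^ Q = x \<and> G Q x = t}) + card {x. x ^ Q = x \<and>
    poly (E g) x = 0})"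
    by simp
  then show ?thesis by (simp only: of_nat_eq_iff)
qed

text \<open>The lower bound is the total count minus the upper bounds for the other
  \<open>d - 1\<close> fibres, at the cost of a factor \<open>d\<close> in the error.\<close>

lemma card_norm_fiber_approx:
  assumes n: "n \<ge> 1" "k dvd 2 * n" and r: "r = p ^ n" "r = d * s + 1" and s: "s \<ge> m"
    and b: "Polynomial.order b (E g) = 1" "b ^ (r ^ 2) = b" and t: "t \<in> U"
  shows "\<bar>real (card {x. x ^ (r ^ 2) = x \<and> G (r ^ 2) x = t}) - real (r ^ 2) / real d\<bar> \<le> 3 * real
    m * real d * real r"
proof -
  define \<nu> where "\<nu> t = real (card {x. x ^ (r ^ 2) = x \<and> G (r ^ 2) x = t})" for t
  have d: "real d \<ge> 4" using p_ge by simp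
  have r1: "real r \<ge> 1" using r(2) by simp
  have up: "\<nu> t \<le> real (r ^ 2) / real d + 2 * real m * real r" if "t \<in> U" for t
  proof -
    have "real d * \<nu> t \<le> real (r ^ 2 + 2 * m * d * r)"
      using card_norm_fiber_upper[OF r s b that] unfolding \<nu>_def of_nat_mult[symmetric]
        of_nat_le_iff .
    then show ?thesis using d by (simp add: field_simps)
  qed
  have "r ^ 2 = p ^ (2 * n)" by (simp add: r(1) power_mult[symmetric] mult.commute)
  from sum_card_G[OF _ n(2) this] n(1)
  have "(\<Sum>t\<in>U. \<nu> t) + real (card {x. x ^ (r ^ 2) = x \<and> poly (E g) x = 0}) = real (r ^ 2)"
    unfolding \<nu>_def of_nat_sum[symmetric] of_nat_add[symmetric] of_nat_eq_iff by simp
  moreover have "card {x. x ^ (r ^ 2) = x \<and> poly (E g) x = 0} \<le> m"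
    using card_mono[OF finite_roots_E, of "{x. x ^ (r ^ 2) = x \<and> poly (E g) x = 0}"] roots_E_bound
    by (auto intro: order_trans)
  ultimately have tot: "(\<Sum>t\<in>U. \<nu> t) \<ge> real (r ^ 2) - real m" by linarith
  have "(\<Sum>s\<in>U - {t}. \<nu> s) \<le> (\<Sum>s\<in>U - {t}. real (r ^ 2) / real d + 2 * real m * real r)"
    by (intro sum_mono up) auto
  also have "\<dots> = (real d - 1) * (real (r ^ 2) / real d + 2 * real m * real r)"
    using t finite_U card_U d by (simp add: of_nat_diff)
  finally have "\<nu> t \<ge> real (r ^ 2) - real m - (real d - 1) * (real (r ^ 2) / real d + 2 * real m
    * real r)"
    using tot sum.remove[OF finite_U t, of \<nu>] by linarith
  also have "real (r ^ 2) - real m - (real d - 1) * (real (r ^ 2) / real d + 2 * real m * real r) =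
      real (r ^ 2) / real d - real m - 2 * (real d - 1) * real m * real r"
    using d by (simp add: field_simps)
  finally have low: "\<nu> t \<ge> real (r ^ 2) / real d - real m - 2 * (real d - 1) * real m * real r" .
  have "real m * 1 \<le> real m * real r" using r1 by (intro mult_left_mono) auto
  moreover have "1 * (real m * real r) \<le> real d * (real m * real r)" using d by (intro
    mult_right_mono) auto
  ultimately show ?thesis
    using low up[OF t] unfolding \<nu>_def by (simp add: abs_le_iff algebra_simps)
qed

end

section \<open>The L-function of a character\<close>

text \<open>A character of the multiplicative group of the prime field, extended by 0; its
  nontriviality is expressed by \<open>chi_sum\<close>.\<close>

locale finite_field_poly_char = finite_field_poly g p k
  for g :: "'a::{field,finite} poly" and p k :: nat +
  fixes \<chi> :: "'a alg_closure \<Rightarrow> complex"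
  assumes chi_0: "\<chi> 0 = 0" and chi_1: "\<chi> 1 = 1"
    and chi_mult: "\<And>x y. x ^ p = x \<Longrightarrow> y ^ p = y \<Longrightarrow> \<chi> (x * y) = \<chi> x * \<chi> y"
    and chi_norm: "\<And>x. norm (\<chi> x) \<le> 1"
    and chi_sum: "(\<Sum>x\<in>U. \<chi> x) = 0"
begin

text \<open>On a stable multiset the product is fixed by Frobenius, so its norm lies in the prime
  field or is 0. With this weight \<open>c\<close> gives the coefficients of the L-function and
  \<open>S\<close> those of its logarithmic derivative.\<close>

definition w :: "'a alg_closure multiset \<Rightarrow> complex" where
  "w D = \<chi> (N (\<Prod>x\<in>#D. poly (E g) x))"

definition c :: "nat \<Rightarrow> complex" where
  "c n = (\<Sum>D | image_mset fr D = D \<and> size D = n. w D)"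

definition S :: "nat \<Rightarrow> complex" where
  "S j = (\<Sum>x | (fr ^^ j) x = x. w (orbit_mset fr x j))"

lemma fr_prod_poly: "fr (\<Prod>x\<in>#D. poly (E h) x) = (\<Prod>x\<in>#image_mset fr D. poly (E h) x)"
  by (induction D) (simp_all add: fr_mult fr_poly_E)

lemma fr_prod_stable: "image_mset fr D = D \<Longrightarrow> fr (\<Prod>x\<in>#D. poly (E h) x) = (\<Prod>x\<in>#D. poly (E h) x)"
  by (simp only: fr_prod_poly)

lemma N_fixed: "fr y = y \<Longrightarrow> N y ^ p = N y"
  using N_in_U[of y] U_0 p_ge by (cases "y = 0") auto

lemma chi_N_mult: "fr x = x \<Longrightarrow> fr y = y \<Longrightarrow> \<chi> (N (x * y)) = \<chi> (N x) * \<chi> (N y)"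
  by (simp add: N_mult chi_mult N_fixed)

lemma fr_power: "fr (x ^ n) = fr x ^ n"
  by (induction n) (simp_all add: fr_mult)

lemma chi_N_power: "fr x = x \<Longrightarrow> \<chi> (N (x ^ n)) = \<chi> (N x) ^ n"
  by (induction n) (simp_all add: chi_N_mult fr_power chi_1)

lemma w_add: "image_mset fr D = D \<Longrightarrow> image_mset fr D' = D' \<Longrightarrow> w (D + D') = w D * w D'"
  by (simp add: w_def chi_N_mult fr_prod_stable)

lemma newton: "of_nat n * c n = (\<Sum>j=1..n. S j * c (n - j))"
  unfolding c_def S_def
proof (rule newton_stable_msets[OF inj_fr w_add finite_stable])
  fix j :: nat assume "j \<ge> 1"
  then show "finite {x. (fr ^^ j) x = x}"
    using finite_fixed[of "k * j"] k_ge by (simp add: funpow_fr q_def power_mult)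
qed

lemma c_0: "c 0 = 1"
proof -
  have "{D. image_mset fr D = D \<and> size D = 0} = {{#}}" by auto
  then show ?thesis by (simp add: c_def w_def chi_1)
qed

text \<open>Transitivity of the norm: Frobenius commutes with \<open>g\<close>, so the product along
  the walk is a power of the value at \<open>x\<close> whose exponent is a geometric sum.\<close>

lemma w_orbit: "w (orbit_mset fr x j) = \<chi> (G (q ^ j) x)"
proof -
  have fr_pow: "(fr ^^ i) (poly (E g) x) = poly (E g) ((fr ^^ i) x)" for i
    by (induction i) (simp_all add: fr_poly_E)
  have "(\<Prod>y\<in>#orbit_mset fr x j. poly (E g) y) = poly (E g) x ^ (\<Sum>i<j. q ^ i)"
    by (induction j)
      (simp_all add: orbit_mset_Suc power_add mult.commute fr_pow[symmetric], simp add: funpow_fr)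
  then have "w (orbit_mset fr x j) = \<chi> (poly (E g) x ^ ((\<Sum>i<j. q ^ i) * ((q - 1) div d)))"
    by (simp add: w_def N_def power_mult)
  also have "(\<Sum>i<j. q ^ i) * ((q - 1) div d) = (q ^ j - 1) div d"
  proof -
    have dv: "d dvd q - 1" using d_dvd[of k] by (simp add: q_def)
    have "(q ^ j - 1) = (q - 1) * (\<Sum>i<j. q ^ i)"
      using geometric_sum_nat[of q j] q_gt_1 by simp
    then show ?thesis using dv by (simp add: div_mult_swap mult.commute)
  qed
  finally show ?thesis by (simp add: G_def)
qed

lemma S_eq: "S j = (\<Sum>x | x ^ (q ^ j) = x. \<chi> (G (q ^ j) x))"
  by (simp add: S_def w_orbit funpow_fr)

lemma S_eq_U:
  assumes "j \<ge> 1"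
  shows "S j = (\<Sum>t\<in>U. of_nat (card {x. x ^ (q ^ j) = x \<and> G (q ^ j) x = t}) * \<chi> t)"
  unfolding S_eq using assms k_ge chi_0 G_exponent_pos[of "k * j"]
  by (intro sum_over_U[of "k * j"]) (auto simp: q_def power_mult)

text \<open>Because \<open>\<chi>\<close> sums to 0 over \<open>U\<close>, the common main term of
  the fibre counts drops out and only the Stepanov error remains.\<close>

lemma S_bound:
  obtains n0 C where "n0 \<ge> 1" "C \<ge> 0" "\<And>j. j \<ge> 1 \<Longrightarrow> norm (S (n0 * j)) \<le> C * sqrt (real q) ^ (n0 * j)"
proof -
  obtain b e where b: "Polynomial.order b (E g) = 1" "e \<ge> 1" "b ^ (q ^ e) = b"
    using periodic_simple_root by blast
  \<comment> \<open>In \<open>n0\<close> the factor 2 makes the field size a square,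
    \<open>e\<close> puts \<open>b\<close> into the field, and \<open>M\<close> makes
    \<open>r\<close> so large that \<open>s \<ge> m\<close>.\<close>
  define M where "M = d * m + 1"
  define n0 where "n0 = 2 * e * M"
  define C where "C = real d * (3 * real m * real d)"
  have "norm (S (n0 * j)) \<le> C * sqrt (real q) ^ (n0 * j)" if j: "j \<ge> 1" for j
  proof -
    define n where "n = k * (e * M * j)"
    define r where "r = p ^ n"
    have rq: "r = q ^ (e * M * j)" by (simp add: r_def n_def q_def power_mult)
    have r2: "r ^ 2 = q ^ (n0 * j)"
      unfolding rq n0_def by (simp add: power_mult[symmetric] mult_ac)
    define s where "s = (r - 1) div d"
    have "r \<ge> 1" using p_ge by (simp add: r_def)
    then have rs: "r = d * s + 1"
      using d_dvd[of n] by (simp add: s_def r_def)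
    have "M \<le> n"
      using k_ge b(2) j by (simp add: n_def)
    also have "n < 2 ^ n" by (rule less_exp)
    also have "2 ^ n \<le> r" unfolding r_def using p_ge by (intro power_mono) auto
    finally have "d * m < d * s" using rs by (simp add: M_def)
    then have s: "s \<ge> m" by simp
    have "b ^ (r ^ 2) = b"
    proof -
      have "(fr ^^ (e * (2 * M * j))) b = b"
        by (rule funpow_multiple_fixed) (simp add: funpow_fr b)
      then show ?thesis unfolding r2 n0_def by (simp add: funpow_fr mult_ac)
    qed
    note approx = card_norm_fiber_approx[of n r s b, OF _ _ r_def rs s b(1) this]
    have n1: "n \<ge> 1" using \<open>M \<le> n\<close> by (simp add: M_def)
    have kn: "k dvd 2 * n" by (simp add: n_def)
    have "n0 * j \<ge> 1" using b(2) j by (simp add: n0_def M_def)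
    then have "S (n0 * j) = (\<Sum>t\<in>U. of_nat (card {x. x ^ (r ^ 2) = x \<and> G (r ^ 2) x = t}) * \<chi> t)"
      using S_eq_U by (simp add: r2)
    also have "\<dots> = \<dots> - of_real (real (r ^ 2) / real d) * (\<Sum>t\<in>U. \<chi> t)"
      unfolding chi_sum by simp
    also have "\<dots> = (\<Sum>t\<in>U. of_real (real (card {x. x ^ (r ^ 2) = x \<and> G (r ^ 2) x = t}) - real (r
      ^ 2) / real d) * \<chi> t)"
      unfolding of_real_diff left_diff_distrib sum_subtractf sum_distrib_left by simp
    also have "norm \<dots> \<le> (\<Sum>t\<in>U. 3 * real m * real d * real r)"
    proof (rule sum_norm_le)
      fix t assume t: "t \<in> U"
      have "norm (of_real (real (card {x. x ^ (r ^ 2) = x \<and> G (r ^ 2) x = t}) - real (r ^ 2) /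
        real d) * \<chi> t)
          \<le> (3 * real m * real d * real r) * 1"
        unfolding norm_mult norm_of_real
        using approx[OF n1 kn t] chi_norm[of t] by (intro mult_mono) auto
      then show "norm (of_real (real (card {x. x ^ (r ^ 2) = x \<and> G (r ^ 2) x = t}) - real (r ^
        2) / real d) * \<chi> t)
          \<le> 3 * real m * real d * real r" by simp
    qed
    also have "\<dots> = C * real r" by (simp add: C_def card_U)
    also have "real r = sqrt (real q) ^ (n0 * j)"
      by (simp add: rq n0_def power_mult mult.assoc)
    finally show ?thesis .
  qed
  moreover have "n0 \<ge> 1" using b(2) by (simp add: n0_def M_def)
  moreover have "C \<ge> 0" by (simp add: C_def)
  ultimately show thesis using that by blast
qed

text \<open>The factor picked up for each root of a monic polynomial when the values of
  \<open>g\<close> at its roots are exchanged for its values at the roots of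
  \<open>g\<close>.\<close>

definition \<kappa> where "\<kappa> = to_ac (Polynomial.lead_coeff g) * (- 1) ^ m"

text \<open>Up to powers of the leading coefficient, the product in \<open>\<psi>\<close> is the resultant of \<open>g\<close> and
  \<open>h\<close>, so that \<open>\<psi>\<close> is a character modulo \<open>g\<close>.\<close>

definition \<psi> where "\<psi> h = \<chi> (N (\<Prod>b\<in>#proots (E g). poly (E h) b))"

lemma g_nonzero: "g \<noteq> 0" using deg_g by auto

lemma fr_kappa: "fr \<kappa> = \<kappa>"
proof -
  have "\<kappa> = to_ac (Polynomial.lead_coeff g * (- 1) ^ m)" by (simp add: \<kappa>_def)
  then show ?thesis by (simp only: fr_to_ac)
qed

lemma kappa_nonzero: "\<kappa> \<noteq> 0" using g_nonzero by (simp add: \<kappa>_def)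

lemma fr_prod_roots: "fr (\<Prod>b\<in>#proots (E g). poly (E h) b) = (\<Prod>b\<in>#proots (E g). poly (E h) b)"
  by (rule fr_prod_stable[OF stable_proots[OF g_nonzero]])

text \<open>Reciprocity of the resultant: up to sign and leading coefficient, both products run over
  all differences of a root of \<open>g\<close> and a root of \<open>h\<close>.\<close>

lemma w_proots:
  assumes h: "Polynomial.degree h = n" "Polynomial.lead_coeff h = 1"
  shows "w (proots (E h)) = \<chi> (N \<kappa>) ^ n * \<psi> h"
proof -
  define B where "B = proots (E g)"
  define D where "D = proots (E h)"
  have h0: "h \<noteq> 0" using h by auto
  have sD: "size D = n" using poly_eq_prod_proots(2)[of "E h"] h0 h by (simp add: D_def)
  have sB: "size B = m" using poly_eq_prod_proots(2)[of "E g"] g_nonzero by (simp add: B_def)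
  have Eh: "poly (E h) b = (\<Prod>x\<in>#D. b - x)" for b
  proof -
    have "E h = (\<Prod>x\<in>#D. [:- x, 1:])"
      using poly_eq_prod_proots(1)[of "E h"] h0 h by (simp add: D_def)
    then show ?thesis by (simp add: poly_prod_mset)
  qed
  have Eg: "poly (E g) x = to_ac (Polynomial.lead_coeff g) * (\<Prod>b\<in>#B. x - b)" for x
  proof -
    have "E g = Polynomial.smult (to_ac (Polynomial.lead_coeff g)) (\<Prod>x\<in>#B. [:- x, 1:])"
      using poly_eq_prod_proots(1)[of "E g"] g_nonzero by (simp add: B_def)
    then have "poly (E g) x = poly (Polynomial.smult (to_ac (Polynomial.lead_coeff g)) (\<Prod>x\<in>#B.
      [:- x, 1:])) x"
      by simp
    then show ?thesis by (simp add: poly_prod_mset)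
  qed
  have flip: "(\<Prod>b\<in>#B. x - b) = (- 1) ^ m * (\<Prod>b\<in>#B. b - x)" for x
    unfolding sB[symmetric] by (induction B) (simp_all add: algebra_simps)
  have "(\<Prod>x\<in>#D. poly (E g) x) = (\<Prod>x\<in>#D. \<kappa> * (\<Prod>b\<in>#B. b - x))"
    by (simp add: Eg flip \<kappa>_def mult.assoc)
  also have "\<dots> = \<kappa> ^ n * (\<Prod>x\<in>#D. \<Prod>b\<in>#B. b - x)"
    by (simp add: prod_mset.distrib sD)
  also have "(\<Prod>x\<in>#D. \<Prod>b\<in>#B. b - x) = (\<Prod>b\<in>#B. poly (E h) b)"
    unfolding Eh by (rule prod_mset.swap)
  finally show ?thesis
    using fr_prod_roots[of h] unfolding w_def D_def[symmetric] \<psi>_def B_def[symmetric]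
    by (simp add: chi_N_mult fr_power fr_kappa chi_N_power)
qed

lemma psi_mult: "\<psi> (h1 * h2) = \<psi> h1 * \<psi> h2"
  using fr_prod_roots[of h1] fr_prod_roots[of h2]
  by (simp add: \<psi>_def map_poly_to_ac_mult prod_mset.distrib chi_N_mult)

lemma psi_cong:
  assumes "g dvd h1 - h2"
  shows "\<psi> h1 = \<psi> h2"
proof -
  obtain h where h: "h1 = h2 + g * h" using assms by (metis add_diff_cancel_left'
    diff_add_cancel dvdE add.commute)
  have "poly (E h1) b = poly (E h2) b" if "b \<in># proots (E g)" for b
    using that g_nonzero by (simp add: h map_poly_to_ac_add map_poly_to_ac_mult)
  then show ?thesis
    unfolding \<psi>_def by (intro arg_cong[of _ _ "\<lambda>x. \<chi> (N x)"] arg_cong[of _ _ prod_mset]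
      image_mset_cong)
qed

lemma psi_nonzero_root:
  assumes "\<psi> h \<noteq> 0" "b \<in># proots (E g)"
  shows "poly (E h) b \<noteq> 0"
proof
  assume "poly (E h) b = 0"
  then have "(\<Prod>b\<in>#proots (E g). poly (E h) b) = 0"
    using assms(2) by (metis (no_types, lifting) image_eqI prod_mset_zero_iff set_image_mset)
  then show False using assms(1) by (simp only: \<psi>_def N_0 chi_0 simp_thms)
qed

lemma chi_nonzero:
  assumes "t \<in> U" shows "\<chi> t \<noteq> 0"
proof -
  have "t ^ d = 1" using assms by (simp add: U_def)
  then have 1: "t * t ^ (d - 1) = 1"
    using p_ge power_minus_mult[of d t] by (simp add: mult.commute)
  have "t ^ p = t" using assms U_0 by auto
  moreover from this have "(t ^ (d - 1)) ^ p = t ^ (d - 1)"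
    by (metis power_mult mult.commute)
  ultimately have "\<chi> t * \<chi> (t ^ (d - 1)) = 1" using 1 chi_mult chi_1 by metis
  then show ?thesis by auto
qed

text \<open>If \<open>\<psi>\<close> were trivial, the sums \<open>S j\<close> would grow like \<open>q ^ j\<close>, contrary to Stepanov's bound.\<close>
lemma psi_nontrivial: "\<exists>u. \<psi> u \<noteq> 0 \<and> \<psi> u \<noteq> 1"
proof (rule ccontr)
  assume "\<not> ?thesis"
  then have triv: "\<psi> u = 0 \<or> \<psi> u = 1" for u by blast
  obtain n0 C where n0: "n0 \<ge> 1" "C \<ge> 0"
    and bound: "\<And>j. j \<ge> 1 \<Longrightarrow> norm (S (n0 * j)) \<le> C * sqrt (real q) ^ (n0 * j)"
    using S_bound by blast
  define R where "R = sqrt (real q)"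
  have R: "R > 1" "R ^ 2 = real q" using q_gt_1 by (auto simp: R_def)
  \<comment> \<open>Once \<open>R ^ j\<close> exceeds \<open>C + m\<close>, the estimate
    \<open>R ^ j * R ^ j - m \<le> C * R ^ j\<close> becomes impossible.\<close>
  obtain i0 where i0: "C + real m < R ^ i0" using real_arch_pow[OF R(1)] by blast
  define i where "i = Suc i0"
  \<comment> \<open>A multiple of \<open>n0\<close>, so that \<open>bound\<close> applies, and of
    \<open>d\<close>, so that the factor \<open>\<chi> (N \<kappa>) ^ j\<close> is 1.\<close>
  define j where "j = n0 * (d * i)"
  have di: "d * i \<ge> 1" using p_ge by (simp add: i_def)
  have j1: "j \<ge> 1" using n0 di by (simp add: j_def)
  have ij: "i0 \<le> j"
  proof -
    have "i0 \<le> 1 * i" by (simp add: i_def)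
    also have "1 * i \<le> d * i" using p_ge by (intro mult_le_mono1) simp
    also have "d * i \<le> n0 * (d * i)" using n0 by simp
    finally show ?thesis by (simp add: j_def)
  qed
  have Nk: "N \<kappa> \<in> U" by (rule N_in_U[OF fr_kappa kappa_nonzero])
  have "\<chi> (N \<kappa>) ^ d = \<chi> (N (\<kappa> ^ d))" by (simp add: chi_N_power fr_kappa)
  also have "N (\<kappa> ^ d) = N \<kappa> ^ d" by (simp add: N_def mult.commute flip: power_mult)
  also have "\<dots> = 1" using Nk by (simp add: U_def)
  finally have chi_d: "\<chi> (N \<kappa>) ^ d = 1" by (simp add: chi_1)
  have "\<chi> (N \<kappa>) ^ j = (\<chi> (N \<kappa>) ^ d) ^ (n0 * i)"
    unfolding j_def by (simp add: mult_ac flip: power_mult)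
  then have chi_j: "\<chi> (N \<kappa>) ^ j = 1" unfolding chi_d by simp
  define Q where "Q = q ^ j"
  have Qp: "Q = p ^ (k * j)" by (simp add: Q_def q_def power_mult)
  have kj: "k * j \<ge> 1" using k_ge j1 by simp
  have one: "\<chi> (G Q x) = (if poly (E g) x = 0 then 0 else 1)" if x: "x ^ Q = x" for x
  proof (cases "poly (E g) x = 0")
    case True
    then show ?thesis
      using G_exponent_pos[OF kj] by (simp add: G_def Qp power_0_left chi_0)
  next
    case False
    have fx: "(fr ^^ j) x = x" using x by (simp add: funpow_fr Q_def)
    \<comment> \<open>The closed walk at \<open>x\<close> is the root multiset of a monic
      \<open>h\<close>, so the summand at \<open>x\<close> is a value of
      \<open>\<psi>\<close>.\<close>
    have "orbit_mset fr x j \<in> {D. image_mset fr D = D \<and> size D = j}"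
      using orbit_mset_stable[OF fx] by simp
    then obtain h where h: "Polynomial.degree h = j" "Polynomial.lead_coeff h = 1" "orbit_mset
      fr x j = proots (E h)"
      using bij_monic_stable[of j] unfolding bij_betw_def by blast
    have "\<chi> (G Q x) = \<psi> h"
      using w_orbit[of x j] w_proots[OF h(1,2)] by (simp add: h(3) chi_j Q_def)
    moreover have "\<chi> (G Q x) \<noteq> 0"
      using G_in_U[of x "k * j"] x False by (intro chi_nonzero) (simp add: Qp)
    ultimately show ?thesis using triv[of h] False by auto
  qed
  have fin: "finite {x::'a alg_closure. x ^ Q = x}" unfolding Qp by (rule finite_fixed[OF kj])
  have "S j = (\<Sum>x | x ^ Q = x. if poly (E g) x = 0 then 0 else 1)"
    unfolding S_eq Q_def[symmetric] by (intro sum.cong) (auto simp: one)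
  also have "\<dots> = (\<Sum>x\<in>{x. x ^ Q = x} - {x. poly (E g) x = 0}. 1)"
    using fin by (intro sum.mono_neutral_cong_right) auto
  also have "\<dots> = of_nat (card ({x. x ^ Q = x} - {x. poly (E g) x = 0}))" by simp
  finally have "norm (S j) = real (card ({x. x ^ Q = x} - {x. poly (E g) x = 0}))" by simp
  moreover have "card {x::'a alg_closure. x ^ Q = x} - card {x. poly (E g) x = 0} \<le> card ({x. x
    ^ Q = x} - {x. poly (E g) x = 0})"
    by (rule diff_card_le_card_Diff[OF finite_roots_E])
  then have "Q \<le> card ({x. x ^ Q = x} - {x. poly (E g) x = 0}) + m"
    using card_fixed[OF kj, folded Qp] roots_E_bound by linarith
  then have "real Q \<le> real (card ({x. x ^ Q = x} - {x. poly (E g) x = 0})) + real m"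
    by linarith
  ultimately have "real Q - real m \<le> norm (S j)" by linarith
  also have "\<dots> \<le> C * R ^ j"
    using bound[OF di] by (simp add: j_def R_def)
  also have "real Q = R ^ j * R ^ j"
    unfolding Q_def of_nat_power R(2)[symmetric] by (simp add: power2_eq_square power_mult_distrib)
  finally have "R ^ j * R ^ j \<le> C * R ^ j + real m" by simp
  also have "\<dots> \<le> (C + real m) * R ^ j"
    using R(1) by (simp add: distrib_right mult_le_cancel_left1 one_le_power)
  finally have "R ^ j \<le> C + real m" using R(1) by simp
  moreover have "R ^ i0 \<le> R ^ j" using R(1) ij by (intro power_increasing) auto
  ultimately show False using i0 by simp
qed

text \<open>For \<open>\<psi> u \<noteq> 0\<close>, multiplication by \<open>u\<close> permutes the residues modulo \<open>g\<close>, among which the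
  monic polynomials of degree \<open>n \<ge> m\<close> are equidistributed.\<close>
lemma c_vanish:
  assumes n: "n \<ge> m"
  shows "c n = 0"
proof -
  obtain u where u: "\<psi> u \<noteq> 0" "\<psi> u \<noteq> 1" using psi_nontrivial by blast
  define M where "M = {h :: 'a poly. Polynomial.degree h = n \<and> Polynomial.lead_coeff h = 1}"
  \<comment> \<open>\<open>T\<close> replaces the residue of \<open>h\<close> modulo
    \<open>g\<close> by that of \<open>u * h\<close>. The change has degree below \<open>m\<close>,
    so \<open>h\<close> stays monic of degree \<open>n\<close>.\<close>
  define T where "T h = h - h mod g + (u * h) mod g" for h
  have mod_less: "Polynomial.degree (h mod g) < m" for h
    using degree_mod_less[OF g_nonzero, of h] deg_g by auto
  have T_M: "T h \<in> M" if h: "h \<in> M" for h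
  proof -
    define r where "r = (u * h) mod g - h mod g"
    have T: "T h = h + r" by (simp add: T_def r_def)
    have "Polynomial.degree r < m"
      unfolding r_def using mod_less by (intro degree_diff_less) auto
    then have "Polynomial.degree r < Polynomial.degree h" using h n by (simp add: M_def)
    then show ?thesis
      using h by (auto simp: T M_def degree_add_eq_left coeff_eq_0)
  qed
  have "inj_on T M"
  proof (rule inj_onI)
    fix h h' assume h: "h \<in> M" "h' \<in> M" and eq: "T h = T h'"
    have hm: "g dvd h - h mod g" for h by (simp add: minus_mod_eq_mult_div)
    have "g dvd (h - h mod g) - (h' - h' mod g)" by (intro dvd_diff hm)
    also have "(h - h mod g) - (h' - h' mod g) = (u * h') mod g - (u * h) mod g"
      using eq by (simp add: T_def algebra_simps)
    finally have "(u * h') mod g - (u * h) mod g = 0"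
      by (rule eq_0_if_dvd_degree_less) (intro degree_diff_less mod_less)
    then have uh: "(u * h) mod g = (u * h') mod g" by simp
    then have hh: "h - h' = h mod g - h' mod g" using eq by (simp add: T_def algebra_simps)
    have "g dvd u * (h - h')"
      using uh mod_eq_dvd_iff[of "u * h" g "u * h'"] by (simp add: right_diff_distrib)
    \<comment> \<open>As \<open>\<psi> u \<noteq> 0\<close>, no root of \<open>g\<close> is a root
      of \<open>u\<close>; hence \<open>g\<close> divides \<open>h - h'\<close> over the closure,
      and the degree of \<open>h - h'\<close> is below \<open>m\<close>.\<close>
    then have "E g dvd E u * E (h - h')"
      by (metis dvd_def map_poly_to_ac_mult)
    moreover have Eg: "E g = Polynomial.smult (to_ac (Polynomial.lead_coeff g)) (\<Prod>x\<in>#proots (E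
      g). [:- x, 1:])"
      using poly_eq_prod_proots(1)[of "E g"] g_nonzero by simp
    ultimately have "(\<Prod>x\<in>#proots (E g). [:- x, 1:]) dvd E u * E (h - h')"
      by (metis smult_dvd_cancel)
    then have "(\<Prod>x\<in>#proots (E g). [:- x, 1:]) dvd E (h - h')"
      by (rule prod_linear_dvd_mult_cancel) (rule psi_nonzero_root[OF u(1)])
    then have "E (h - h') = 0"
    proof (rule eq_0_if_dvd_degree_less)
      have "Polynomial.degree (\<Prod>x\<in>#proots (E g). [:- x, 1:]) = m"
        using poly_eq_prod_proots(2)[of "E g"] g_nonzero by (simp add:
          degree_lead_coeff_prod_linear)
      then show "Polynomial.degree (E (h - h')) < Polynomial.degree (\<Prod>x\<in>#proots (E g). [:- x, 1:])"
        unfolding hh using mod_less by (simp add: degree_diff_less)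
    qed
    then show "h = h'" by simp
  qed
  moreover have finM: "finite M" unfolding M_def by (rule finite_monic)
  ultimately have "bij_betw T M M"
    using T_M by (simp add: bij_betw_def endo_inj_surj image_subsetI)
  then have "(\<Sum>h\<in>M. \<psi> h) = (\<Sum>h\<in>M. \<psi> (T h))"
    by (rule sum.reindex_bij_betw[symmetric])
  also have "\<dots> = (\<Sum>h\<in>M. \<psi> u * \<psi> h)"
  proof (intro sum.cong refl)
    fix h
    have "T h - u * h = (h - h mod g) - (u * h - (u * h) mod g)" by (simp add: T_def)
    then have "g dvd T h - u * h"
      by (metis dvd_diff minus_mod_eq_mult_div dvd_triv_left)
    then show "\<psi> (T h) = \<psi> u * \<psi> h" using psi_cong psi_mult by metis
  qed
  also have "\<dots> = \<psi> u * (\<Sum>h\<in>M. \<psi> h)" by (rule sum_distrib_left[symmetric])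
  finally have "(\<Sum>h\<in>M. \<psi> h) = 0" using u(2) by (metis mult_cancel_right1)
  moreover have "c n = (\<Sum>h\<in>M. w (proots (E h)))"
    unfolding c_def M_def by (rule sum.reindex_bij_betw[OF bij_monic_stable, symmetric])
  moreover have "\<dots> = (\<Sum>h\<in>M. \<chi> (N \<kappa>) ^ n * \<psi> h)"
    by (intro sum.cong refl w_proots) (auto simp: M_def)
  ultimately show ?thesis by (simp flip: sum_distrib_left)
qed

text \<open>The coefficients vanish from index \<open>m\<close> on, so the L-function has at most
  \<open>m - 1\<close> inverse roots, each of absolute value at most \<open>sqrt q\<close>.\<close>

lemma character_sum_bound:
  "norm (\<Sum>x | x ^ q = x. \<chi> (G q x)) \<le> real (m - 1) * sqrt (real q)"
proof -
  obtain n0 C where n0: "n0 \<ge> 1" "C \<ge> 0"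
    and bound: "\<And>j. j \<ge> 1 \<Longrightarrow> norm (S (n0 * j)) \<le> C * sqrt (real q) ^ (n0 * j)"
    using S_bound by blast
  have "norm (S 1) \<le> real (m - 1) * sqrt (real q)"
    by (rule L_function_bound[OF c_0 c_vanish newton n0(1) _ bound]) (use q_gt_1 in auto)
  then show ?thesis by (simp add: S_eq)
qed

end

section \<open>The Weil bound for norm fibres\<close>

context finite_field_poly
begin

text \<open>The generator is the image of a primitive root modulo \<open>p\<close>.\<close>

lemma U_generator:
  obtains \<gamma> where "U = {\<gamma> ^ i | i. True}" and "\<And>i j. \<gamma> ^ i = \<gamma> ^ j \<longleftrightarrow> [i = j] (mod d)"
proof -
  obtain a where a: "residue_primroot p a"
    using prime_primitive_root_exists[OF _ prime_p] p_ge by auto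
  have cop: "coprime p a" and ord_a: "ord p a = d"
    using a prime_p by (auto simp: residue_primroot_def totient_prime)
  define \<gamma> where "\<gamma> = (of_nat a :: 'a alg_closure)"
  have eq: "\<gamma> ^ i = \<gamma> ^ j \<longleftrightarrow> [i = j] (mod d)" for i j
    using order_divides_expdiff[OF cop, of i j] of_nat_eq_iff_cong_CHAR[of "a ^ i" "a ^ j",
      where ?'a = "'a alg_closure"]
    by (simp add: \<gamma>_def ord_a)
  have sub: "\<gamma> ^ i \<in> U" for i
  proof -
    have "\<gamma> ^ (i * d) = \<gamma> ^ 0" by (subst eq) (simp add: cong_def)
    then show ?thesis by (simp add: U_def power_mult)
  qed
  have "inj_on (\<lambda>i. \<gamma> ^ i) {..<d}"
    by (auto simp: inj_on_def eq cong_def)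
  then have "card ((\<lambda>i. \<gamma> ^ i) ` {..<d}) = card U"
    by (simp add: card_image card_U)
  then have "(\<lambda>i. \<gamma> ^ i) ` {..<d} = U"
    using sub by (intro card_subset_eq finite_U) auto
  then have "U = {\<gamma> ^ i | i. True}" using sub by auto
  with eq show thesis using that by blast
qed

text \<open>Fourier inversion on the cyclic group \<open>U\<close>: the trivial character yields the
  main term, each of the other \<open>d - 1\<close> an error bounded by
  \<open>character_sum_bound\<close>.\<close>

theorem card_norm_fiber:
  assumes t: "t \<in> U"
  shows "\<bar>real (card {x. x ^ q = x \<and> G q x = t}) - real q / real d\<bar> \<le> real m * sqrt (real q)"
proof -
  obtain \<gamma> where U: "U = {\<gamma> ^ i | i. True}" and \<gamma>: "\<And>i j. \<gamma> ^ i = \<gamma> ^ j \<longleftrightarrow> [i = j] (mod d)"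
    using U_generator by blast
  \<comment> \<open>A discrete logarithm, determined only modulo \<open>d\<close>; this suffices
    because \<open>\<omega> ^ d = 1\<close>.\<close>
  define ind where "ind s = (SOME i. s = \<gamma> ^ i)" for s
  have ind: "\<gamma> ^ ind s = s" if "s \<in> U" for s
  proof -
    have "s = \<gamma> ^ ind s"
      unfolding ind_def by (rule someI_ex) (use that U in auto)
    then show ?thesis by simp
  qed
  define \<omega> where "\<omega> = cis (2 * pi / real d)"
  have d0: "d > 0" using p_ge by simp
  have \<omega>_pow: "\<omega> ^ i = cis (2 * pi * real i / real d)" for i
    by (simp add: \<omega>_def DeMoivre mult_ac)
  have \<omega>_d: "\<omega> ^ d = 1" unfolding \<omega>_pow using d0 by simp
  have \<omega>_cong: "\<omega> ^ i = \<omega> ^ j" if "[i = j] (mod d)" for i j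
  proof -
    have "\<omega> ^ i = \<omega> ^ (i mod d)" for i
    proof -
      have "\<omega> ^ i = \<omega> ^ (d * (i div d) + i mod d)" by simp
      also have "\<dots> = \<omega> ^ (i mod d)" by (simp only: power_add power_mult \<omega>_d power_one mult_1)
      finally show ?thesis .
    qed
    then show ?thesis using that by (metis cong_def)
  qed
  have \<omega>_inj: "i = j" if "\<omega> ^ i = \<omega> ^ j" "i < d" "j < d" for i j
    using bij_betw_roots_unity[OF d0] that unfolding bij_betw_def inj_on_def \<omega>_pow by blast
  have \<omega>0: "\<omega> \<noteq> 0" by (simp add: \<omega>_def)
  define \<chi> where "\<chi> a s = (if s \<in> U then \<omega> ^ (a * ind s) else 0)" for a s
  have \<chi>_pow: "\<chi> a (\<gamma> ^ i) = \<omega> ^ (a * i)" for a i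
  proof -
    have "\<gamma> ^ i \<in> U" using U by auto
    then have "[ind (\<gamma> ^ i) = i] (mod d)" using ind \<gamma> by blast
    then have "\<omega> ^ ind (\<gamma> ^ i) = \<omega> ^ i" by (rule \<omega>_cong)
    then show ?thesis using \<open>\<gamma> ^ i \<in> U\<close> unfolding \<chi>_def by (metis power_mult mult.commute)
  qed
  define \<nu> where "\<nu> s = card {x. x ^ q = x \<and> G q x = s}" for s
  have char_bound: "norm (\<Sum>s\<in>U. of_nat (\<nu> s) * \<chi> a s) \<le> real (m - 1) * sqrt (real q)"
    if a: "0 < a" "a < d" for a
  proof -
    interpret finite_field_poly_char g p k "\<chi> a"
    proof
      show "\<chi> a 0 = 0" using U_nonzero by (simp add: \<chi>_def)
      show "\<chi> a 1 = 1" using \<chi>_pow[of a 0] by simp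
      show "norm (\<chi> a x) \<le> 1" for x
        by (simp add: \<chi>_def \<omega>_def norm_power)
      show "\<chi> a (x * y) = \<chi> a x * \<chi> a y" if "x ^ p = x" "y ^ p = y" for x y
      proof (cases "x = 0 \<or> y = 0")
        case True
        then show ?thesis using \<open>\<chi> a 0 = 0\<close> by auto
      next
        case False
        then have "x \<in> U" "y \<in> U" using that U_0 by auto
        then obtain i j where "x = \<gamma> ^ i" "y = \<gamma> ^ j" using U by auto
        then show ?thesis by (simp add: \<chi>_pow distrib_left flip: power_add)
      qed
      have \<gamma>U: "\<gamma> \<in> U" using U by (auto intro: exI[of _ 1])
      then have \<gamma>0: "\<gamma> \<noteq> 0" using U_nonzero by auto
      have "bij_betw (\<lambda>s. \<gamma> * s) U U"
      proof -
        have "inj_on (\<lambda>s. \<gamma> * s) U" using \<gamma>0 by (simp add: inj_on_def)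
        moreover have "(\<lambda>s. \<gamma> * s) ` U \<subseteq> U"
          unfolding U by (auto intro: exI[of _ "Suc _"])
        ultimately show ?thesis by (simp add: bij_betw_def endo_inj_surj finite_U)
      qed
      then have "(\<Sum>s\<in>U. \<chi> a s) = (\<Sum>s\<in>U. \<chi> a (\<gamma> * s))"
        by (rule sum.reindex_bij_betw[symmetric])
      also have "\<dots> = (\<Sum>s\<in>U. \<omega> ^ a * \<chi> a s)"
      proof (intro sum.cong refl)
        fix s assume "s \<in> U"
        then obtain i where "s = \<gamma> ^ i" using U by auto
        then show "\<chi> a (\<gamma> * s) = \<omega> ^ a * \<chi> a s"
          using \<chi>_pow[of a "Suc i"] by (simp add: \<chi>_pow power_add)
      qed
      also have "\<dots> = \<omega> ^ a * (\<Sum>s\<in>U. \<chi> a s)" by (rule sum_distrib_left[symmetric])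
      finally have "(\<Sum>s\<in>U. \<chi> a s) = \<omega> ^ a * (\<Sum>s\<in>U. \<chi> a s)" .
      moreover have "\<omega> ^ a \<noteq> 1"
      proof
        assume "\<omega> ^ a = 1"
        then have "\<omega> ^ a = \<omega> ^ 0" by simp
        then have "a = 0" using a(2) d0 by (rule \<omega>_inj)
        then show False using a(1) by simp
      qed
      ultimately show "(\<Sum>s\<in>U. \<chi> a s) = 0" by (metis mult_cancel_right1)
    qed
    show ?thesis
      using character_sum_bound sum_over_U[of k q "\<chi> a"] k_ge G_exponent_pos[of k] chi_0
      by (simp add: q_def \<nu>_def)
  qed
  have ortho: "(\<Sum>a<d. inverse (\<chi> a t) * \<chi> a s) = (if s = t then of_nat d else 0)" if s: "s \<in> U"
    for s
  proof -
    obtain i j where ij: "s = \<gamma> ^ i" "t = \<gamma> ^ j" using s t U by auto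
    define z where "z = inverse (\<omega> ^ j) * \<omega> ^ i"
    have z: "inverse (\<chi> a t) * \<chi> a s = z ^ a" for a
      unfolding ij \<chi>_pow z_def by (simp add: power_mult_distrib power_inverse mult.commute flip:
        power_mult)
    have zd: "z ^ d = 1"
      unfolding z_def power_mult_distrib power_inverse power_mult[symmetric] mult.commute[of _ d]
      unfolding power_mult \<omega>_d by simp
    show ?thesis
    proof (cases "s = t")
      case True
      then have "\<omega> ^ i = \<omega> ^ j" using \<omega>_cong \<gamma> ij by metis
      then have "z = 1" using \<omega>0 by (simp add: z_def)
      then show ?thesis unfolding z using True by simp
    next
      case False
      have "z \<noteq> 1"
      proof
        assume "z = 1"
        then have "\<omega> ^ i = \<omega> ^ j" using \<omega>0 by (simp add: z_def field_simps)
        then have "\<omega> ^ (i mod d) = \<omega> ^ (j mod d)"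
          using \<omega>_cong[of i "i mod d"] \<omega>_cong[of j "j mod d"] by (simp add: cong_def)
        then have "i mod d = j mod d" by (rule \<omega>_inj) (use d0 in auto)
        then show False using False ij \<gamma> by (simp add: cong_def)
      qed
      then show ?thesis unfolding z using False zd geometric_sum[of z d] by simp
    qed
  qed
  have \<chi>t: "norm (inverse (\<chi> a t)) = 1" for a
    using t by (simp add: \<chi>_def \<omega>_def norm_power norm_inverse)
  have "of_nat d * of_nat (\<nu> t) = (\<Sum>s\<in>U. of_nat (\<nu> s) * (if s = t then of_nat d else (0::complex)))"
    using t finite_U by (simp add: if_distrib sum.delta' mult.commute cong: if_cong)
  also have "\<dots> = (\<Sum>s\<in>U. of_nat (\<nu> s) * (\<Sum>a<d. inverse (\<chi> a t) * \<chi> a s))"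
    by (intro sum.cong refl) (simp only: ortho)
  also have "\<dots> = (\<Sum>s\<in>U. \<Sum>a<d. inverse (\<chi> a t) * (of_nat (\<nu> s) * \<chi> a s))"
    by (simp add: sum_distrib_left mult_ac)
  also have "\<dots> = (\<Sum>a<d. \<Sum>s\<in>U. inverse (\<chi> a t) * (of_nat (\<nu> s) * \<chi> a s))"
    by (rule sum.swap)
  also have "\<dots> = (\<Sum>a<d. inverse (\<chi> a t) * (\<Sum>s\<in>U. of_nat (\<nu> s) * \<chi> a s))"
    by (simp only: sum_distrib_left)
  also have "\<dots> = (\<Sum>s\<in>U. of_nat (\<nu> s)) + (\<Sum>a\<in>{..<d} - {0}. inverse (\<chi> a t) * (\<Sum>s\<in>U. of_nat (\<nu> s)
    * \<chi> a s))"
  proof -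
    have "inverse (\<chi> 0 t) * (\<Sum>s\<in>U. of_nat (\<nu> s) * \<chi> 0 s) = (\<Sum>s\<in>U. of_nat (\<nu> s))"
      using t by (simp add: \<chi>_def)
    then show ?thesis using d0 by (subst sum.remove[of _ 0]) auto
  qed
  finally have main: "of_nat d * of_nat (\<nu> t) - (\<Sum>s\<in>U. of_nat (\<nu> s)) =
      (\<Sum>a\<in>{..<d} - {0}. inverse (\<chi> a t) * (\<Sum>s\<in>U. of_nat (\<nu> s) * \<chi> a s))"
    by simp
  have "norm (\<Sum>a\<in>{..<d} - {0}. inverse (\<chi> a t) * (\<Sum>s\<in>U. of_nat (\<nu> s) * \<chi> a s))
      \<le> (\<Sum>a\<in>{..<d} - {0}. real (m - 1) * sqrt (real q))"
    by (rule sum_norm_le) (use char_bound in \<open>auto simp: norm_mult \<chi>t\<close>)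
  also have "\<dots> = real (d - 1) * (real (m - 1) * sqrt (real q))"
    using d0 by simp
  finally have 1: "norm (of_nat d * of_nat (\<nu> t) - (\<Sum>s\<in>U. of_nat (\<nu> s)) :: complex)
      \<le> real (d - 1) * (real (m - 1) * sqrt (real q))" unfolding main .
  have "(of_nat d * of_nat (\<nu> t) - (\<Sum>s\<in>U. of_nat (\<nu> s)) :: complex) =
      of_real (real d * real (\<nu> t) - (\<Sum>s\<in>U. real (\<nu> s)))" by simp
  with 1 have 2: "\<bar>real d * real (\<nu> t) - (\<Sum>s\<in>U. real (\<nu> s))\<bar> \<le> real (d - 1) * (real (m - 1) *
    sqrt (real q))"
    by (simp only: norm_of_real)
  \<comment> \<open>The trivial character counts the points where \<open>g\<close> does not vanish,
    which are \<open>q\<close> up to at most \<open>m\<close>.\<close>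
  have "(\<Sum>s\<in>U. \<nu> s) + card {x. x ^ q = x \<and> poly (E g) x = 0} = q"
    unfolding \<nu>_def by (rule sum_card_G[of k]) (use k_ge in \<open>auto simp: q_def\<close>)
  moreover have "card {x. x ^ q = x \<and> poly (E g) x = 0} \<le> m"
    using card_mono[OF finite_roots_E, of "{x. x ^ q = x \<and> poly (E g) x = 0}"] roots_E_bound
    by (auto intro: order_trans)
  ultimately have "(\<Sum>s\<in>U. \<nu> s) \<le> q" "q \<le> (\<Sum>s\<in>U. \<nu> s) + m" by linarith+
  then have "\<bar>(\<Sum>s\<in>U. real (\<nu> s)) - real q\<bar> \<le> real m"
    by (simp flip: of_nat_sum)
  then have "\<bar>real d * real (\<nu> t) - real q\<bar> \<le> real m + real (d - 1) * (real (m - 1) * sqrt (real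
    q))"
    using 2 by linarith
  also have "\<dots> \<le> real m * sqrt (real q) + real (d - 1) * (real m * sqrt (real q))"
  proof (intro add_mono mult_left_mono mult_right_mono)
    show "real m \<le> real m * sqrt (real q)"
      using q_gt_1 by (simp add: mult_le_cancel_left1)
  qed auto
  also have "\<dots> = real d * (real m * sqrt (real q))"
    using d0 by (simp add: of_nat_diff algebra_simps)
  finally have "\<bar>real d * real (\<nu> t) - real q\<bar> \<le> real d * (real m * sqrt (real q))" .
  moreover have "\<bar>real d * real (\<nu> t) - real q\<bar> = real d * \<bar>real (\<nu> t) - real q / real d\<bar>"
  proof -
    have "real d * real (\<nu> t) - real q = real d * (real (\<nu> t) - real q / real d)"
      using d0 by (simp add: right_diff_distrib)
    then show ?thesis by (simp add: abs_mult)
  qed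
  ultimately show ?thesis using d0 unfolding \<nu>_def by simp
qed

corollary card_norm_fiber_base:
  fixes t :: 'a
  assumes t: "t ^ d = 1"
  shows "\<bar>real (card {x. poly g x ^ ((q - 1) div d) = t}) - real q / real d\<bar> \<le> real m * sqrt
    (real q)"
proof -
  have tU: "to_ac t \<in> U" using t by (simp add: U_def flip: to_ac_power)
  have "{x. x ^ q = x \<and> G q x = to_ac t} = to_ac ` {x. poly g x ^ ((q - 1) div d) = t}"
  proof -
    have "{x. x ^ q = x \<and> G q x = to_ac t} = {x \<in> range to_ac. G q x = to_ac t}"
      by (auto simp: range_to_ac fr_def)
    also have "\<dots> = to_ac ` {x. poly g x ^ ((q - 1) div d) = t}"
      by (auto simp: G_def poly_map_poly_to_ac simp flip: to_ac_power)
    finally show ?thesis .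
  qed
  then have "card {x. x ^ q = x \<and> G q x = to_ac t} = card {x. poly g x ^ ((q - 1) div d) = t}"
    by (simp add: card_image inj_on_subset[OF inj_to_ac])
  then show ?thesis using card_norm_fiber[OF tU] by simp
qed

end

section \<open>The trace of Frobenius and the Hasse invariant\<close>

lemma finite_field_power_minus_one:
  fixes x :: "'a::{field,finite}"
  assumes "x \<noteq> 0"
  shows "x ^ (CARD('a) - 1) = 1"
proof -
  have "x ^ (CARD('a) - 1) * x = 1 * x"
    using power_minus_mult[of "CARD('a)" x] finite_field_power_card[of x] by simp
  then show ?thesis by (rule mult_right_cancel[OF assms, THEN iffD1])
qed

lemma CARD_field_gt_1: "CARD('a::{field,finite}) > 1"
  using card_mono[of "UNIV :: 'a set" "{0, 1}"] by simp

lemma of_nat_CARD_eq_0: "of_nat CARD('a) = (0 :: 'a::{field,finite})"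
  using CHAR_dvd_CARD[where ?'a = 'a] by (simp add: of_nat_eq_0_iff_char_dvd)

lemma card_roots_unity_le:
  assumes "e \<ge> 1"
  shows "card {x :: 'a::idom. x ^ e = 1} \<le> e" and "finite {x :: 'a. x ^ e = 1}"
proof -
  define P where "P = Polynomial.monom 1 e - (1 :: 'a poly)"
  have "poly.coeff P e \<noteq> 0" using assms by (simp add: P_def)
  then have "P \<noteq> 0" by auto
  have roots: "{x. x ^ e = 1} = {x. poly P x = 0}" by (simp add: P_def poly_monom)
  have "Polynomial.degree P \<le> e"
    unfolding P_def by (rule degree_diff_le) (auto simp: degree_monom_eq)
  then show "card {x :: 'a. x ^ e = 1} \<le> e" "finite {x :: 'a. x ^ e = 1}"
    unfolding roots using card_poly_roots_bound[OF \<open>P \<noteq> 0\<close>] poly_roots_finite[OF \<open>P \<noteq> 0\<close>] by auto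
qed

text \<open>For \<open>0 < e < q - 1\<close> some nonzero \<open>x0\<close> has
  \<open>x0 ^ e \<noteq> 1\<close>; substituting \<open>x0 * x\<close> multiplies the sum by this
  factor, so it vanishes.\<close>

lemma sum_powers_finite_field:
  assumes "e < 2 * (CARD('a) - 1)"
  shows "(\<Sum>x\<in>UNIV. x ^ e) = (if e = CARD('a) - 1 then -1 else 0 :: 'a::{field,finite})"
proof -
  define q where "q = CARD('a)"
  have q: "q > 1" using CARD_field_gt_1 by (simp add: q_def)
  have small: "(\<Sum>x\<in>UNIV. x ^ e) = (0 :: 'a)" if e: "0 < e" "e < q - 1" for e
  proof -
    have "card {x :: 'a. x ^ e = 1} < card (UNIV - {0 :: 'a})"
      using card_roots_unity_le(1)[of e, where ?'a = 'a] e by (simp add: q_def)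
    then have "\<not> UNIV - {0 :: 'a} \<subseteq> {x. x ^ e = 1}"
      using card_mono[of "{x :: 'a. x ^ e = 1}" "UNIV - {0}"] by auto
    then obtain x0 :: 'a where x0: "x0 \<noteq> 0" "x0 ^ e \<noteq> 1" by auto
    have "(\<Sum>x\<in>UNIV. x ^ e) = (\<Sum>x\<in>UNIV. (x0 * x) ^ e)"
      by (rule sum.reindex_bij_witness[of _ "\<lambda>x. x0 * x" "\<lambda>x. x / x0"]) (use x0 in auto)
    also have "\<dots> = x0 ^ e * (\<Sum>x\<in>UNIV. x ^ e)"
      by (simp add: power_mult_distrib sum_distrib_left)
    finally show ?thesis using x0 by (metis mult_cancel_right1)
  qed
  consider "e = 0" | "0 < e" "e < q - 1" | "e = q - 1" | "q - 1 < e" by linarith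
  then show ?thesis
  proof cases
    case 1
    then show ?thesis using q of_nat_CARD_eq_0[where ?'a = 'a] by (simp add: q_def)
  next
    case 2
    then show ?thesis using small by (simp add: q_def)
  next
    case 3
    have "(\<Sum>x\<in>UNIV. x ^ e) = (\<Sum>x\<in>UNIV - {0 :: 'a}. (1 :: 'a))"
    proof (rule sum.mono_neutral_cong_right)
      show "x ^ e = 1" if "x \<in> UNIV - {0}" for x :: 'a
        using that 3 finite_field_power_minus_one[of x] by (simp add: q_def)
    qed (use 3 q in \<open>auto simp: power_0_left\<close>)
    also have "\<dots> = of_nat q - 1"
      using q by (simp add: q_def of_nat_diff)
    finally show ?thesis using 3 of_nat_CARD_eq_0[where ?'a = 'a] by (simp add: q_def)
  next
    \<comment> \<open>Lowering the exponent by \<open>q - 1\<close> is harmless also at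
      \<open>x = 0\<close>, because \<open>e'\<close> stays positive.\<close>
    case 4
    define e' where "e' = e - (q - 1)"
    have e': "0 < e'" "e' < q - 1" "e = (q - 1) + e'" using 4 assms by (auto simp: e'_def q_def)
    have "x ^ e = x ^ e'" for x :: 'a
    proof (cases "x = 0")
      case True
      then show ?thesis using e' by (simp add: power_0_left)
    next
      case False
      then show ?thesis
        using finite_field_power_minus_one[of x] unfolding e'(3) power_add q_def by simp
    qed
    then show ?thesis using small[OF e'(1,2)] 4 by (simp add: q_def)
  qed
qed

lemma sum_poly_finite_field:
  fixes P :: "'a::{field,finite} poly"
  assumes "Polynomial.degree P < 2 * (CARD('a) - 1)"
  shows "(\<Sum>x\<in>UNIV. poly P x) = - poly.coeff P (CARD('a) - 1)"
proof -
  define M where "M = 2 * (CARD('a) - 1)"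
  have M: "CARD('a) - 1 < M" using CARD_field_gt_1[where ?'a = 'a] by (simp add: M_def)
  have "poly P x = (\<Sum>i<M. poly.coeff P i * x ^ i)" for x
    unfolding poly_altdef using assms
    by (intro sum.mono_neutral_left) (auto simp: M_def coeff_eq_0)
  then have "(\<Sum>x\<in>UNIV. poly P x) = (\<Sum>x\<in>UNIV. \<Sum>i<M. poly.coeff P i * x ^ i)" by simp
  also have "\<dots> = (\<Sum>i<M. poly.coeff P i * (\<Sum>x\<in>UNIV. x ^ i))"
    by (subst sum.swap) (simp add: sum_distrib_left)
  also have "\<dots> = (\<Sum>i<M. if i = CARD('a) - 1 then - poly.coeff P i else 0)"
    by (intro sum.cong refl) (simp add: sum_powers_finite_field M_def)
  also have "\<dots> = - poly.coeff P (CARD('a) - 1)" using M by simp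
  finally show ?thesis .
qed

text \<open>Euler's criterion: squaring is two-to-one on nonzero elements, so there are
  \<open>h\<close> nonzero squares, and they exhaust the at most \<open>h\<close> solutions of
  \<open>z ^ h = 1\<close>.\<close>

lemma card_square_roots:
  fixes z :: "'a::{field,finite}"
  assumes odd: "odd CARD('a)"
  shows "of_nat (card {y. y ^ 2 = z}) = 1 + z ^ ((CARD('a) - 1) div 2)"
proof -
  define h where "h = (CARD('a) - 1) div 2"
  have h2: "2 * h = CARD('a) - 1" using odd by (simp add: h_def)
  have h0: "h \<ge> 1" using h2 CARD_field_gt_1[where ?'a = 'a] by linarith
  have two: "(2 :: 'a) \<noteq> 0"
  proof
    assume "(2 :: 'a) = 0"
    then have "of_nat CARD('a) = (1 :: 'a)"
      using odd by (metis add.left_neutral mult_zero_left of_nat_1 of_nat_add of_nat_mult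
        of_nat_numeral oddE)
    then show False using of_nat_CARD_eq_0[where ?'a = 'a] by simp
  qed
  have roots: "{y :: 'a. y ^ 2 = x ^ 2} = {x, - x}" for x
    by (auto simp: power2_eq_iff)
  have card2: "card {y :: 'a. y ^ 2 = x ^ 2} = 2" if "x \<noteq> 0" for x
  proof -
    have "x \<noteq> - x" using that two by (metis add_eq_0_iff2 mult_2 mult_eq_0_iff)
    then show ?thesis by (simp add: roots)
  qed
  have sq: "(x ^ 2) ^ h = 1" if "x \<noteq> 0" for x :: 'a
    using finite_field_power_minus_one[OF that] by (simp add: h2 flip: power_mult)
  define Sq where "Sq = (\<lambda>x :: 'a. x ^ 2) ` (UNIV - {0})"
  have "card (UNIV - {0 :: 'a}) = (\<Sum>y\<in>Sq. card {x \<in> UNIV - {0}. x ^ 2 = y})"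
    unfolding Sq_def card_eq_sum by (rule sum.image_gen) simp
  also have "\<dots> = (\<Sum>y\<in>Sq. 2)"
  proof (intro sum.cong refl)
    fix y assume "y \<in> Sq"
    then obtain x where x: "x \<noteq> 0" "y = x ^ 2" by (auto simp: Sq_def)
    then have "{x' \<in> UNIV - {0}. x' ^ 2 = y} = {x'. x' ^ 2 = x ^ 2}" by auto
    then show "card {x \<in> UNIV - {0}. x ^ 2 = y} = 2" using card2[OF x(1)] by simp
  qed
  finally have cSq: "card Sq = h" using h2 by simp
  have "Sq = {z. z ^ h = 1}"
  proof (rule card_subset_eq)
    show sub: "Sq \<subseteq> {z. z ^ h = 1}" using sq by (auto simp: Sq_def)
    show "card Sq = card {z :: 'a. z ^ h = 1}"
      using card_mono[OF card_roots_unity_le(2)[OF h0] sub] card_roots_unity_le(1)[OF h0, where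
        ?'a = 'a] cSq
      by simp
  qed (rule card_roots_unity_le(2)[OF h0])
  show ?thesis unfolding h_def[symmetric]
  proof (cases "z = 0")
    case True
    then show "of_nat (card {y. y ^ 2 = z}) = 1 + z ^ h" using h0 by (simp add: power_0_left)
  next
    case False
    show "of_nat (card {y. y ^ 2 = z}) = 1 + z ^ h"
    proof (cases "\<exists>x. z = x ^ 2")
      case True
      then obtain x where x: "z = x ^ 2" by auto
      then have "x \<noteq> 0" using False by auto
      then show ?thesis using card2[of x] sq[of x] x by simp
    next
      case no: False
      then have "z \<notin> Sq" by (auto simp: Sq_def)
      then have "z ^ h \<noteq> 1" using \<open>Sq = {z. z ^ h = 1}\<close> by auto
      moreover have "(z ^ h) ^ 2 = z ^ (2 * h)"
        by (simp add: mult.commute flip: power_mult)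
      then have "(z ^ h) ^ 2 = 1"
        unfolding h2 using finite_field_power_minus_one[OF False] by simp
      ultimately have "z ^ h = - 1" by (auto simp: power2_eq_1_iff)
      moreover have "{y. y ^ 2 = z} = {}" using no by auto
      ultimately show ?thesis by simp
    qed
  qed
qed

text \<open>Counting \<open>y\<close> for each \<open>x\<close> by Euler's criterion turns the trace
  into minus the sum of \<open>F ^ h\<close> over the field. The degree \<open>3 * h\<close> is
  below \<open>4 * h\<close>, so this sum is minus a single coefficient.\<close>

lemma of_int_frob_trace:
  fixes A B :: "'a::{field,finite}"
  assumes odd: "odd CARD('a)"
  shows "of_int (frob_trace A B) = poly.coeff ([:B, A, 0, 1:] ^ ((CARD('a) - 1) div 2))
    (CARD('a) - 1)"
proof -
  define F where "F = [:B, A, 0, 1:]"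
  define h where "h = (CARD('a) - 1) div 2"
  have h2: "2 * h = CARD('a) - 1" using odd by (simp add: h_def)
  have h0: "h \<ge> 1" using h2 CARD_field_gt_1[where ?'a = 'a] by linarith
  have Fx: "poly F x = x ^ 3 + A * x + B" for x
    by (simp add: F_def power3_eq_cube algebra_simps)
  define aff where "aff = (SIGMA x:UNIV. {y. y ^ 2 = poly F x})"
  have "ec_points A B = insert Infinity ((\<lambda>(x,y). Affine x y) ` aff)"
    by (auto simp: ec_points_def aff_def Fx)
  moreover have "card ((\<lambda>(x,y). Affine x y) ` aff) = card aff"
    by (rule card_image) (auto simp: inj_on_def)
  moreover have "card aff = (\<Sum>x\<in>UNIV. card {y. y ^ 2 = poly F x})"
    unfolding aff_def by (rule card_SigmaI) auto
  ultimately have "card (ec_points A B) = Suc (\<Sum>x\<in>UNIV. card {y. y ^ 2 = poly F x})"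
    by (subst \<open>ec_points A B = _\<close>) (auto simp: card_insert_if)
  then have "of_int (frob_trace A B) = (of_nat CARD('a) - (\<Sum>x\<in>UNIV. of_nat (card {y. y ^ 2 =
    poly F x})) :: 'a)"
    by (simp add: frob_trace_def)
  also have "\<dots> = - (\<Sum>x\<in>UNIV. 1 + poly F x ^ h)"
    unfolding h_def by (simp only: card_square_roots[OF odd] of_nat_CARD_eq_0 diff_0)
  also have "\<dots> = - (\<Sum>x\<in>UNIV. poly (F ^ h) x)"
    using of_nat_CARD_eq_0[where ?'a = 'a] by (simp add: sum.distrib)
  also have "\<dots> = poly.coeff (F ^ h) (CARD('a) - 1)"
  proof -
    have "Polynomial.degree (F ^ h) = 3 * h"
      by (simp add: F_def degree_power_eq)
    then show ?thesis using h2 h0 by (subst sum_poly_finite_field) auto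
  qed
  finally show ?thesis by (simp add: F_def h_def)
qed

section \<open>The Hasse invariant and its norm\<close>

lemma coeff_power_CHAR:
  fixes P :: "'a::comm_ring_1 poly"
  assumes p: "prime p" "CHAR('a) = p"
  shows "poly.coeff (P ^ p) j = (if p dvd j then poly.coeff P (j div p) ^ p else 0)"
proof -
  have p0: "p > 0" using p(1) by (rule prime_gt_0_nat)
  have "P ^ p = (\<Sum>i\<le>Polynomial.degree P. Polynomial.monom (poly.coeff P i) i) ^ p"
    by (simp add: poly_as_sum_of_monoms)
  also have "\<dots> = (\<Sum>i\<le>Polynomial.degree P. Polynomial.monom (poly.coeff P i) i ^ p)"
    using p by (intro freshmans_dream_sum) auto
  finally have "poly.coeff (P ^ p) j = (\<Sum>i\<le>Polynomial.degree P. if i * p = j then poly.coeff P i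
    ^ p else 0)"
    by (simp add: monom_power coeff_sum)
  also have "\<dots> = (if p dvd j then poly.coeff P (j div p) ^ p else 0)"
  proof (cases "p dvd j")
    case True
    then obtain c where c: "j = p * c" by (rule dvdE)
    have "(\<Sum>i\<le>Polynomial.degree P. if i * p = j then poly.coeff P i ^ p else 0) =
        (\<Sum>i\<le>Polynomial.degree P. if i = c then poly.coeff P i ^ p else 0)"
      using p0 by (intro sum.cong refl) (auto simp: c)
    also have "\<dots> = poly.coeff P c ^ p"
      using p0 by (auto simp: coeff_eq_0 power_0_left)
    finally show ?thesis using c p0 by simp
  qed (auto intro!: sum.neutral)
  finally show ?thesis .
qed

text \<open>The power splits as \<open>F ^ n * (F ^ e) ^ p\<close>. The second factor only has
  exponents divisible by \<open>p\<close>, and the degree of the first leaves only its coefficient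
  at \<open>p - 1\<close>; induction then builds up the norm exponent.\<close>

lemma coeff_power_norm:
  fixes F :: "'a::comm_ring_1 poly"
  assumes p: "prime p" "CHAR('a) = p" "odd p" and F: "Polynomial.degree F \<le> 3"
  shows "poly.coeff (F ^ ((p ^ k - 1) div 2)) (p ^ k - 1) =
    poly.coeff (F ^ ((p - 1) div 2)) (p - 1) ^ ((p ^ k - 1) div (p - 1))"
proof (induction k)
  case (Suc k)
  define n where "n = (p - 1) div 2"
  define H where "H = poly.coeff (F ^ n) (p - 1)"
  define P where "P = F ^ ((p ^ k - 1) div 2)"
  have p3: "p \<ge> 3" using p prime_ge_2_nat[of p] by (cases "p = 2") auto
  have n2: "2 * n + 1 = p" using p p3 by (simp add: n_def)
  define e where "e = (p ^ k - 1) div 2"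
  have e2: "2 * e + 1 = p ^ k" using p p3 by (simp add: e_def)
  have pk: "p ^ Suc k - 1 = p * (p ^ k - 1) + (p - 1)"
    using p3 by (simp add: diff_mult_distrib2)
  have "(p ^ Suc k - 1) = 2 * (n + e * p)"
    using n2 e2 unfolding pk by (simp add: algebra_simps flip: e2)
  then have half: "(p ^ Suc k - 1) div 2 = n + e * p" by simp
  have div: "(p ^ Suc k - 1) div (p - 1) = 1 + p * ((p ^ k - 1) div (p - 1))"
  proof -
    have "p - 1 dvd p ^ k - 1"
      using geometric_sum_nat[of p k] p3 by (metis dvd_triv_left le_trans one_le_numeral)
    then obtain c where c: "p ^ k - 1 = (p - 1) * c" by (rule dvdE)
    then have "(p ^ k - 1) div (p - 1) = c" using p3 by simp
    then have E: "p * (p ^ k - 1) + (p - 1) = (p - 1) * (1 + p * ((p ^ k - 1) div (p - 1)))"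
      unfolding c by (simp only: distrib_left mult_1_right mult_ac add_ac)
    show ?thesis unfolding pk E by (rule nonzero_mult_div_cancel_left) (use p3 in simp)
  qed
  have degn: "Polynomial.degree (F ^ n) \<le> 3 * n"
    using degree_power_le[of F n] F by (meson le_trans mult_le_mono1)
  have "poly.coeff (F ^ ((p ^ Suc k - 1) div 2)) (p ^ Suc k - 1) =
      poly.coeff (F ^ n * P ^ p) (p ^ Suc k - 1)"
    unfolding half P_def e_def[symmetric] by (simp add: power_add power_mult)
  also have "\<dots> = (\<Sum>i\<le>p ^ Suc k - 1. poly.coeff (F ^ n) i * poly.coeff (P ^ p) (p ^ Suc k - 1 - i))"
    by (rule coeff_mult)
  also have "\<dots> = (\<Sum>i\<in>{p - 1}. poly.coeff (F ^ n) i * poly.coeff (P ^ p) (p ^ Suc k - 1 - i))"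
  proof (rule sum.mono_neutral_right)
    show "{p - 1} \<subseteq> {..p ^ Suc k - 1}" unfolding pk by simp
    show "\<forall>i\<in>{..p ^ Suc k - 1} - {p - 1}. poly.coeff (F ^ n) i * poly.coeff (P ^ p) (p ^ Suc k -
      1 - i) = 0"
    proof
      fix i assume i: "i \<in> {..p ^ Suc k - 1} - {p - 1}"
      show "poly.coeff (F ^ n) i * poly.coeff (P ^ p) (p ^ Suc k - 1 - i) = 0"
      proof (cases "i \<le> 3 * n")
        case True
        have "\<not> p dvd p ^ Suc k - 1 - i"
        proof
          assume "p dvd p ^ Suc k - 1 - i"
          moreover have "p ^ Suc k - 1 - i + (i + 1) = p ^ Suc k"
          proof -
            have "i \<le> p ^ Suc k - 1" "0 < p ^ Suc k" using i p3 by auto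
            then show ?thesis by linarith
          qed
          ultimately have "p dvd i + 1"
            by (metis dvd_add_right_iff dvd_power zero_less_Suc)
          then obtain c where c: "i + 1 = p * c" by (rule dvdE)
          have "i + 1 < p * 2" using True n2 by linarith
          then have "c = 1" using c by (cases c rule: nat.exhaust) (auto simp: less_Suc_eq)
          then have "i = p - 1" using c by simp
          then show False using i by simp
        qed
        then show ?thesis by (simp add: coeff_power_CHAR[OF p(1,2)])
      next
        case False
        then show ?thesis using degn by (simp add: coeff_eq_0)
      qed
    qed
  qed simp
  also have "\<dots> = H * poly.coeff (P ^ p) (p * (p ^ k - 1))"
    unfolding pk H_def by simp
  also have "\<dots> = H * poly.coeff P (p ^ k - 1) ^ p"
    using p3 by (simp add: coeff_power_CHAR[OF p(1,2)])
  also have "\<dots> = H ^ ((p ^ Suc k - 1) div (p - 1))"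
    unfolding P_def Suc.IH div n_def[symmetric] H_def[symmetric]
    by (simp add: mult.commute flip: power_mult)
  finally show ?case by (simp add: H_def n_def)
qed simp

section \<open>The Hasse invariant as a polynomial\<close>

text \<open>A multinomial term of \<open>(x ^ 3 + A * x + B) ^ n\<close> at
  \<open>x ^ (2 * n)\<close>: \<open>c\<close> factors supply \<open>B\<close>,
  \<open>(n + c) div 2\<close> supply \<open>x ^ 3\<close>, the others \<open>A * x\<close>. The
  condition says that this is possible.\<close>

definition hasse_coeff :: "nat \<Rightarrow> 'a::comm_ring_1 \<Rightarrow> nat \<Rightarrow> 'a" where
  "hasse_coeff n A c = (if even (n + c) \<and> (n + c) div 2 \<le> n - c
     then of_nat ((n choose c) * ((n - c) choose ((n + c) div 2))) * A ^ (n - c - (n + c) div 2)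
     else 0)"

text \<open>For \<open>p = 2 * n + 1\<close>, the Hasse invariant of \<open>y\<^sup>2 = x\<^sup>3 + A x + B\<close> as a polynomial in \<open>B\<close>.\<close>
definition hasse_poly :: "nat \<Rightarrow> 'a::comm_ring_1 \<Rightarrow> 'a poly" where
  "hasse_poly n A = (\<Sum>c\<le>n. Polynomial.monom (hasse_coeff n A c) c)"

lemma coeff_hasse_poly: "poly.coeff (hasse_poly n A) c = hasse_coeff n A c"
proof -
  have "poly.coeff (hasse_poly n A) c = (\<Sum>i\<le>n. if i = c then hasse_coeff n A i else 0)"
    by (simp add: hasse_poly_def coeff_sum)
  also have "\<dots> = hasse_coeff n A c"
    by (auto simp: hasse_coeff_def binomial_eq_0)
  finally show ?thesis .
qed

lemma degree_hasse_poly: "Polynomial.degree (hasse_poly n A) \<le> n"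
  unfolding hasse_poly_def
  by (rule degree_sum_le) (auto intro: order_trans[OF degree_monom_le])

lemma coeff_of_nat_mult: "poly.coeff (of_nat m * P) i = of_nat m * poly.coeff P i"
  by (simp add: of_nat_poly)

text \<open>The cubic is expanded by the binomial theorem in two stages, as
  \<open>B + x * (x ^ 2 + A)\<close>.\<close>

lemma poly_hasse_poly:
  fixes A B :: "'a::comm_ring_1"
  shows "poly (hasse_poly n A) B = poly.coeff ([:B, A, 0, 1:] ^ n) (2 * n)"
proof -
  have inner: "poly.coeff ((Polynomial.monom 1 2 + [:A:]) ^ j) N =
      (if even N \<and> N div 2 \<le> j then of_nat (j choose (N div 2)) * A ^ (j - N div 2) else 0)" for j N
  proof -
    have "poly.coeff ((Polynomial.monom 1 2 + [:A:]) ^ j) N =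
        (\<Sum>l\<le>j. of_nat (j choose l) * poly.coeff (Polynomial.monom 1 (2 * l) * [:A ^ (j - l):]) N)"
      unfolding binomial_ring coeff_sum
      by (intro sum.cong refl) (simp add: mult.assoc coeff_of_nat_mult monom_power
        poly_const_pow mult.commute[of _ 2])
    also have "\<dots> = (\<Sum>l\<le>j. if 2 * l = N then of_nat (j choose l) * A ^ (j - l) else 0)"
      by (intro sum.cong refl) (auto simp: coeff_monom_mult coeff_pCons split: nat.splits)
    also have "\<dots> = (if even N \<and> N div 2 \<le> j then of_nat (j choose (N div 2)) * A ^ (j - N div 2)
      else 0)"
    proof (cases "even N")
      case True
      then have "2 * l = N \<longleftrightarrow> l = N div 2" for l by auto
      then show ?thesis using True by simp
    qed (auto intro!: sum.neutral)
    finally show ?thesis .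
  qed
  have F: "[:B, A, 0, 1:] = [:B:] + Polynomial.monom 1 1 * (Polynomial.monom 1 2 + [:A:])"
    by (simp add: monom_altdef power2_eq_square)
  have "poly.coeff ([:B, A, 0, 1:] ^ n) (2 * n) =
      (\<Sum>c\<le>n. of_nat (n choose c) * (B ^ c * poly.coeff ((Polynomial.monom 1 2 + [:A:]) ^ (n -
        c)) (n + c)))"
  proof -
    define Z where "Z = Polynomial.monom 1 2 + [:A:]"
    show ?thesis
      unfolding F Z_def[symmetric] binomial_ring[of "[:B:]"] coeff_sum
      by (intro sum.cong refl)
        (simp add: mult.assoc coeff_of_nat_mult poly_const_pow power_mult_distrib monom_power
          coeff_monom_mult)
  qed
  also have "\<dots> = (\<Sum>c\<le>n. hasse_coeff n A c * B ^ c)"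
    by (intro sum.cong refl) (simp add: inner hasse_coeff_def mult_ac)
  also have "\<dots> = poly (hasse_poly n A) B"
    by (simp add: hasse_poly_def poly_sum poly_monom)
  finally show ?thesis by simp
qed

lemma of_nat_nonzero_less:
  assumes "0 < m" "m < CHAR('a::semiring_1)"
  shows "(of_nat m :: 'a) \<noteq> 0"
  using assms by (auto simp: of_nat_eq_0_iff_char_dvd dest: dvd_imp_le)

text \<open>This compares the multinomial coefficients of \<open>(c, l, b)\<close> and
  \<open>(c + 2, l + 1, b - 3)\<close>, each \<open>fact n\<close> divided by three factorials. For
  \<open>b < 3\<close> both sides vanish.\<close>

lemma multinomial_step:
  assumes l: "l \<le> n - c" and c: "c \<le> n"
  defines "b \<equiv> n - c - l"
  shows "(n choose (c + 2)) * ((n - (c + 2)) choose (l + 1)) * ((c + 1) * (c + 2) * (l + 1)) =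
    (n choose c) * ((n - c) choose l) * (b * (b - 1) * (b - 2))"
proof (cases "b \<ge> 3")
  case False
  then have "(n - (c + 2)) choose (l + 1) = 0 \<or> c + 2 > n"
    using l by (auto simp: b_def binomial_eq_0_iff)
  moreover have "b * (b - 1) * (b - 2) = 0" using False by (auto simp: less_Suc_eq numeral_3_eq_3)
  ultimately show ?thesis by (auto simp: binomial_eq_0)
next
  case True
  define b' where "b' = b - 3"
  have n: "n = c + 2 + (l + 1 + b')" using True l c by (simp add: b'_def b_def)
  have b: "b = b' + 3" using True by (simp add: b'_def)
  have 1: "(n choose c) * ((n - c) choose l) * (fact c * fact l * fact b) = fact n"
  proof -
    have e1: "fact c * fact (n - c) * (n choose c) = fact n" using c by (rule binomial_fact_lemma)
    have e2: "fact l * fact b * ((n - c) choose l) = fact (n - c)"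
      unfolding b_def using l by (rule binomial_fact_lemma)
    have "(n choose c) * ((n - c) choose l) * (fact c * fact l * fact b) =
        fact c * (fact l * fact b * ((n - c) choose l)) * (n choose c)" by (simp only: mult_ac)
    then show ?thesis by (simp only: e1 e2)
  qed
  have 2: "(n choose (c + 2)) * ((n - (c + 2)) choose (l + 1)) * (fact (c + 2) * fact (l + 1) *
    fact b') = fact n"
  proof -
    have e1: "fact (c + 2) * fact (n - (c + 2)) * (n choose (c + 2)) = fact n"
      by (rule binomial_fact_lemma) (simp add: n)
    have "fact (l + 1) * fact (n - (c + 2) - (l + 1)) * ((n - (c + 2)) choose (l + 1)) = fact (n
      - (c + 2))"
      by (rule binomial_fact_lemma) (simp add: n)
    moreover have "n - (c + 2) - (l + 1) = b'" by (simp add: n)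
    ultimately have e2: "fact (l + 1) * fact b' * ((n - (c + 2)) choose (l + 1)) = fact (n - (c
      + 2))"
      by simp
    have "(n choose (c + 2)) * ((n - (c + 2)) choose (l + 1)) * (fact (c + 2) * fact (l + 1) *
      fact b') =
        fact (c + 2) * (fact (l + 1) * fact b' * ((n - (c + 2)) choose (l + 1))) * (n choose (c
          + 2))"
      by (simp only: mult_ac)
    then show ?thesis by (simp only: e1 e2)
  qed
  have f1: "fact (c + 2) = (c + 1) * (c + 2) * (fact c :: nat)" by (simp add: algebra_simps)
  have f2: "fact (l + 1) = (l + 1) * (fact l :: nat)" by simp
  have f3: "fact b = b * (b - 1) * (b - 2) * (fact b' :: nat)"
    unfolding b by (simp add: numeral_3_eq_3 algebra_simps)
  define C C' where "C = (n choose c) * ((n - c) choose l)"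
    and "C' = (n choose (c + 2)) * ((n - (c + 2)) choose (l + 1))"
  have "C' * ((c + 1) * (c + 2) * (l + 1)) * (fact c * fact l * fact b') =
      C' * (fact (c + 2) * fact (l + 1) * fact b')"
    unfolding f1 f2 by (simp only: mult_ac)
  also have "\<dots> = C * (fact c * fact l * fact b)"
    using 1 2 by (simp add: C_def C'_def)
  also have "\<dots> = C * (b * (b - 1) * (b - 2)) * (fact c * fact l * fact b')"
    unfolding f3 by (simp only: mult_ac)
  finally show ?thesis
    unfolding C_def[symmetric] C'_def[symmetric] by (subst (asm) mult_right_cancel) auto
qed

text \<open>In characteristic \<open>2 * n + 1\<close> one has \<open>2 * n = -1\<close>, so
  \<open>4 * l = 2 * c - 1\<close> and \<open>4 * b = - 6 * c - 1\<close>, and the ratio of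
  successive coefficients depends on \<open>c\<close> and \<open>A\<close> alone.\<close>

lemma hasse_recurrence:
  fixes A :: "'a::field"
  assumes p: "prime (2 * n + 1)" "CHAR('a) = 2 * n + 1" "n \<ge> 2"
  shows "16 * of_nat ((c + 1) * (c + 2)) * A ^ 3 * hasse_coeff n A (c + 2) +
    3 * (36 * of_nat c * of_nat c + 36 * of_nat c + 5) * hasse_coeff n A c = 0"
proof (cases "even (n + c) \<and> (n + c) div 2 \<le> n - c")
  case False
  then have "\<not> (even (n + (c + 2)) \<and> (n + (c + 2)) div 2 \<le> n - (c + 2))" by auto
  with False show ?thesis by (simp only: hasse_coeff_def if_False mult_zero_right add_0_right)
next
  case True
  define l where "l = (n + c) div 2"
  define b where "b = n - c - l"
  have l2: "2 * l = n + c" using True by (simp add: l_def)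
  have lle: "l \<le> n - c" using True by (simp add: l_def)
  have cn: "c \<le> n" using l2 lle p(3) by linarith
  have nb: "n = c + l + b" using lle cn by (simp add: b_def)
  have l'2: "(n + (c + 2)) div 2 = l + 1" using l2 by simp
  define M where "M = (of_nat ((n choose c) * ((n - c) choose l)) :: 'a)"
  define M' where "M' = (of_nat ((n choose (c + 2)) * ((n - (c + 2)) choose (l + 1))) :: 'a)"
  define x where "x = (of_nat c :: 'a)"
  have hn: "2 * of_nat n = (-1 :: 'a)"
    using of_nat_CHAR[where ?'a = 'a] unfolding p(2) by (simp add: eq_neg_iff_add_eq_0 add.commute)
  have hl: "4 * of_nat l = 2 * x - (1 :: 'a)"
  proof -
    have "4 * of_nat l = (2 * of_nat (2 * l) :: 'a)" by simp
    also have "\<dots> = 2 * of_nat n + 2 * x" unfolding l2 x_def by (simp add: algebra_simps)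
    finally show ?thesis using hn by simp
  qed
  have hb: "4 * of_nat b = - (6 * x) - (1 :: 'a)"
  proof -
    have "4 * of_nat b = 2 * (2 * of_nat n) - 4 * x - (4 * of_nat l :: 'a)"
      unfolding nb x_def by (simp add: algebra_simps)
    also have "\<dots> = 2 * (-1) - 4 * x - (2 * x - 1)" unfolding hn hl ..
    also have "\<dots> = - (6 * x) - (1 :: 'a)" by (simp add: algebra_simps)
    finally show ?thesis .
  qed
  have b3: "(of_nat (b * (b - 1) * (b - 2)) :: 'a) = of_nat b * (of_nat b - 1) * (of_nat b - 2)"
  proof (cases "b \<ge> 2")
    case True
    then show ?thesis by (simp add: of_nat_diff)
  next
    case False
    then have "b = 0 \<or> b = 1" by auto
    then show ?thesis by auto
  qed
  have step: "M' * ((x + 1) * (x + 2) * (of_nat l + 1)) = M * (of_nat b * (of_nat b - 1) *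
    (of_nat b - 2))"
    using arg_cong[OF multinomial_step[OF lle cn], of "of_nat :: nat \<Rightarrow> 'a"]
    unfolding b_def[symmetric] of_nat_mult[of _ "b * _ * _"] b3 M_def M'_def x_def
    by (simp add: algebra_simps)
  \<comment> \<open>The factors in \<open>b\<close> become \<open>- (6 * x + 1)\<close>,
    \<open>- (6 * x + 5)\<close> and \<open>- 3 * (2 * x + 3)\<close>; the common factor
    \<open>2 * x + 3\<close> is \<open>4 * (l + 1)\<close>, which is nonzero and can be
    cancelled.\<close>
  have "(2 * x + 3) * (16 * (x + 1) * (x + 2) * M' + 3 * (36 * x * x + 36 * x + 5) * M) =
      16 * (4 * of_nat l + 4) * (x + 1) * (x + 2) * M' + (2 * x + 3) * 3 * (36 * x * x + 36 * x
        + 5) * M"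
    unfolding hl by (simp add: algebra_simps)
  also have "16 * (4 * of_nat l + 4) * (x + 1) * (x + 2) * M' = 64 * (M' * ((x + 1) * (x + 2) *
    (of_nat l + 1)))"
    by (simp add: algebra_simps)
  also have "\<dots> = M * ((4 * of_nat b) * (4 * of_nat b - 4) * (4 * of_nat b - 8))"
    unfolding step by (simp add: algebra_simps)
  also have "\<dots> + (2 * x + 3) * 3 * (36 * x * x + 36 * x + 5) * M = 0"
    unfolding hb by (simp add: algebra_simps)
  finally have *: "(2 * x + 3) * (16 * (x + 1) * (x + 2) * M' + 3 * (36 * x * x + 36 * x + 5) *
    M) = 0" .
  have "2 * x + 3 = 4 * of_nat (l + 1)" using hl by (simp add: algebra_simps)
  moreover have "(of_nat (l + 1) :: 'a) \<noteq> 0"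
    using lle p(3) by (intro of_nat_nonzero_less) (auto simp: p(2))
  moreover have "(4 :: 'a) \<noteq> 0"
    using of_nat_nonzero_less[of 4, where ?'a = 'a] p(2,3) by simp
  ultimately have "2 * x + 3 \<noteq> 0" by (simp only: mult_eq_0_iff) simp
  then have eq: "16 * (x + 1) * (x + 2) * M' + 3 * (36 * x * x + 36 * x + 5) * M = 0"
    using * by (simp only: mult_eq_0_iff simp_thms)
  have hc: "hasse_coeff n A c = M * A ^ b"
    using True by (simp add: hasse_coeff_def M_def b_def l_def)
  have hc': "A ^ 3 * hasse_coeff n A (c + 2) = M' * A ^ b"
  proof (cases "b \<ge> 3")
    case True
    then have "l + 1 \<le> n - (c + 2)" "n - (c + 2) - (l + 1) = b - 3" using nb by auto
    then have "hasse_coeff n A (c + 2) = M' * A ^ (b - 3)"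
      using \<open>even (n + c) \<and> _\<close> unfolding hasse_coeff_def l'2 by (simp add: M'_def)
    moreover have "A ^ b = A ^ 3 * A ^ (b - 3)" using True by (simp flip: power_add)
    ultimately show ?thesis by simp
  next
    case False
    then have lt: "n - (c + 2) < l + 1" using nb by simp
    then have "M' = 0" by (simp add: M'_def binomial_eq_0)
    moreover have "hasse_coeff n A (c + 2) = 0" unfolding hasse_coeff_def l'2 using lt by simp
    ultimately show ?thesis by simp
  qed
  have "16 * of_nat ((c + 1) * (c + 2)) * A ^ 3 * hasse_coeff n A (c + 2) +
      3 * (36 * of_nat c * of_nat c + 36 * of_nat c + 5) * hasse_coeff n A c =
      16 * (x + 1) * (x + 2) * (A ^ 3 * hasse_coeff n A (c + 2)) + 3 * (36 * x * x + 36 * x + 5)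
        * hasse_coeff n A c"
    by (simp add: x_def algebra_simps)
  also have "\<dots> = (16 * (x + 1) * (x + 2) * M' + 3 * (36 * x * x + 36 * x + 5) * M) * A ^ b"
    unfolding hc hc' by (simp add: algebra_simps)
  finally show ?thesis using eq by simp
qed

text \<open>The Picard--Fuchs equation of the family of curves with fixed \<open>A\<close>.\<close>
lemma hasse_ode:
  fixes A :: "'a::field"
  assumes "prime (2 * n + 1)" "CHAR('a) = 2 * n + 1" "n \<ge> 2"
  shows "[:16 * A ^ 3, 0, 108:] * pderiv (pderiv (hasse_poly n A)) + [:0, 216:] * pderiv
    (hasse_poly n A)
    + Polynomial.smult 15 (hasse_poly n A) = 0"
proof (rule poly_eqI)
  fix c
  let ?h = "hasse_coeff n A"
  have "poly.coeff ([:16 * A ^ 3, 0, 108:] * pderiv (pderiv (hasse_poly n A)) + [:0, 216:] *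
    pderiv (hasse_poly n A)
    + Polynomial.smult 15 (hasse_poly n A)) c =
      16 * A ^ 3 * (of_nat (c + 1) * (of_nat (c + 2) * ?h (c + 2)))
      + 108 * (of_nat c * (of_nat c - 1) * ?h c) + 216 * (of_nat c * ?h c) + 15 * ?h c"
  proof -
    have 1: "poly.coeff ([:a, 0, b:] * P) c = a * poly.coeff P c + (if c \<ge> 2 then b * poly.coeff
      P (c - 2) else 0)"
      for a b and P :: "'a poly"
      by (auto simp: coeff_pCons numeral_2_eq_2 split: nat.splits)
    have 2: "poly.coeff ([:0, b:] * P) c = (if c \<ge> 1 then b * poly.coeff P (c - 1) else 0)"
      for b and P :: "'a poly"
      by (auto simp: coeff_pCons split: nat.splits)
    consider "c = 0" | "c = 1" | i where "c = Suc (Suc i)" by (metis One_nat_def not0_implies_Suc)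
    then show ?thesis
      unfolding coeff_add 1 2 coeff_smult coeff_pderiv coeff_hasse_poly
      by cases (simp_all add: mult_ac)
  qed
  also have "\<dots> = 16 * of_nat ((c + 1) * (c + 2)) * A ^ 3 * hasse_coeff n A (c + 2) +
    3 * (36 * of_nat c * of_nat c + 36 * of_nat c + 5) * hasse_coeff n A c"
    by (simp add: algebra_simps)
  also have "\<dots> = 0" by (rule hasse_recurrence[OF assms])
  finally show "poly.coeff ([:16 * A ^ 3, 0, 108:] * pderiv (pderiv (hasse_poly n A)) + [:0,
    216:] * pderiv (hasse_poly n A)
    + Polynomial.smult 15 (hasse_poly n A)) c = poly.coeff 0 c" by simp
qed

section \<open>Simple roots from the differential equation\<close>

lemma pderiv_linear_power_mult:
  fixes u :: "'a::idom poly"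
  shows "pderiv ([:- b, 1:] ^ Suc n * u) = [:- b, 1:] ^ n * (Polynomial.smult (of_nat (Suc n)) u
    + [:- b, 1:] * pderiv u)"
proof -
  have "pderiv [:- b, 1:] = 1" by (simp add: pderiv_pCons)
  then have "pderiv ([:- b, 1:] ^ Suc n * u) = [:- b, 1:] ^ Suc n * pderiv u + u *
    Polynomial.smult (of_nat (Suc n)) ([:- b, 1:] ^ n)"
    by (simp only: pderiv_mult pderiv_power_Suc mult_1_right)
  then show ?thesis by (simp only: distrib_left mult_smult_right mult_smult_left power_Suc
    mult_ac add_ac)
qed

text \<open>At a root of order at least 2 the lowest terms of the equation force its leading
  coefficient to vanish at \<open>b\<close>; then the next terms force \<open>b = 0\<close> and
  hence \<open>A = 0\<close>. The degree bound keeps the factors \<open>s\<close> and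
  \<open>s'\<close> from differentiation nonzero.\<close>

lemma ode_simple_roots:
  fixes f :: "'a::field poly"
  assumes char: "CHAR('a) = p" "prime p" "p \<ge> 5" and deg: "Polynomial.degree f < p" and f0: "f \<noteq> 0"
    and A: "A \<noteq> 0"
    and ode: "[:16 * A ^ 3, 0, 108:] * pderiv (pderiv f) + [:0, 216:] * pderiv f +
      Polynomial.smult 15 f = 0"
  shows "Polynomial.order b f \<le> 1"
proof (rule ccontr)
  assume "\<not> ?thesis"
  then obtain w where w: "Polynomial.order b f = Suc (Suc w)"
    by (metis One_nat_def not_less_eq_eq Suc_le_D le_Suc_eq nat_le_linear Suc_le_mono)
  have wp: "Suc (Suc w) < p" using order_degree[OF f0, of b] w deg by simp
  define Y where "Y = [:- b, 1:]"
  obtain u where u: "f = Y ^ Suc (Suc w) * u" "\<not> Y dvd u"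
    using order_decomp[OF f0, of b] unfolding w Y_def by blast
  have ub: "poly u b \<noteq> 0" using u(2) by (simp add: Y_def poly_eq_0_iff_dvd)
  have Yb: "poly Y b = 0" by (simp add: Y_def)
  have Y0: "Y \<noteq> 0" by (simp add: Y_def)
  define s where "s = (of_nat (Suc (Suc w)) :: 'a)"
  define s' where "s' = (of_nat (Suc w) :: 'a)"
  define v where "v = Polynomial.smult s u + Y * pderiv u"
  have d1: "pderiv f = Y ^ Suc w * v"
    unfolding u(1) Y_def v_def s_def by (rule pderiv_linear_power_mult)
  define v' where "v' = Polynomial.smult s' v + Y * pderiv v"
  have d2: "pderiv (pderiv f) = Y ^ w * v'"
    unfolding d1 unfolding Y_def v'_def s'_def by (rule pderiv_linear_power_mult)
  have "Y ^ w * ([:16 * A ^ 3, 0, 108:] * v' + Y * ([:0, 216:] * v + Y * Polynomial.smult 15 u))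
    = 0"
    using ode unfolding d2 unfolding d1 unfolding u(1)
    by (simp only: power_Suc distrib_left mult_smult_right mult_smult_left mult_ac add_ac)
  then have eq: "[:16 * A ^ 3, 0, 108:] * v' + Y * ([:0, 216:] * v + Y * Polynomial.smult 15 u) = 0"
    using Y0 by simp
  have s0: "s \<noteq> 0" "s' \<noteq> 0"
    unfolding s_def s'_def by (rule of_nat_nonzero_less; use wp char in simp)+
  have vb: "poly v b = s * poly u b" "poly v' b = s' * (s * poly u b)"
    by (simp_all add: v_def v'_def Yb)
  have "poly ([:16 * A ^ 3, 0, 108:] * v' + Y * ([:0, 216:] * v + Y * Polynomial.smult 15 u)) b = 0"
    unfolding eq by simp
  then have "(16 * A ^ 3 + 108 * b ^ 2) * (s' * (s * poly u b)) = 0"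
    by (simp add: Yb vb power2_eq_square algebra_simps)
  then have disc: "16 * A ^ 3 + 108 * b ^ 2 = 0"
    using s0 ub by simp
  \<comment> \<open>At such a \<open>b\<close> the leading coefficient itself has a factor
    \<open>Y\<close>, which can be cancelled once more.\<close>
  have "[:16 * A ^ 3, 0, 108:] = Y * Polynomial.smult 108 [:b, 1:]"
  proof -
    have "16 * A ^ 3 = - (108 * (b * b))" using disc by (simp add: eq_neg_iff_add_eq_0
      power2_eq_square)
    then show ?thesis by (simp add: Y_def algebra_simps)
  qed
  then have "Y * (Polynomial.smult 108 [:b, 1:] * v' + [:0, 216:] * v + Y * Polynomial.smult 15
    u) = 0"
    using eq by (simp only: distrib_left mult.assoc add.assoc)
  then have "Polynomial.smult 108 [:b, 1:] * v' + [:0, 216:] * v + Y * Polynomial.smult 15 u = 0"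
    using Y0 by simp
  then have "poly (Polynomial.smult 108 [:b, 1:] * v' + [:0, 216:] * v + Y * Polynomial.smult 15
    u) b = 0"
    by simp
  then have "216 * b * (s' * s * poly u b) + 216 * b * (s * poly u b) = 0"
    by (simp add: Yb vb algebra_simps)
  moreover have "s' + 1 = s" by (simp add: s_def s'_def)
  ultimately have "216 * b * s * s * poly u b = 0" by (simp add: algebra_simps flip: \<open>s' + 1 = s\<close>)
  moreover have two: "(2 :: 'a) \<noteq> 0"
    using of_nat_nonzero_less[of 2, where ?'a = 'a] char by simp
  moreover have three: "(3 :: 'a) \<noteq> 0"
    using of_nat_nonzero_less[of 3, where ?'a = 'a] char by simp
  moreover have "(216 :: 'a) = 2 ^ 3 * 3 ^ 3" by simp
  ultimately have "b = 0" using s0 ub by (metis mult_eq_0_iff power_eq_0_iff)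
  then have "2 ^ 4 * A ^ 3 = 0" using disc by simp
  then show False using two A by (metis mult_eq_0_iff power_eq_0_iff)
qed

lemma map_poly_to_ac_pderiv: "map_poly to_ac (pderiv P) = pderiv (map_poly to_ac P)"
  by (rule poly_eqI) (simp add: coeff_map_poly coeff_pderiv)

lemma hasse_simple_root:
  fixes A :: "'a::field"
  assumes p: "prime (2 * n + 1)" "CHAR('a) = 2 * n + 1" "n \<ge> 2" and A: "A \<noteq> 0"
    and deg: "Polynomial.degree (hasse_poly n A) \<ge> 1"
  shows "\<exists>b. Polynomial.order b (map_poly to_ac (hasse_poly n A)) = 1"
proof -
  define f where "f = map_poly to_ac (hasse_poly n A)"
  have degf: "Polynomial.degree f = Polynomial.degree (hasse_poly n A)" by (simp add: f_def)
  then have f0: "f \<noteq> 0" using deg by auto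
  obtain b where b: "poly f b = 0"
    using alg_closed_imp_poly_has_root[of f] deg degf by auto
  have "map_poly to_ac ([:16 * A ^ 3, 0, 108:] * pderiv (pderiv (hasse_poly n A)) + [:0, 216:] *
    pderiv (hasse_poly n A)
    + [:15:] * hasse_poly n A) = 0"
    using hasse_ode[OF p, of A] by simp
  then have "[:16 * to_ac A ^ 3, 0, 108:] * pderiv (pderiv f) + [:0, 216:] * pderiv f +
    Polynomial.smult 15 f = 0"
    unfolding map_poly_to_ac_add map_poly_to_ac_mult map_poly_to_ac_pderiv f_def[symmetric]
    by (simp add: map_poly_pCons)
  then have "Polynomial.order b f \<le> 1"
    using p A degree_hasse_poly[of n A] degf f0
    by (intro ode_simple_roots[of "2 * n + 1" f "to_ac A"]) auto
  moreover have "Polynomial.order b f \<noteq> 0" using b f0 by (simp add: order_root)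
  ultimately show ?thesis unfolding f_def by (metis le_antisym less_one linorder_not_le)
qed

text \<open>The smallest positive \<open>c\<close> of the parity of \<open>n\<close> works, since
  binomial coefficients with upper index below \<open>p\<close> are nonzero. It leaves the
  admissible range only for \<open>n = 4\<close>, excluded because 9 is composite.\<close>

lemma degree_hasse_poly_pos:
  fixes A :: "'a::field"
  assumes p: "prime (2 * n + 1)" "CHAR('a) = 2 * n + 1" "n \<ge> 3" and A: "A \<noteq> 0"
  shows "Polynomial.degree (hasse_poly n A) \<ge> 1"
proof -
  define c where "c = (if odd n then 1 else 2 :: nat)"
  have "n \<noteq> 4"
  proof
    assume "n = 4"
    moreover have "\<not> prime (9::nat)"
      using prime_nat_iff[of 9] by (auto intro!: exI[of _ 3])
    ultimately show False using p(1) by simp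
  qed
  then have c: "even (n + c)" "(n + c) div 2 \<le> n - c" "c \<le> n" "c \<ge> 1"
    using p(3) by (auto simp: c_def elim!: oddE evenE)
  have nz: "(of_nat (a choose b) :: 'a) \<noteq> 0" if "a \<le> n" "b \<le> a" for a b
  proof -
    have "\<not> 2 * n + 1 dvd fact a" using prime_dvd_fact_iff[OF p(1)] that by simp
    moreover have "(a choose b) dvd fact a"
      using binomial_fact_lemma[OF that(2)] by (metis dvd_triv_right)
    ultimately show ?thesis using p(2) by (metis dvd_trans of_nat_eq_0_iff_char_dvd)
  qed
  have "hasse_coeff n A c \<noteq> 0"
    using c A nz[of n c] nz[of "n - c" "(n + c) div 2"] by (simp add: hasse_coeff_def)
  then have "c \<le> Polynomial.degree (hasse_poly n A)"
    by (intro le_degree) (simp add: coeff_hasse_poly)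
  then show ?thesis using c by simp
qed

section \<open>Counting curves\<close>

text \<open>The singular cubics of this shape are \<open>(x - c) ^ 2 * (x + 2 * c)\<close>.\<close>

lemma bij_singular_curves:
  assumes two: "(2 :: 'a::field) \<noteq> 0" and three: "(3 :: 'a) \<noteq> 0"
  shows "bij_betw (\<lambda>c. (- 3 * c ^ 2, 2 * c ^ 3)) UNIV {(A :: 'a, B). 4 * A ^ 3 + 27 * B ^ 2 = 0}"
proof (rule bij_betwI')
  fix c c' :: 'a
  have "c = c'" if "(- 3 * c ^ 2, 2 * c ^ 3) = (- 3 * c' ^ 2, 2 * c' ^ 3)"
  proof -
    have eq: "c ^ 2 = c' ^ 2" "c ^ 3 = c' ^ 3" using that two three by auto
    show ?thesis
    proof (cases "c = 0")
      case True
      then show ?thesis using eq by simp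
    next
      case False
      have "c * c ^ 2 = c' * c ^ 2" using eq by (simp add: power2_eq_square power3_eq_cube)
      then show ?thesis using False by simp
    qed
  qed
  then show "(- 3 * c ^ 2, 2 * c ^ 3) = (- 3 * c' ^ 2, 2 * c' ^ 3) \<longleftrightarrow> c = c'" by auto
next
  fix c :: 'a
  show "(- 3 * c ^ 2, 2 * c ^ 3) \<in> {(A, B). 4 * A ^ 3 + 27 * B ^ 2 = 0}"
    by (simp add: power2_eq_square power3_eq_cube algebra_simps)
next
  fix P :: "'a \<times> 'a" assume "P \<in> {(A, B). 4 * A ^ 3 + 27 * B ^ 2 = 0}"
  then obtain A B where P: "P = (A, B)" and eq: "4 * A ^ 3 + 27 * B ^ 2 = 0" by auto
  have nz: "(27 :: 'a) \<noteq> 0" "(4 :: 'a) \<noteq> 0"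
    using three two power_not_zero[of "3 :: 'a" 3] power_not_zero[of "2 :: 'a" 2] by simp_all
  show "\<exists>c\<in>UNIV. P = (- 3 * c ^ 2, 2 * c ^ 3)"
  proof (cases "A = 0")
    case True
    then have "B = 0" using eq nz by simp
    then show ?thesis using True P by (intro bexI[of _ 0]) auto
  next
    case False
    \<comment> \<open>The repeated root, recovered from \<open>B / A = - 2 * c / 3\<close>.\<close>
    define c where "c = - (3 * B) / (2 * A)"
    have eq': "27 * B ^ 2 = - (4 * A ^ 3)" using eq by (simp add: eq_neg_iff_add_eq_0 add.commute)
    have "- 3 * c ^ 2 = - (27 * B ^ 2) / (4 * A ^ 2)"
      by (simp add: c_def power_divide power_mult_distrib)
    also have "\<dots> = A"
      unfolding eq' using False nz by (simp add: power2_eq_square power3_eq_cube)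
    finally have 1: "- 3 * c ^ 2 = A" .
    have "3 * (2 * c ^ 3) = - (2 * c * (- 3 * c ^ 2))"
      by (simp add: power2_eq_square power3_eq_cube)
    also have "\<dots> = 3 * B" unfolding 1 using False two by (simp add: c_def)
    finally have 2: "2 * c ^ 3 = B" by (rule mult_left_cancel[OF three, THEN iffD1])
    show ?thesis using 1 2 P by (intro bexI[of _ c]) auto
  qed
qed

lemma prime_ge_5_field_facts:
  assumes p: "prime p" "p \<ge> 5" and "CARD('a::{field,finite}) = p ^ k"
  shows "CHAR('a) = p" "(2 :: 'a) \<noteq> 0" "(3 :: 'a) \<noteq> 0" "odd p" "odd CARD('a)"
proof -
  show char: "CHAR('a) = p" using CHAR_finite_field[OF p(1) assms(3)] .
  show "(2 :: 'a) \<noteq> 0" "(3 :: 'a) \<noteq> 0"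
    using of_nat_nonzero_less[of 2, where ?'a = 'a] of_nat_nonzero_less[of 3, where ?'a = 'a]
      char p(2) by simp_all
  show "odd p" using p prime_odd_nat by simp
  then show "odd CARD('a)" using assms(3) by simp
qed

text \<open>A congruence modulo \<open>p\<close> is an equality in the field, where the trace is the
  norm of the Hasse invariant.\<close>

lemma frob_trace_cong_iff:
  fixes A B :: "'a::{field,finite}"
  assumes p: "prime p" "p \<ge> 5" and card: "CARD('a) = p ^ k"
  shows "[frob_trace A B = int t] (mod int p) \<longleftrightarrow>
    poly (hasse_poly ((p - 1) div 2) A) B ^ ((p ^ k - 1) div (p - 1)) = of_nat t"
proof -
  note facts = prime_ge_5_field_facts[OF p card]
  have n2: "2 * ((p - 1) div 2) = p - 1" using facts(4) by simp
  have "[frob_trace A B = int t] (mod int p) \<longleftrightarrow> (of_int (frob_trace A B) :: 'a) = of_int (int t)"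
    unfolding of_int_eq_iff_cong_CHAR facts(1) ..
  also have "(of_int (frob_trace A B) :: 'a) = poly.coeff ([:B, A, 0, 1:] ^ ((p ^ k - 1) div 2))
    (p ^ k - 1)"
    using of_int_frob_trace[OF facts(5), of A B] by (simp add: card)
  also have "\<dots> = poly.coeff ([:B, A, 0, 1:] ^ ((p - 1) div 2)) (p - 1) ^ ((p ^ k - 1) div (p - 1))"
    by (rule coeff_power_norm[OF p(1) facts(1,4)]) simp
  also have "poly.coeff ([:B, A, 0, 1:] ^ ((p - 1) div 2)) (p - 1) = poly (hasse_poly ((p - 1)
    div 2) A) B"
    unfolding poly_hasse_poly n2 ..
  finally show ?thesis by simp
qed

lemma hasse_poly_2: "poly (hasse_poly 2 A) B = 2 * A"
proof -
  have "{..2::nat} = {0, 1, 2}" by auto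
  then show ?thesis by (simp add: hasse_poly_def hasse_coeff_def monom_0)
qed

lemma card_hasse_fiber:
  fixes A \<tau> :: "'a::{field,finite}"
  assumes p: "prime p" "p \<ge> 7" and k: "k \<ge> 1" and card: "CARD('a) = p ^ k"
    and A: "A \<noteq> 0" and \<tau>: "\<tau> ^ (p - 1) = 1"
  defines "n \<equiv> (p - 1) div 2" and "q \<equiv> p ^ k"
  shows "\<bar>real (card {B. poly (hasse_poly n A) B ^ ((q - 1) div (p - 1)) = \<tau>}) - real q / real
    (p - 1)\<bar>
    \<le> real n * sqrt (real q)"
proof -
  note facts = prime_ge_5_field_facts[OF p(1) _ card]
  have n: "2 * n + 1 = p" "n \<ge> 3" using facts(4) p(2) by (auto simp: n_def)
  have char: "prime (2 * n + 1)" "CHAR('a) = 2 * n + 1" using p facts(1) n by auto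
  have deg: "Polynomial.degree (hasse_poly n A) \<ge> 1"
    using degree_hasse_poly_pos[OF char n(2) A] .
  interpret F: finite_field_poly "hasse_poly n A" p k
  proof
    show "\<exists>b. Polynomial.order b (map_poly to_ac (hasse_poly n A)) = 1"
      using hasse_simple_root[OF char _ A deg] n(2) by simp
  qed (use p k card deg in auto)
  have "\<bar>real (card {B. poly (hasse_poly n A) B ^ ((q - 1) div (p - 1)) = \<tau>}) - real q / real (p
    - 1)\<bar>
    \<le> real (Polynomial.degree (hasse_poly n A)) * sqrt (real q)"
    using F.card_norm_fiber_base[OF \<tau>] unfolding F.q_def q_def .
  also have "\<dots> \<le> real n * sqrt (real q)"
    using degree_hasse_poly[of n A] by (intro mult_right_mono) auto
  finally show ?thesis .
qed

text \<open>Serves \<open>p = 5\<close>, where the fibres are counted in \<open>A\<close>: the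
  polynomial \<open>2 * X\<close> has the simple root 0.\<close>

lemma card_linear_fiber:
  fixes \<tau> :: "'a::{field,finite}"
  assumes p: "prime p" "p \<ge> 5" and k: "k \<ge> 1" and card: "CARD('a) = p ^ k" and \<tau>: "\<tau> ^ (p - 1) = 1"
  defines "q \<equiv> p ^ k"
  shows "\<bar>real (card {A. (2 * A) ^ ((q - 1) div (p - 1)) = \<tau>}) - real q / real (p - 1)\<bar> \<le> sqrt
    (real q)"
proof -
  note facts = prime_ge_5_field_facts[OF p card]
  interpret F: finite_field_poly "[:0, 2 :: 'a:]" p k
  proof
    have two: "(2 :: 'a alg_closure) \<noteq> 0"
    proof -
      have "to_ac (2 :: 'a) \<noteq> 0" using facts(2) by (simp only: to_ac_eq_0_iff not_False_eq_True)
      then show ?thesis by simp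
    qed
    have "map_poly to_ac [:0, 2 :: 'a:] = [:- 0, 1:] ^ 1 * [:2:]" by (simp add: map_poly_pCons)
    moreover have "Polynomial.order 0 ([:- 0, 1:] ^ 1 * [:2 :: 'a alg_closure:]) = 1"
      by (rule order_linear_power_mult) (use two in simp)
    ultimately have "Polynomial.order 0 (map_poly to_ac [:0, 2 :: 'a:]) = 1" by (rule ssubst)
    then show "\<exists>b. Polynomial.order b (map_poly to_ac [:0, 2 :: 'a:]) = 1" by blast
  qed (use p k card facts(2) in auto)
  have "poly [:0, 2 :: 'a:] A = 2 * A" for A by simp
  moreover have "Polynomial.degree [:0, 2 :: 'a:] = 1" using facts(2) by simp
  ultimately show ?thesis
    using F.card_norm_fiber_base[OF \<tau>] unfolding F.q_def q_def by (simp only: of_nat_1 mult_1)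
qed

text \<open>The exceptional index will be \<open>A = 0\<close>, where only the trivial estimate is
  applied.\<close>

lemma sum_bound_except_one:
  fixes f :: "'a::finite \<Rightarrow> real"
  assumes "\<And>x. x \<noteq> a \<Longrightarrow> \<bar>f x - c\<bar> \<le> e" and "\<bar>f a - c\<bar> \<le> e'" and "e \<ge> 0"
  shows "\<bar>(\<Sum>x\<in>UNIV. f x) - real CARD('a) * c\<bar> \<le> real CARD('a) * e + e'"
proof -
  have "(\<Sum>x\<in>UNIV. f x) - real CARD('a) * c = (\<Sum>x\<in>UNIV. f x - c)"
    by (simp add: sum_subtractf)
  also have "\<bar>\<dots>\<bar> \<le> (\<Sum>x\<in>UNIV. \<bar>f x - c\<bar>)" by (rule sum_abs)
  also have "\<dots> \<le> (\<Sum>x\<in>UNIV. e + (if x = a then e' else 0))"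
    using assms by (intro sum_mono) (auto intro: order_trans)
  also have "\<dots> = real CARD('a) * e + e'" by (simp add: sum.distrib)
  finally show ?thesis .
qed

text \<open>Fibre bounds are summed over all \<open>A\<close>, singular pairs included; for
  \<open>p \<ge> 7\<close> the final \<open>real q\<close> pays for \<open>A = 0\<close>.\<close>

lemma card_pairs_trace:
  fixes \<tau> :: "'a::{field,finite}"
  assumes p: "prime p" "p \<ge> 5" and k: "k \<ge> 1" and card: "CARD('a) = p ^ k" and \<tau>: "\<tau> ^ (p - 1) = 1"
  defines "n \<equiv> (p - 1) div 2" and "q \<equiv> p ^ k"
  shows "\<bar>real (card {(A, B). poly (hasse_poly n A) B ^ ((q - 1) div (p - 1)) = \<tau>}) - real q *
    (real q / real (p - 1))\<bar>
    \<le> real q * (real n * sqrt (real q)) + real q"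
proof -
  define e where "e = (q - 1) div (p - 1)"
  define W where "W = {(A, B). poly (hasse_poly n A) B ^ e = \<tau>}"
  have cq: "real CARD('a) = real q" by (simp add: card q_def)
  have n1: "n \<ge> 1" using p(2) by (simp add: n_def)
  consider "p = 5" | "p \<ge> 7"
  proof -
    have "p \<noteq> 6"
    proof
      assume "p = 6"
      then have "even p" by simp
      then show False using prime_ge_5_field_facts(4)[OF p card] by simp
    qed
    then show ?thesis using that p(2) by linarith
  qed
  then have "\<bar>real (card W) - real q * (real q / real (p - 1))\<bar> \<le> real q * (real n * sqrt (real
    q)) + real q"
  proof cases
    case 1
    then have n2: "n = 2" by (simp add: n_def)
    have "W = {A. (2 * A) ^ e = \<tau>} \<times> UNIV" by (auto simp: W_def n2 hasse_poly_2)
    then have "real (card W) - real q * (real q / real (p - 1)) =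
        real q * (real (card {A. (2 * A) ^ e = \<tau>}) - real q / real (p - 1))"
      using cq by (simp add: card_cartesian_product algebra_simps)
    also have "\<bar>\<dots>\<bar> = real q * \<bar>real (card {A. (2 * A) ^ e = \<tau>}) - real q / real (p - 1)\<bar>"
      by (simp add: abs_mult)
    also have "\<dots> \<le> real q * sqrt (real q)"
      using card_linear_fiber[OF p k card \<tau>] unfolding e_def q_def by (intro mult_left_mono) auto
    also have "\<dots> \<le> real q * (real n * sqrt (real q)) + real q"
    proof -
      have "1 * sqrt (real q) \<le> real n * sqrt (real q)" using n1 by (intro mult_right_mono) auto
      then have "real q * sqrt (real q) \<le> real q * (real n * sqrt (real q))" by (intro
        mult_left_mono) auto
      then show ?thesis by simp
    qed
    finally show ?thesis .
  next
    case 2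
    have "W = (SIGMA A:UNIV. {B. poly (hasse_poly n A) B ^ e = \<tau>})" by (auto simp: W_def)
    then have "card W = (\<Sum>A\<in>UNIV. card {B. poly (hasse_poly n A) B ^ e = \<tau>})"
      by (simp add: card_SigmaI)
    then have W: "real (card W) = (\<Sum>A\<in>UNIV. real (card {B. poly (hasse_poly n A) B ^ e = \<tau>}))"
      by simp
    have "\<bar>real (card {B. poly (hasse_poly n 0) B ^ e = \<tau>}) - real q / real (p - 1)\<bar> \<le> real q"
    proof -
      define x y where "x = real (card {B. poly (hasse_poly n 0) B ^ e = \<tau>})"
        and "y = real q / real (p - 1)"
      have "x \<le> real q"
        using card_mono[of UNIV "{B. poly (hasse_poly n 0) B ^ e = \<tau>}"] card by (simp add: x_def
          q_def)
      moreover have "0 \<le> x" "0 \<le> y" by (simp_all add: x_def y_def)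
      moreover have "y \<le> real q / 1"
        unfolding y_def using p(2) by (intro divide_left_mono) auto
      ultimately have "\<bar>x - y\<bar> \<le> real q" by linarith
      then show ?thesis unfolding x_def y_def .
    qed
    then have "\<bar>(\<Sum>A\<in>UNIV. real (card {B. poly (hasse_poly n A) B ^ e = \<tau>})) - real CARD('a) *
      (real q / real (p - 1))\<bar>
        \<le> real CARD('a) * (real n * sqrt (real q)) + real q"
    proof (rule sum_bound_except_one[rotated])
      fix A :: 'a assume "A \<noteq> 0"
      from card_hasse_fiber[OF p(1) 2 k card this \<tau>]
      show "\<bar>real (card {B. poly (hasse_poly n A) B ^ e = \<tau>}) - real q / real (p - 1)\<bar> \<le> real n
        * sqrt (real q)"
        unfolding n_def q_def e_def .
    qed simp
    then show ?thesis unfolding W cq .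
  qed
  then show ?thesis by (simp add: W_def e_def)
qed

theorem theorem11:
  fixes p k t :: nat
    and S S\<^sub>t :: "('a::{field, finite} \<times> 'a) set"
  assumes "prime p" and "p \<ge> 5" and "k \<ge> 1" and "t \<in> {1..p - 1}"
    and "CARD('a) = p ^ k"
  defines "S \<equiv> {(A, B). 4 * A ^ 3 + 27 * B ^ 2 \<noteq> 0}"
    and "S\<^sub>t \<equiv> {(A, B) \<in> S. [frob_trace A B = int t] (mod int p)}"
  shows "int (card S) = int p ^ (2 * k) - int p ^ k \<and>
    \<bar>real (card S\<^sub>t) - real (card S) / (real p - 1)\<bar> \<le> 3 * real p powr (3 * real k / 2 + 1)"
proof -
  note facts = prime_ge_5_field_facts[OF assms(1,2,5)]
  define q where "q = p ^ k"
  define n where "n = (p - 1) div 2"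
  define Z where "Z = {(A :: 'a, B). 4 * A ^ 3 + 27 * B ^ 2 = 0}"
  define W where "W = {(A :: 'a, B). poly (hasse_poly n A) B ^ ((q - 1) div (p - 1)) = of_nat t}"
  have q1: "q \<ge> 1" using assms(2) by (simp add: q_def)
  have card_Z: "card Z = q"
    using bij_betw_same_card[OF bij_singular_curves[OF facts(2,3)]] assms(5) by (simp add: Z_def
      q_def)
  have S: "S = UNIV - Z" by (auto simp: S_def Z_def)
  have card_UNIV: "card (UNIV :: ('a \<times> 'a) set) = q * q"
    by (simp add: card_cartesian_product assms(5) q_def flip: UNIV_Times_UNIV)
  have card_S: "card S = q * q - q"
    unfolding S using card_Z card_UNIV by (subst card_Diff_subset) auto
  have qq: "q \<le> q * q" using q1 by simp
  have first: "int (card S) = int p ^ (2 * k) - int p ^ k"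
    unfolding card_S using qq by (simp add: of_nat_diff q_def power_add mult_2)
  have St: "S\<^sub>t = W - Z"
    unfolding S\<^sub>t_def S W_def frob_trace_cong_iff[OF assms(1,2,5)] n_def q_def by auto
  \<comment> \<open>Fermat's theorem places the image of \<open>t\<close> among the possible nonzero
    norms.\<close>
  have "\<not> p dvd t" using assms(4) by (auto dest: dvd_imp_le)
  then have "[t ^ (p - 1) = 1] (mod p)" by (rule fermat_theorem[OF assms(1)])
  then have "of_nat (t ^ (p - 1)) = (of_nat 1 :: 'a)"
    unfolding of_nat_eq_iff_cong_CHAR facts(1) .
  then have "(of_nat t :: 'a) ^ (p - 1) = 1" by simp
  from card_pairs_trace[OF assms(1,2,3,5) this]
  have W: "\<bar>real (card W) - real q * (real q / real (p - 1))\<bar> \<le> real q * (real n * sqrt (real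
    q)) + real q"
    unfolding W_def n_def q_def .
  have "card W \<le> card S\<^sub>t + q"
    unfolding St using diff_card_le_card_Diff[of Z W] card_Z by simp
  moreover have "card S\<^sub>t \<le> card W" unfolding St by (intro card_mono) auto
  ultimately have St_W: "real (card S\<^sub>t) \<le> real (card W)" "real (card W) \<le> real (card S\<^sub>t) + real q"
    by linarith+
  define d where "d = real p - 1"
  have d: "d \<ge> 4" "real (p - 1) = d" using assms(2) by (auto simp: d_def of_nat_diff)
  have "real (card S) / d = real q * (real q / d) - real q / d"
    unfolding card_S using qq by (simp add: of_nat_diff diff_divide_distrib)
  moreover have "0 \<le> real q / d" "real q / d \<le> real q"
    using d(1) by (auto simp: divide_le_eq mult_le_cancel_left1)
  \<comment> \<open>Three errors of size \<open>q\<close> add up: from \<open>A = 0\<close> in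
    \<open>W\<close>, from removing the singular pairs, and from replacing \<open>q * q / d\<close>
    by \<open>card S / d\<close>.\<close>
  ultimately have "\<bar>real (card S\<^sub>t) - real (card S) / d\<bar> \<le> real q * (real n * sqrt (real q)) + 3
    * real q"
    using W[unfolded d(2) abs_le_iff] St_W by (intro abs_leI) linarith+
  also have "\<dots> \<le> real q * (real n * sqrt (real q)) + 3 * (real q * sqrt (real q))"
    using q1 by (simp add: mult_le_cancel_left1)
  also have "\<dots> = (real n + 3) * (real q * sqrt (real q))"
    by (simp add: algebra_simps)
  also have "\<dots> \<le> (3 * real p) * (real q * sqrt (real q))"
  proof (rule mult_right_mono)
    have "n + 3 \<le> 3 * p" using assms(2) by (simp add: n_def)
    then show "real n + 3 \<le> 3 * real p" by linarith
  qed simp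
  also have "\<dots> = 3 * real p powr (3 * real k / 2 + 1)"
  proof -
    have p0: "real p > 0" using assms(2) by simp
    have rq: "real q = real p powr real k" using p0 by (simp add: q_def powr_realpow)
    have "sqrt (real q) = real p powr (real k / 2)"
      unfolding rq using p0 by (simp add: powr_half_sqrt[symmetric] powr_powr)
    then have "real q * sqrt (real q) = real p powr (3 * real k / 2)"
      unfolding rq using p0 by (simp flip: powr_add)
    then show ?thesis using p0 by (simp add: powr_add)
  qed
  finally show ?thesis using first by (simp add: d_def)
qed

end
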